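(* Let $A$ be an Artin algebra which is a Gorenstein algebra, and suppose that every finitely generated Gorenstein projective left $A$-module is periodic. Then $$\operatorname{qgldim}(A)=\sup\{\operatorname{Gpd}_A(M)\mid M\in A\text{-mod}\}=\operatorname{G.gldim}(A)=\operatorname{id}({}_AA),$$ where $\operatorname{id}({}_AA)$ is the injective dimension of the left regular module.
   Context: $A\text{-mod}$ is the category of finitely generated left $A$-modules. An Artin algebra $A$ is a Gorenstein algebra if the injective dimensions of ${}_AA$ and of $A_A$ are both finite. All dimensions below are taken in the abelian category $\mathcal{A}=A\text{-mod}$. Complexes are indexed homologically (differentials lower the degree by one); $\operatorname{sup}X_\bullet=\sup\{i\mid X_i\neq 0\}$, $\operatorname{inf}X_\bullet=\inf\{i\mid X_i\ne 0\}$, $\operatorname{hsup}X_\bullet=\sup\{i\mid \operatorname{H}_i(X_\bullet)\neq 0\}$. A complex is bounded below if $\operatorname{inf}X_\bullet>-\infty$. An object $G$ of $\mathcal{A}$ is Gorenstein projective if there is an exact sequence $\cdots\to P_1\to P_0\to P_{-1}\to P_{-2}\to\cdots$ of projective objects which stays exact after applying $\operatorname{Hom}_{\mathcal{A}}(-,P)$ for every projective $P$, such that $G\cong\operatorname{Im}(P_0\to P_{-1})$. $\operatorname{Gpd}_A M$ is the smallest integer $n\ge 0$ such that there is an exact sequence $0\to G_n\to\cdots\to G_0\to M\to 0$ with all $G_i$ Gorenstein projective, and $\infty$ if there is none. The Gorenstein global dimension is $\operatorname{G.gldim}(A)=\sup\{\operatorname{Gpd}_AM\mid M\in A\text{-mod}\}$.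 A module $M$ is periodic if $\Omega^r M\cong M$ for some $r\geq 1$, i.e. there is an exact sequence $0\to M\to P_{r-1}\to\cdots\to P_0\to M\to 0$ with all $P_i$ projective and $r\ge 1$. A quasi-projective resolution of $M$ is a bounded below complex $P_\bullet$ of projective objects such that for all $i\geq\operatorname{inf}P_\bullet$ there are nonnegative integers $a_i$, not all zero, with $\operatorname{H}_i(P_\bullet)\cong M^{\oplus a_i}$; it is finite if $\operatorname{sup}P_\bullet<\infty$. The quasi-projective dimension is $\operatorname{qpd}_{A}M=\inf\{\operatorname{sup}P_\bullet-\operatorname{hsup}P_\bullet\mid P_\bullet\text{ a finite quasi-projective resolution of }M\}$, and $\infty$ if $M$ has no finite quasi-projective resolution; by convention $\operatorname{qpd}_A0=0$. The quasi-global dimension is $\operatorname{qgldim}(A)=\sup\{\operatorname{qpd}_A(M)\mid M\in A\text{-mod}\}$. *)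

theory Defs
  imports "HOL-Algebra.Module" "HOL-Algebra.Ideal" "HOL-Library.Extended_Real"
begin

section \<open>Left modules over a not necessarily commutative ring\<close>

text \<open>The library locale \<^locale>\<open>module\<close> has the same axioms, but requires the ring of scalars to be
  commutative. As there, the fields \<^const>\<open>mult\<close> and \<^const>\<open>one\<close> of the record of a module carry no
  meaning.\<close>

locale left_module = R?: ring R + M?: abelian_group M
  for R :: "('a, 'r) ring_scheme" (structure) and M :: "('a, 'b, 'm) module_scheme" (structure) +
  assumes smult_closed [simp, intro]:
      "\<lbrakk>a \<in> carrier R; x \<in> carrier M\<rbrakk> \<Longrightarrow> a \<odot>\<^bsub>M\<^esub> x \<in> carrier M"
    and smult_l_distr:
      "\<lbrakk>a \<in> carrier R; b \<in> carrier R; x \<in> carrier M\<rbrakk> \<Longrightarrow>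
        (a \<oplus> b) \<odot>\<^bsub>M\<^esub> x = a \<odot>\<^bsub>M\<^esub> x \<oplus>\<^bsub>M\<^esub> b \<odot>\<^bsub>M\<^esub> x"
    and smult_r_distr:
      "\<lbrakk>a \<in> carrier R; x \<in> carrier M; y \<in> carrier M\<rbrakk> \<Longrightarrow>
        a \<odot>\<^bsub>M\<^esub> (x \<oplus>\<^bsub>M\<^esub> y) = a \<odot>\<^bsub>M\<^esub> x \<oplus>\<^bsub>M\<^esub> a \<odot>\<^bsub>M\<^esub> y"
    and smult_assoc1:
      "\<lbrakk>a \<in> carrier R; b \<in> carrier R; x \<in> carrier M\<rbrakk> \<Longrightarrow>
        (a \<otimes> b) \<odot>\<^bsub>M\<^esub> x = a \<odot>\<^bsub>M\<^esub> (b \<odot>\<^bsub>M\<^esub> x)"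
    and smult_one [simp]:
      "x \<in> carrier M \<Longrightarrow> \<one> \<odot>\<^bsub>M\<^esub> x = x"

definition fin_gen :: "('a, 'r) ring_scheme \<Rightarrow> ('a, 'b, 'm) module_scheme \<Rightarrow> bool" where
  "fin_gen R M \<longleftrightarrow>
    (\<exists>S. finite S \<and> S \<subseteq> carrier M \<and> (\<forall>H. submodule H R M \<longrightarrow> S \<subseteq> H \<longrightarrow> H = carrier M))"

definition zero_mod :: "('a, 'b, 'm) module_scheme \<Rightarrow> bool" where
  "zero_mod M \<longleftrightarrow> carrier M = {\<zero>\<^bsub>M\<^esub>}"

definition mod_hom ::
  "('a, 'r) ring_scheme \<Rightarrow> ('a, 'b, 'm) module_scheme \<Rightarrow> ('a, 'c, 'n) module_scheme \<Rightarrow> ('b \<Rightarrow> 'c) set"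
  where "mod_hom R M N =
    {f \<in> hom (add_monoid M) (add_monoid N).
      \<forall>a\<in>carrier R. \<forall>x\<in>carrier M. f (a \<odot>\<^bsub>M\<^esub> x) = a \<odot>\<^bsub>N\<^esub> f x}"

definition mod_iso ::
  "('a, 'r) ring_scheme \<Rightarrow> ('a, 'b, 'm) module_scheme \<Rightarrow> ('a, 'c, 'n) module_scheme \<Rightarrow> bool"
  where "mod_iso R M N \<longleftrightarrow> (\<exists>f\<in>mod_hom R M N. bij_betw f (carrier M) (carrier N))"

definition quot_mod :: "('a, 'b, 'm) module_scheme \<Rightarrow> 'b set \<Rightarrow> ('a, 'b set) module" where
  "quot_mod M H =
    \<lparr>carrier = a_rcosets\<^bsub>M\<^esub> H, mult = undefined, one = undefined, zero = H, add = set_add M,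
     smult = (\<lambda>a X. \<Union>x\<in>X. H +>\<^bsub>M\<^esub> (a \<odot>\<^bsub>M\<^esub> x))\<rparr>"

text \<open>\<^term>\<open>mod_power M n\<close> is the direct sum of \<open>n\<close> copies of \<open>M\<close>.\<close>

definition mod_power :: "('a, 'b, 'm) module_scheme \<Rightarrow> nat \<Rightarrow> ('a, nat \<Rightarrow> 'b) module" where
  "mod_power M n =
    \<lparr>carrier = {..<n} \<rightarrow>\<^sub>E carrier M, mult = undefined, one = undefined,
     zero = (\<lambda>i\<in>{..<n}. \<zero>\<^bsub>M\<^esub>), add = (\<lambda>x y. \<lambda>i\<in>{..<n}. x i \<oplus>\<^bsub>M\<^esub> y i),
     smult = (\<lambda>a x. \<lambda>i\<in>{..<n}. a \<odot>\<^bsub>M\<^esub> x i)\<rparr>"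

definition reg_mod :: "('a, 'r) ring_scheme \<Rightarrow> ('a, 'a) module" where
  "reg_mod R =
    \<lparr>carrier = carrier R, mult = mult R, one = one R, zero = zero R, add = add R, smult = mult R\<rparr>"

text \<open>Right modules are treated as left modules over the opposite ring.\<close>

definition op_ring :: "('a, 'r) ring_scheme \<Rightarrow> 'a ring" where
  "op_ring R =
    \<lparr>carrier = carrier R, mult = (\<lambda>x y. y \<otimes>\<^bsub>R\<^esub> x), one = one R, zero = zero R, add = add R\<rparr>"


section \<open>The category of finitely generated modules\<close>

text \<open>The elements of the modules in the category are taken from the type \<open>(nat \<Rightarrow> 'a) set\<close>, which
  contains the cosets of submodules of the free modules of finite rank. By \<open>fg_mod_representative\<close>
  below, every finitely generated left module, with elements of any type, is isomorphic to an object
  of \<open>fg_mod R\<close>.\<close>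

type_synonym 'a fgm = "('a, (nat \<Rightarrow> 'a) set) module"
type_synonym 'a fgmap = "(nat \<Rightarrow> 'a) set \<Rightarrow> (nat \<Rightarrow> 'a) set"

definition fg_mod :: "('a, 'r) ring_scheme \<Rightarrow> 'a fgm set" where
  "fg_mod R = {M. left_module R M \<and> fin_gen R M}"

definition proj_obj :: "('a, 'r) ring_scheme \<Rightarrow> 'a fgm \<Rightarrow> bool" where
  "proj_obj R P \<longleftrightarrow> P \<in> fg_mod R \<and>
    (\<forall>M\<in>fg_mod R. \<forall>N\<in>fg_mod R. \<forall>g\<in>mod_hom R M N. \<forall>f\<in>mod_hom R P N.
      g ` carrier M = carrier N \<longrightarrow> (\<exists>h\<in>mod_hom R P M. \<forall>x\<in>carrier P. g (h x) = f x))"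

definition inj_obj :: "('a, 'r) ring_scheme \<Rightarrow> 'a fgm \<Rightarrow> bool" where
  "inj_obj R I \<longleftrightarrow> I \<in> fg_mod R \<and>
    (\<forall>M\<in>fg_mod R. \<forall>N\<in>fg_mod R. \<forall>g\<in>mod_hom R M N. \<forall>f\<in>mod_hom R M I.
      inj_on g (carrier M) \<longrightarrow> (\<exists>h\<in>mod_hom R N I. \<forall>x\<in>carrier M. h (g x) = f x))"

context left_module
begin

lemma smult_l_null: "x \<in> carrier M \<Longrightarrow> \<zero> \<odot>\<^bsub>M\<^esub> x = \<zero>\<^bsub>M\<^esub>"
  by (metis M.add.r_cancel_one' R.l_zero R.zero_closed smult_closed smult_l_distr)

lemma smult_r_null: "a \<in> carrier R \<Longrightarrow> a \<odot>\<^bsub>M\<^esub> \<zero>\<^bsub>M\<^esub> = \<zero>\<^bsub>M\<^esub>"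
  by (metis M.add.r_cancel_one' M.l_zero M.zero_closed smult_closed smult_r_distr)

lemma smult_minus_one: "x \<in> carrier M \<Longrightarrow> (\<ominus> \<one>) \<odot>\<^bsub>M\<^esub> x = \<ominus>\<^bsub>M\<^esub> x"
  by (metis M.minus_equality R.add.inv_closed R.l_neg R.one_closed smult_closed smult_l_distr
      smult_l_null smult_one)

lemma finsum_smult_ldistr:
  "\<lbrakk>finite I; a \<in> carrier R; f \<in> I \<rightarrow> carrier M\<rbrakk> \<Longrightarrow>
    a \<odot>\<^bsub>M\<^esub> (\<Oplus>\<^bsub>M\<^esub>i\<in>I. f i) = (\<Oplus>\<^bsub>M\<^esub>i\<in>I. a \<odot>\<^bsub>M\<^esub> f i)"
  by (induct set: finite) (simp_all add: smult_r_null Pi_def smult_r_distr)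

lemma lincombs_submodule:
  assumes g: "g \<in> {..<n} \<rightarrow> carrier M"
  shows "submodule {\<Oplus>\<^bsub>M\<^esub>i\<in>{..<n::nat}. v i \<odot>\<^bsub>M\<^esub> g i | v. v \<in> {..<n} \<rightarrow> carrier R} R M"
    (is "submodule ?L R M")
proof -
  have gi: "i < n \<Longrightarrow> g i \<in> carrier M" for i using g by auto
  have sm: "a \<odot>\<^bsub>M\<^esub> x \<in> ?L" if a: "a \<in> carrier R" and x: "x \<in> ?L" for a x
  proof -
    obtain v where v: "v \<in> {..<n} \<rightarrow> carrier R" "x = (\<Oplus>\<^bsub>M\<^esub>i\<in>{..<n}. v i \<odot>\<^bsub>M\<^esub> g i)"
      using x by blast
    have "a \<odot>\<^bsub>M\<^esub> x = (\<Oplus>\<^bsub>M\<^esub>i\<in>{..<n}. a \<odot>\<^bsub>M\<^esub> (v i \<odot>\<^bsub>M\<^esub> g i))"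
      unfolding v(2) using v gi a by (intro finsum_smult_ldistr) auto
    also have "\<dots> = (\<Oplus>\<^bsub>M\<^esub>i\<in>{..<n}. (a \<otimes> v i) \<odot>\<^bsub>M\<^esub> g i)"
      using v gi a by (intro M.finsum_cong') (auto simp: smult_assoc1 Pi_def)
    finally show ?thesis using v a by (auto intro!: exI[of _ "\<lambda>i. a \<otimes> v i"])
  qed
  have sub: "?L \<subseteq> carrier M" using gi by (auto intro!: M.finsum_closed)
  have ad: "x \<oplus>\<^bsub>M\<^esub> y \<in> ?L" if x: "x \<in> ?L" and y: "y \<in> ?L" for x y
  proof -
    obtain v where v: "v \<in> {..<n} \<rightarrow> carrier R" "x = (\<Oplus>\<^bsub>M\<^esub>i\<in>{..<n}. v i \<odot>\<^bsub>M\<^esub> g i)"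
      using x by blast
    obtain w where w: "w \<in> {..<n} \<rightarrow> carrier R" "y = (\<Oplus>\<^bsub>M\<^esub>i\<in>{..<n}. w i \<odot>\<^bsub>M\<^esub> g i)"
      using y by blast
    have "x \<oplus>\<^bsub>M\<^esub> y = (\<Oplus>\<^bsub>M\<^esub>i\<in>{..<n}. v i \<odot>\<^bsub>M\<^esub> g i \<oplus>\<^bsub>M\<^esub> w i \<odot>\<^bsub>M\<^esub> g i)"
      unfolding v(2) w(2) using v w gi by (intro M.finsum_addf[symmetric]) auto
    also have "\<dots> = (\<Oplus>\<^bsub>M\<^esub>i\<in>{..<n}. (v i \<oplus> w i) \<odot>\<^bsub>M\<^esub> g i)"
      using v w gi by (intro M.finsum_cong') (auto simp: smult_l_distr Pi_def)
    finally show ?thesis using v w by (auto intro!: exI[of _ "\<lambda>i. v i \<oplus> w i"])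
  qed
  have "\<zero>\<^bsub>M\<^esub> = (\<Oplus>\<^bsub>M\<^esub>i\<in>{..<n}. \<zero> \<odot>\<^bsub>M\<^esub> g i)"
    using gi by (subst M.finsum_cong'[where g = "\<lambda>_. \<zero>\<^bsub>M\<^esub>", OF refl]) (auto simp: smult_l_null)
  then have ze: "\<zero>\<^bsub>M\<^esub> \<in> ?L" by (auto intro!: exI[of _ "\<lambda>_. \<zero>"])
  have inv: "\<ominus>\<^bsub>M\<^esub> x \<in> ?L" if x: "x \<in> ?L" for x
    using sm[OF _ x, of "\<ominus> \<one>"] sub x by (auto simp: smult_minus_one subset_iff)
  show ?thesis
  proof (intro submodule.intro subgroup.intro submodule_axioms.intro)
    show "inv\<^bsub>add_monoid M\<^esub> x \<in> ?L" if "x \<in> ?L" for x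
      using inv[OF that] by (simp add: a_inv_def)
  qed (use sub ad ze sm in auto)
qed

end

lemma mod_transport:
  fixes R :: "('a, 'r) ring_scheme" and M :: "('a, 'b, 'm) module_scheme" and e :: "'b \<Rightarrow> 'c"
  assumes M: "left_module R M" and fg: "fin_gen R M" and e: "inj_on e (carrier M)"
  shows "\<exists>N :: ('a, 'c) module. left_module R N \<and> fin_gen R N \<and> mod_iso R M N"
proof -
  interpret left_module R M by (rule M)
  define e' where "e' = the_inv_into (carrier M) e"
  have e': "x \<in> carrier M \<Longrightarrow> e' (e x) = x" for x
    by (simp add: e'_def the_inv_into_f_f[OF e])
  define N :: "('a, 'c) module" where
    "N = \<lparr>carrier = e ` carrier M, mult = undefined, one = undefined, zero = e \<zero>\<^bsub>M\<^esub>,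
      add = (\<lambda>x y. e (e' x \<oplus>\<^bsub>M\<^esub> e' y)), smult = (\<lambda>a x. e (a \<odot>\<^bsub>M\<^esub> e' x))\<rparr>"
  have N: "carrier N = e ` carrier M" "\<zero>\<^bsub>N\<^esub> = e \<zero>\<^bsub>M\<^esub>" "x \<oplus>\<^bsub>N\<^esub> y = e (e' x \<oplus>\<^bsub>M\<^esub> e' y)"
    "a \<odot>\<^bsub>N\<^esub> x = e (a \<odot>\<^bsub>M\<^esub> e' x)" for a x y
    by (simp_all add: N_def)
  have agN: "abelian_group N"
  proof (rule abelian_groupI)
    show "\<exists>y\<in>carrier N. y \<oplus>\<^bsub>N\<^esub> x = \<zero>\<^bsub>N\<^esub>" if x: "x \<in> carrier N" for x
    proof -
      from x obtain z where "z \<in> carrier M" "x = e z" by (auto simp: N)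
      then show ?thesis by (intro bexI[of _ "e (\<ominus>\<^bsub>M\<^esub> z)"]) (auto simp: N e' M.l_neg)
    qed
  qed (auto simp: N e' M.a_ac)
  have lmN: "left_module R N"
    using agN R.ring_axioms
    by (intro left_module.intro left_module_axioms.intro)
      (auto simp: N e' smult_l_distr smult_r_distr smult_assoc1)
  have hom: "e \<in> mod_hom R M N"
    by (auto simp: mod_hom_def hom_def N e')
  have iso: "mod_iso R M N"
    unfolding mod_iso_def using hom e by (intro bexI[of _ e]) (auto simp: bij_betw_def N)
  obtain S where S: "finite S" "S \<subseteq> carrier M"
    "\<And>H. submodule H R M \<Longrightarrow> S \<subseteq> H \<Longrightarrow> H = carrier M"
    using fg unfolding fin_gen_def by blast
  interpret N: left_module R N by (rule lmN)
  have "K = carrier N" if K: "submodule K R N" and SK: "e ` S \<subseteq> K" for K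
  proof -
    interpret K: submodule K R N by (rule K)
    have Ksub: "K \<subseteq> e ` carrier M" using K.subset by (simp add: N)
    define H where "H = {x \<in> carrier M. e x \<in> K}"
    have inv: "e (\<ominus>\<^bsub>M\<^esub> x) \<in> K" if "x \<in> carrier M" "e x \<in> K" for x
    proof -
      have "e (\<ominus>\<^bsub>M\<^esub> x) = (\<ominus>\<^bsub>R\<^esub> \<one>\<^bsub>R\<^esub>) \<odot>\<^bsub>N\<^esub> e x"
        using that by (simp add: N e' smult_minus_one)
      then show ?thesis using K.smult_closed that by simp
    qed
    have "submodule H R M"
    proof (intro submodule.intro subgroup.intro submodule_axioms.intro)
      show "x \<otimes>\<^bsub>add_monoid M\<^esub> y \<in> H" if "x \<in> H" "y \<in> H" for x y
        using that K.m_closed[of "e x" "e y"] by (auto simp: H_def N e')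
      show "inv\<^bsub>add_monoid M\<^esub> x \<in> H" if "x \<in> H" for x
        using that inv[of x] M.a_inv_closed[of x] by (auto simp: H_def a_inv_def)
      show "\<one>\<^bsub>add_monoid M\<^esub> \<in> H" using K.one_closed by (auto simp: H_def N)
      show "a \<odot>\<^bsub>M\<^esub> x \<in> H" if "a \<in> carrier R" "x \<in> H" for a x
        using that K.smult_closed[of a "e x"] by (auto simp: H_def N e')
    qed (auto simp: H_def)
    moreover have "S \<subseteq> H" using SK S by (auto simp: H_def)
    ultimately have "H = carrier M" by (rule S(3))
    then show ?thesis using Ksub by (auto simp: H_def N)
  qed
  then have "fin_gen R N"
    unfolding fin_gen_def using S by (intro exI[of _ "e ` S"]) (auto simp: N)
  with lmN iso show ?thesis by blast
qed

lemma fg_mod_representative: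
  fixes R :: "('a, 'r) ring_scheme" and M :: "('a, 'b, 'm) module_scheme"
  assumes M: "left_module R M" and fg: "fin_gen R M"
  shows "\<exists>N\<in>fg_mod R. mod_iso R M N"
proof -
  interpret left_module R M by (rule M)
  obtain S where S: "finite S" "S \<subseteq> carrier M"
    "\<And>H. submodule H R M \<Longrightarrow> S \<subseteq> H \<Longrightarrow> H = carrier M"
    using fg unfolding fin_gen_def by blast
  obtain n and g :: "nat \<Rightarrow> 'b" where g: "g ` {..<n} = S"
    using S(1) by (metis finite_imp_nat_seg_image_inj_on lessThan_def)
  define c where "c v = (\<Oplus>\<^bsub>M\<^esub>i\<in>{..<n}. v i \<odot>\<^bsub>M\<^esub> g i)" for v
  define L where "L = {c v | v. v \<in> {..<n} \<rightarrow> carrier R}"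
  have gM: "g \<in> {..<n} \<rightarrow> carrier M" using g S by auto
  have "submodule L R M"
    unfolding L_def c_def by (rule lincombs_submodule[OF gM])
  moreover have "S \<subseteq> L"
  proof
    fix s assume "s \<in> S"
    then obtain j where j: "j < n" "s = g j" using g by auto
    have "c (\<lambda>i. if i = j then \<one>\<^bsub>R\<^esub> else \<zero>\<^bsub>R\<^esub>) = (\<Oplus>\<^bsub>M\<^esub>i\<in>{..<n}. if j = i then g i else \<zero>\<^bsub>M\<^esub>)"
      unfolding c_def using gM by (intro M.finsum_cong') (auto simp: smult_l_null Pi_def)
    also have "\<dots> = g j" using j gM by (intro M.finsum_singleton) auto
    finally show "s \<in> L" unfolding L_def j
      by (auto intro!: exI[of _ "\<lambda>i. if i = j then \<one>\<^bsub>R\<^esub> else \<zero>\<^bsub>R\<^esub>"])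
  qed
  ultimately have "L = carrier M" by (rule S(3))
  then have LM: "carrier M = L" ..
  have surj: "\<exists>v. c v = x" if "x \<in> carrier M" for x
    using that unfolding LM L_def by blast
  have "inj_on (\<lambda>x. {v. c v = x}) (carrier M)"
    using surj unfolding inj_on_def by blast
  then show ?thesis
    using mod_transport[OF M fg] unfolding fg_mod_def by blast
qed


section \<open>Complexes\<close>

text \<open>Complexes are indexed homologically: \<open>d i\<close> maps \<open>X i\<close> to \<open>X (i - 1)\<close>. A finite exact sequence
  is an exact complex with zero modules at the remaining places.\<close>

definition mod_complex ::
  "('a, 'r) ring_scheme \<Rightarrow> (int \<Rightarrow> 'a fgm) \<Rightarrow> (int \<Rightarrow> 'a fgmap) \<Rightarrow> bool" where
  "mod_complex R X d \<longleftrightarrow>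
    (\<forall>i. X i \<in> fg_mod R \<and> d i \<in> mod_hom R (X i) (X (i - 1)) \<and>
      (\<forall>x\<in>carrier (X i). d (i - 1) (d i x) = \<zero>\<^bsub>X (i - 2)\<^esub>))"

definition exact_complex ::
  "('a, 'r) ring_scheme \<Rightarrow> (int \<Rightarrow> 'a fgm) \<Rightarrow> (int \<Rightarrow> 'a fgmap) \<Rightarrow> bool" where
  "exact_complex R X d \<longleftrightarrow> mod_complex R X d \<and>
    (\<forall>i. d (i + 1) ` carrier (X (i + 1)) = a_kernel (X i) (X (i - 1)) (d i))"

definition homology ::
  "(int \<Rightarrow> 'a fgm) \<Rightarrow> (int \<Rightarrow> 'a fgmap) \<Rightarrow> int \<Rightarrow> ('a, (nat \<Rightarrow> 'a) set set) module" where
  "homology X d i =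
    quot_mod ((X i)\<lparr>carrier := a_kernel (X i) (X (i - 1)) (d i)\<rparr>)
      (d (i + 1) ` carrier (X (i + 1)))"

definition sup_cpx :: "(int \<Rightarrow> 'a fgm) \<Rightarrow> ereal" where
  "sup_cpx X = (SUP i\<in>{i. \<not> zero_mod (X i)}. ereal (of_int i))"

definition inf_cpx :: "(int \<Rightarrow> 'a fgm) \<Rightarrow> ereal" where
  "inf_cpx X = (INF i\<in>{i. \<not> zero_mod (X i)}. ereal (of_int i))"

definition hsup_cpx :: "(int \<Rightarrow> 'a fgm) \<Rightarrow> (int \<Rightarrow> 'a fgmap) \<Rightarrow> ereal" where
  "hsup_cpx X d = (SUP i\<in>{i. \<not> zero_mod (homology X d i)}. ereal (of_int i))"


section \<open>Gorenstein projective and periodic modules\<close>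

definition Gproj :: "('a, 'r) ring_scheme \<Rightarrow> 'a fgm \<Rightarrow> bool" where
  "Gproj R G \<longleftrightarrow> G \<in> fg_mod R \<and>
    (\<exists>X d. exact_complex R X d \<and> (\<forall>i. proj_obj R (X i)) \<and>
      (\<forall>Q. proj_obj R Q \<longrightarrow>
        (\<forall>i. \<forall>f\<in>mod_hom R (X i) Q.
          (\<forall>x\<in>carrier (X (i + 1)). f (d (i + 1) x) = \<zero>\<^bsub>Q\<^esub>) \<longleftrightarrow>
          (\<exists>g\<in>mod_hom R (X (i - 1)) Q. \<forall>x\<in>carrier (X i). f x = g (d i x)))) \<and>
      mod_iso R G ((X (- 1))\<lparr>carrier := d 0 ` carrier (X 0)\<rparr>))"

definition periodic_mod :: "('a, 'r) ring_scheme \<Rightarrow> 'a fgm \<Rightarrow> bool" where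
  "periodic_mod R M \<longleftrightarrow>
    (\<exists>r::nat. r \<ge> 1 \<and>
      (\<exists>X d. exact_complex R X d \<and> X (- 1) = M \<and> X (int r) = M \<and>
        (\<forall>i. 0 \<le> i \<and> i < int r \<longrightarrow> proj_obj R (X i)) \<and>
        (\<forall>i. i < - 1 \<or> int r < i \<longrightarrow> zero_mod (X i))))"


section \<open>Dimensions\<close>

definition Gpd :: "('a, 'r) ring_scheme \<Rightarrow> 'a fgm \<Rightarrow> ereal" where
  "Gpd R M = Inf {ereal (real n) | n.
    \<exists>X d. exact_complex R X d \<and> X (- 1) = M \<and>
      (\<forall>i. 0 \<le> i \<and> i \<le> int n \<longrightarrow> Gproj R (X i)) \<and>
      (\<forall>i. i < - 1 \<or> int n < i \<longrightarrow> zero_mod (X i))}"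

definition Ggldim :: "('a, 'r) ring_scheme \<Rightarrow> ereal" where
  "Ggldim R = (SUP M\<in>fg_mod R. Gpd R M)"

text \<open>An injective coresolution \<open>0 \<rightarrow> M \<rightarrow> I\<^sup>0 \<rightarrow> \<dots> \<rightarrow> I\<^sup>n \<rightarrow> 0\<close> is placed in degrees \<open>1, 0, \<dots>, -n\<close>.
  The elements of \<open>M\<close> may have any type, so that the injective dimension is defined for \<^const>\<open>reg_mod\<close>; hence
  \<open>M\<close> appears in the complex only up to isomorphism.\<close>

definition inj_dim :: "('a, 'r) ring_scheme \<Rightarrow> ('a, 'b, 'm) module_scheme \<Rightarrow> ereal" where
  "inj_dim R M = Inf {ereal (real n) | n.
    \<exists>X d. exact_complex R X d \<and> mod_iso R M (X 1) \<and>
      (\<forall>i. - int n \<le> i \<and> i \<le> 0 \<longrightarrow> inj_obj R (X i)) \<and>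
      (\<forall>i. i < - int n \<or> 1 < i \<longrightarrow> zero_mod (X i))}"

definition quasi_proj_resolution ::
  "('a, 'r) ring_scheme \<Rightarrow> 'a fgm \<Rightarrow> (int \<Rightarrow> 'a fgm) \<Rightarrow> (int \<Rightarrow> 'a fgmap) \<Rightarrow> bool" where
  "quasi_proj_resolution R M X d \<longleftrightarrow>
    mod_complex R X d \<and> (\<forall>i. proj_obj R (X i)) \<and> inf_cpx X > - \<infinity> \<and>
    (\<exists>a :: int \<Rightarrow> nat.
      (\<exists>i. inf_cpx X \<le> ereal (of_int i) \<and> a i \<noteq> 0) \<and>
      (\<forall>i. inf_cpx X \<le> ereal (of_int i) \<longrightarrow> mod_iso R (homology X d i) (mod_power M (a i))))"

definition qpd :: "('a, 'r) ring_scheme \<Rightarrow> 'a fgm \<Rightarrow> ereal" where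
  "qpd R M =
    (if zero_mod M then 0
     else Inf {sup_cpx X - hsup_cpx X d | X d. quasi_proj_resolution R M X d \<and> sup_cpx X < \<infinity>})"

definition qgldim :: "('a, 'r) ring_scheme \<Rightarrow> ereal" where
  "qgldim R = (SUP M\<in>fg_mod R. qpd R M)"


section \<open>Artin algebras and Gorenstein algebras\<close>

definition artinian_cring :: "('k, 'r) ring_scheme \<Rightarrow> bool" where
  "artinian_cring k \<longleftrightarrow> cring k \<and>
    (\<forall>I :: nat \<Rightarrow> 'k set. (\<forall>n. ideal (I n) k \<and> I (Suc n) \<subseteq> I n) \<longrightarrow> (\<exists>n. \<forall>m\<ge>n. I m = I n))"

locale artin_algebra = Module.module k A + A?: ring A
  for k :: "('k, 'r) ring_scheme" (structure) and A :: "('k, 'a, 'm) module_scheme" (structure) +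
  assumes smult_mult_left:
      "\<lbrakk>c \<in> carrier k; x \<in> carrier A; y \<in> carrier A\<rbrakk> \<Longrightarrow>
        c \<odot>\<^bsub>A\<^esub> (x \<otimes>\<^bsub>A\<^esub> y) = (c \<odot>\<^bsub>A\<^esub> x) \<otimes>\<^bsub>A\<^esub> y"
    and smult_mult_right:
      "\<lbrakk>c \<in> carrier k; x \<in> carrier A; y \<in> carrier A\<rbrakk> \<Longrightarrow>
        c \<odot>\<^bsub>A\<^esub> (x \<otimes>\<^bsub>A\<^esub> y) = x \<otimes>\<^bsub>A\<^esub> (c \<odot>\<^bsub>A\<^esub> y)"
    and base_artinian: "artinian_cring k"
    and fin_gen_over_base: "fin_gen k A"

definition gorenstein_algebra :: "('a, 'r) ring_scheme \<Rightarrow> bool" where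
  "gorenstein_algebra A \<longleftrightarrow>
    inj_dim A (reg_mod A) < \<infinity> \<and> inj_dim (op_ring A) (reg_mod (op_ring A)) < \<infinity>"

end

theory Submission
  imports Defs
begin

text \<open>Let \<open>n\<close> be the injective dimension of the left regular module of \<open>A\<close>, and take an injective
  coresolution \<open>0 \<rightarrow> A \<rightarrow> I\<^sup>0 \<rightarrow> \<dots> \<rightarrow> I\<^sup>n \<rightarrow> 0\<close> of this minimal length. With it, the vanishing of
  \<open>Ext\<^sup>k(M, A)\<close> becomes a lifting property of the homomorphisms from \<open>M\<close> to \<open>I\<^sup>k\<close>
  (\<open>hom_acyclic\<close>, \<open>ext_zero\<close>), and the only homological algebra needed is dimension shifting along
  short exact sequences (\<open>hom_acyclic_quotient\<close>, \<open>hom_acyclic_sub\<close>).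

  Lower bounds. Let \<open>n \<ge> 1\<close>. The group \<open>Ext\<^sup>n(I\<^sup>n, A)\<close> is not zero: otherwise the identity of \<open>I\<^sup>n\<close> would lift to
  \<open>I\<^sup>n\<^sup>-\<^sup>1\<close>, the last map would split, and the coresolution could be shortened (\<open>shorten\<close>). But
  \<open>Ext\<^sup>n(M, A)\<close> vanishes if \<open>M\<close> has a Gorenstein projective resolution of length less than \<open>n\<close>
  (\<open>Gpd_ext_zero\<close>), and also if \<open>M\<close> has a quasi-projective resolution \<open>P\<close> with
  \<open>sup P - hsup P < n\<close> (\<open>qpd_ext_zero\<close>). In the second case, let \<open>h = hsup P\<close>. The boundaries in degree
  \<open>h\<close> have projective dimension less than \<open>n - 1\<close>, or vanish if \<open>n = 1\<close>, and \<open>Ext\<^sup>n\<^sup>+\<^sup>1\<close> is zero; hence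
  \<open>Ext\<^sup>n(H\<^sub>h(P), A) = 0\<close>, and \<open>M\<close> is a direct summand of \<open>H\<^sub>h(P)\<close>.

  Upper bounds. The \<open>n\<close>-th syzygy of every module is perpendicular to \<open>A\<close>, that is, it has no \<open>Ext\<close> to
  \<open>A\<close> in positive degrees. Over a ring that is Gorenstein on both sides the perpendicular modules are
  the Gorenstein projective ones (\<open>Gproj_perp\<close>, \<open>perp_Gproj\<close>); the finite injective dimension of the
  right regular module enters by duality, to show that perpendicular modules embed in projective
  modules (\<open>perp_torsionless\<close>). So the Gorenstein projective dimension is at most \<open>n\<close>, and, because
  Gorenstein projective modules are periodic, every module \<open>M\<close> has a projective resolution \<open>Q\<close> that is
  periodic from degree \<open>n\<close> on, with a period \<open>r \<ge> 2\<close> (\<open>periodic_resolution_exists\<close>). The identity of the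
  periodic part extends to a chain map \<open>\<eta>\<close> from \<open>Q\<close> to itself that lowers degrees by \<open>r\<close>. Up to a
  contractible complex, the cone of \<open>\<eta>\<close> is a complex of projective modules in the degrees
  \<open>0, \<dots>, n + r - 1\<close>, with homology \<open>M\<close> in the degrees \<open>0\<close> and \<open>r - 1\<close> and zero elsewhere
  (\<open>cone_quasi_projective_resolution\<close>). If \<open>M\<close> is not zero, it is a quasi-projective
  resolution of \<open>M\<close> with \<open>sup - hsup \<le> n\<close>.

  That syzygies over \<open>A\<close> and the duals of finitely generated modules are finitely generated follows from
  the theorem that Artinian commutative rings are Noetherian (\<open>artinian_noetherian\<close>).\<close>

section \<open>Homomorphisms and submodules\<close>

lemma left_moduleI:
  assumes "ring R"
    and "\<And>x y. x \<in> carrier M \<Longrightarrow> y \<in> carrier M \<Longrightarrow> x \<oplus>\<^bsub>M\<^esub> y \<in> carrier M"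
    and "\<zero>\<^bsub>M\<^esub> \<in> carrier M"
    and "\<And>x y. x \<in> carrier M \<Longrightarrow> y \<in> carrier M \<Longrightarrow> x \<oplus>\<^bsub>M\<^esub> y = y \<oplus>\<^bsub>M\<^esub> x"
    and "\<And>x y z. x \<in> carrier M \<Longrightarrow> y \<in> carrier M \<Longrightarrow> z \<in> carrier M \<Longrightarrow>
      (x \<oplus>\<^bsub>M\<^esub> y) \<oplus>\<^bsub>M\<^esub> z = x \<oplus>\<^bsub>M\<^esub> (y \<oplus>\<^bsub>M\<^esub> z)"
    and "\<And>x. x \<in> carrier M \<Longrightarrow> \<zero>\<^bsub>M\<^esub> \<oplus>\<^bsub>M\<^esub> x = x"
    and "\<And>x. x \<in> carrier M \<Longrightarrow> \<exists>y\<in>carrier M. y \<oplus>\<^bsub>M\<^esub> x = \<zero>\<^bsub>M\<^esub>"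
    and "\<And>a x. a \<in> carrier R \<Longrightarrow> x \<in> carrier M \<Longrightarrow> a \<odot>\<^bsub>M\<^esub> x \<in> carrier M"
    and "\<And>a b x. a \<in> carrier R \<Longrightarrow> b \<in> carrier R \<Longrightarrow> x \<in> carrier M \<Longrightarrow>
      (a \<oplus>\<^bsub>R\<^esub> b) \<odot>\<^bsub>M\<^esub> x = a \<odot>\<^bsub>M\<^esub> x \<oplus>\<^bsub>M\<^esub> b \<odot>\<^bsub>M\<^esub> x"
    and "\<And>a x y. a \<in> carrier R \<Longrightarrow> x \<in> carrier M \<Longrightarrow> y \<in> carrier M \<Longrightarrow>
      a \<odot>\<^bsub>M\<^esub> (x \<oplus>\<^bsub>M\<^esub> y) = a \<odot>\<^bsub>M\<^esub> x \<oplus>\<^bsub>M\<^esub> a \<odot>\<^bsub>M\<^esub> y"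
    and "\<And>a b x. a \<in> carrier R \<Longrightarrow> b \<in> carrier R \<Longrightarrow> x \<in> carrier M \<Longrightarrow>
      (a \<otimes>\<^bsub>R\<^esub> b) \<odot>\<^bsub>M\<^esub> x = a \<odot>\<^bsub>M\<^esub> (b \<odot>\<^bsub>M\<^esub> x)"
    and "\<And>x. x \<in> carrier M \<Longrightarrow> \<one>\<^bsub>R\<^esub> \<odot>\<^bsub>M\<^esub> x = x"
  shows "left_module R M"
proof -
  have "abelian_group M" using assms(2-7) by (intro abelian_groupI) auto
  then show ?thesis using assms(1,8-)
    by (intro left_module.intro left_module_axioms.intro) auto
qed

lemma mod_homI:
  assumes "\<And>x. x \<in> carrier M \<Longrightarrow> f x \<in> carrier N"
    and "\<And>x y. x \<in> carrier M \<Longrightarrow> y \<in> carrier M \<Longrightarrow> f (x \<oplus>\<^bsub>M\<^esub> y) = f x \<oplus>\<^bsub>N\<^esub> f y"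
    and "\<And>a x. a \<in> carrier R \<Longrightarrow> x \<in> carrier M \<Longrightarrow> f (a \<odot>\<^bsub>M\<^esub> x) = a \<odot>\<^bsub>N\<^esub> f x"
  shows "f \<in> mod_hom R M N"
  using assms by (auto simp: mod_hom_def hom_def)

lemma mod_hom_closed: "f \<in> mod_hom R M N \<Longrightarrow> x \<in> carrier M \<Longrightarrow> f x \<in> carrier N"
  by (auto simp: mod_hom_def hom_def)

lemma mod_hom_add:
  "f \<in> mod_hom R M N \<Longrightarrow> x \<in> carrier M \<Longrightarrow> y \<in> carrier M \<Longrightarrow> f (x \<oplus>\<^bsub>M\<^esub> y) = f x \<oplus>\<^bsub>N\<^esub> f y"
  by (auto simp: mod_hom_def hom_def)

lemma mod_hom_smult:
  "f \<in> mod_hom R M N \<Longrightarrow> a \<in> carrier R \<Longrightarrow> x \<in> carrier M \<Longrightarrow> f (a \<odot>\<^bsub>M\<^esub> x) = a \<odot>\<^bsub>N\<^esub> f x"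
  by (auto simp: mod_hom_def)

lemma mod_hom_zero:
  assumes M: "left_module R M" and N: "left_module R N" and f: "f \<in> mod_hom R M N"
  shows "f \<zero>\<^bsub>M\<^esub> = \<zero>\<^bsub>N\<^esub>"
proof -
  interpret M: left_module R M by (rule M)
  interpret N: left_module R N by (rule N)
  have "f (\<zero>\<^bsub>R\<^esub> \<odot>\<^bsub>M\<^esub> \<zero>\<^bsub>M\<^esub>) = \<zero>\<^bsub>R\<^esub> \<odot>\<^bsub>N\<^esub> f \<zero>\<^bsub>M\<^esub>"
    using f by (intro mod_hom_smult) auto
  then show ?thesis using mod_hom_closed[OF f, of "\<zero>\<^bsub>M\<^esub>"]
    by (simp add: M.smult_l_null N.smult_l_null)
qed

lemma mod_hom_neg:
  assumes M: "left_module R M" and N: "left_module R N" and f: "f \<in> mod_hom R M N"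
    and x: "x \<in> carrier M"
  shows "f (\<ominus>\<^bsub>M\<^esub> x) = \<ominus>\<^bsub>N\<^esub> f x"
proof -
  interpret M: left_module R M by (rule M)
  interpret N: left_module R N by (rule N)
  show ?thesis
    using mod_hom_smult[OF f, of "\<ominus>\<^bsub>R\<^esub> \<one>\<^bsub>R\<^esub>" x] x mod_hom_closed[OF f x]
    by (simp add: M.smult_minus_one N.smult_minus_one)
qed

lemma mod_hom_minus:
  assumes M: "left_module R M" and N: "left_module R N" and f: "f \<in> mod_hom R M N"
    and x: "x \<in> carrier M" "y \<in> carrier M"
  shows "f (x \<ominus>\<^bsub>M\<^esub> y) = f x \<ominus>\<^bsub>N\<^esub> f y"
proof -
  interpret M: left_module R M by (rule M)
  show ?thesis using x
    by (simp add: a_minus_def mod_hom_add[OF f] mod_hom_neg[OF M N f])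
qed

lemma left_module_minus:
  assumes "left_module R M" "x \<in> carrier M" "y \<in> carrier M"
  shows "x \<ominus>\<^bsub>M\<^esub> y \<in> carrier M" "x \<ominus>\<^bsub>M\<^esub> y \<oplus>\<^bsub>M\<^esub> y = x" "x \<ominus>\<^bsub>M\<^esub> y = \<zero>\<^bsub>M\<^esub> \<longleftrightarrow> x = y"
    "x \<oplus>\<^bsub>M\<^esub> y \<ominus>\<^bsub>M\<^esub> y = x" "x \<ominus>\<^bsub>M\<^esub> \<zero>\<^bsub>M\<^esub> = x"
proof -
  interpret left_module R M by (rule assms)
  show "x \<ominus>\<^bsub>M\<^esub> y \<in> carrier M" using assms by simp
  show 1: "x \<ominus>\<^bsub>M\<^esub> y \<oplus>\<^bsub>M\<^esub> y = x"
    using assms by (simp add: a_minus_def M.a_assoc M.l_neg)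
  show "x \<ominus>\<^bsub>M\<^esub> y = \<zero>\<^bsub>M\<^esub> \<longleftrightarrow> x = y"
    using assms 1 by (metis M.l_zero M.r_neg a_minus_def)
  show "x \<oplus>\<^bsub>M\<^esub> y \<ominus>\<^bsub>M\<^esub> y = x"
    using assms by (simp add: a_minus_def M.a_assoc M.r_neg)
  show "x \<ominus>\<^bsub>M\<^esub> \<zero>\<^bsub>M\<^esub> = x"
    using assms by (simp add: a_minus_def)
qed

lemma left_module_basics:
  assumes "left_module R M"
  shows "ring R" "abelian_group M" "\<zero>\<^bsub>M\<^esub> \<in> carrier M"
    "x \<in> carrier M \<Longrightarrow> y \<in> carrier M \<Longrightarrow> x \<oplus>\<^bsub>M\<^esub> y \<in> carrier M"
    "a \<in> carrier R \<Longrightarrow> x \<in> carrier M \<Longrightarrow> a \<odot>\<^bsub>M\<^esub> x \<in> carrier M"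
    "x \<in> carrier M \<Longrightarrow> \<zero>\<^bsub>M\<^esub> \<oplus>\<^bsub>M\<^esub> x = x" "x \<in> carrier M \<Longrightarrow> x \<oplus>\<^bsub>M\<^esub> \<zero>\<^bsub>M\<^esub> = x"
    "a \<in> carrier R \<Longrightarrow> a \<odot>\<^bsub>M\<^esub> \<zero>\<^bsub>M\<^esub> = \<zero>\<^bsub>M\<^esub>"
    "x \<in> carrier M \<Longrightarrow> y \<in> carrier M \<Longrightarrow> x \<oplus>\<^bsub>M\<^esub> y = y \<oplus>\<^bsub>M\<^esub> x"
    "x \<in> carrier M \<Longrightarrow> \<ominus>\<^bsub>M\<^esub> x \<in> carrier M"
proof -
  interpret left_module R M by (rule assms)
  show "ring R" "abelian_group M" "\<zero>\<^bsub>M\<^esub> \<in> carrier M"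
    "x \<in> carrier M \<Longrightarrow> y \<in> carrier M \<Longrightarrow> x \<oplus>\<^bsub>M\<^esub> y \<in> carrier M"
    "a \<in> carrier R \<Longrightarrow> x \<in> carrier M \<Longrightarrow> a \<odot>\<^bsub>M\<^esub> x \<in> carrier M"
    "x \<in> carrier M \<Longrightarrow> \<zero>\<^bsub>M\<^esub> \<oplus>\<^bsub>M\<^esub> x = x" "x \<in> carrier M \<Longrightarrow> x \<oplus>\<^bsub>M\<^esub> \<zero>\<^bsub>M\<^esub> = x"
    "a \<in> carrier R \<Longrightarrow> a \<odot>\<^bsub>M\<^esub> \<zero>\<^bsub>M\<^esub> = \<zero>\<^bsub>M\<^esub>"
    "x \<in> carrier M \<Longrightarrow> y \<in> carrier M \<Longrightarrow> x \<oplus>\<^bsub>M\<^esub> y = y \<oplus>\<^bsub>M\<^esub> x"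
    "x \<in> carrier M \<Longrightarrow> \<ominus>\<^bsub>M\<^esub> x \<in> carrier M"
    by (auto simp: R.ring_axioms M.abelian_group_axioms smult_r_null M.a_comm)
qed

lemma zero_in_mod_hom:
  assumes "left_module R N" shows "(\<lambda>_. \<zero>\<^bsub>N\<^esub>) \<in> mod_hom R M N"
  using assms by (intro mod_homI) (auto simp: left_module_basics)

lemma id_in_mod_hom: "(\<lambda>x. x) \<in> mod_hom R M M"
  by (intro mod_homI) auto

lemma mod_hom_compose:
  assumes "f \<in> mod_hom R M N" "g \<in> mod_hom R N P"
  shows "(\<lambda>x. g (f x)) \<in> mod_hom R M P"
  using assms
  by (intro mod_homI) (simp_all add: mod_hom_closed[of f] mod_hom_closed[of g] mod_hom_add[of f]
    mod_hom_add[of g] mod_hom_smult[of f] mod_hom_smult[of g])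

lemma mod_hom_cong:
  assumes "left_module R M" "f \<in> mod_hom R M N" "\<And>x. x \<in> carrier M \<Longrightarrow> g x = f x"
  shows "g \<in> mod_hom R M N"
  using assms by (intro mod_homI)
    (simp_all add: mod_hom_closed[of f] mod_hom_add[of f] mod_hom_smult[of f] left_module_basics)

lemma mod_hom_sum:
  assumes N: "left_module R N" and f: "f \<in> mod_hom R M N" and g: "g \<in> mod_hom R M N"
  shows "(\<lambda>x. f x \<oplus>\<^bsub>N\<^esub> g x) \<in> mod_hom R M N"
proof -
  interpret left_module R N by (rule N)
  note c = mod_hom_closed[OF f] mod_hom_closed[OF g]
  show ?thesis
    by (intro mod_homI)
      (simp_all add: c mod_hom_add[OF f] mod_hom_add[OF g] mod_hom_smult[OF f] mod_hom_smult[OF g]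
        M.a_ac smult_r_distr)
qed

lemma mod_hom_neg_hom:
  assumes N: "left_module R N" and f: "f \<in> mod_hom R M N"
  shows "(\<lambda>x. \<ominus>\<^bsub>N\<^esub> f x) \<in> mod_hom R M N"
proof -
  interpret left_module R N by (rule N)
  note c = mod_hom_closed[OF f]
  have "a \<odot>\<^bsub>N\<^esub> (\<ominus>\<^bsub>N\<^esub> y) = \<ominus>\<^bsub>N\<^esub> (a \<odot>\<^bsub>N\<^esub> y)" if "a \<in> carrier R" "y \<in> carrier N" for a y
    using that smult_r_distr[of a "\<ominus>\<^bsub>N\<^esub> y" y]
    by (metis M.a_inv_closed M.l_neg M.minus_equality smult_closed smult_r_null)
  then show ?thesis
    by (intro mod_homI)
      (simp_all add: c mod_hom_add[OF f] mod_hom_smult[OF f] M.minus_add)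
qed

lemma mod_hom_diff:
  assumes N: "left_module R N" and f: "f \<in> mod_hom R M N" and g: "g \<in> mod_hom R M N"
  shows "(\<lambda>x. f x \<ominus>\<^bsub>N\<^esub> g x) \<in> mod_hom R M N"
  unfolding a_minus_def by (intro mod_hom_sum mod_hom_neg_hom assms)

lemma mod_hom_inverse:
  assumes M: "left_module R M" and f: "f \<in> mod_hom R M N"
    and bij: "bij_betw f (carrier M) (carrier N)"
  shows "inv_into (carrier M) f \<in> mod_hom R N M"
proof -
  interpret M: left_module R M by (rule M)
  let ?g = "inv_into (carrier M) f"
  have g: "?g y \<in> carrier M" "f (?g y) = y" if "y \<in> carrier N" for y
    using that bij by (auto simp: bij_betw_def inv_into_into f_inv_into_f)
  have gf: "?g (f x) = x" if "x \<in> carrier M" for x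
    using that bij by (auto simp: bij_betw_def)
  show ?thesis
  proof (rule mod_homI)
    fix x y assume xy: "x \<in> carrier N" "y \<in> carrier N"
    then have "f (?g x \<oplus>\<^bsub>M\<^esub> ?g y) = x \<oplus>\<^bsub>N\<^esub> y" by (simp add: mod_hom_add[OF f] g)
    then show "?g (x \<oplus>\<^bsub>N\<^esub> y) = ?g x \<oplus>\<^bsub>M\<^esub> ?g y"
      using gf[of "?g x \<oplus>\<^bsub>M\<^esub> ?g y"] g xy by simp
  next
    fix a x assume ax: "a \<in> carrier R" "x \<in> carrier N"
    then have "f (a \<odot>\<^bsub>M\<^esub> ?g x) = a \<odot>\<^bsub>N\<^esub> x" by (simp add: mod_hom_smult[OF f] g)
    then show "?g (a \<odot>\<^bsub>N\<^esub> x) = a \<odot>\<^bsub>M\<^esub> ?g x"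
      using gf[of "a \<odot>\<^bsub>M\<^esub> ?g x"] g ax by simp
  qed (auto simp: g)
qed

lemma mod_isoE:
  assumes M: "left_module R M" and iso: "mod_iso R M N"
  obtains f g where "f \<in> mod_hom R M N" "g \<in> mod_hom R N M"
    "\<And>x. x \<in> carrier M \<Longrightarrow> g (f x) = x" "\<And>y. y \<in> carrier N \<Longrightarrow> f (g y) = y"
proof -
  from iso obtain f where f: "f \<in> mod_hom R M N" "bij_betw f (carrier M) (carrier N)"
    unfolding mod_iso_def by blast
  show ?thesis
    using f by (intro that[OF f(1) mod_hom_inverse[OF M f]])
      (auto simp: bij_betw_def f_inv_into_f)
qed

lemma mod_iso_trans:
  assumes "mod_iso R M N" "mod_iso R N P"
  shows "mod_iso R M P"
proof -
  from assms obtain f g where f: "f \<in> mod_hom R M N" "bij_betw f (carrier M) (carrier N)"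
    and g: "g \<in> mod_hom R N P" "bij_betw g (carrier N) (carrier P)"
    unfolding mod_iso_def by blast
  have "bij_betw (\<lambda>x. g (f x)) (carrier M) (carrier P)"
    using bij_betw_trans[OF f(2) g(2)] by (simp add: comp_def)
  with mod_hom_compose[OF f(1) g(1)] show ?thesis unfolding mod_iso_def by blast
qed

lemma inj_mod_homI:
  assumes M: "left_module R M" and N: "left_module R N" and f: "f \<in> mod_hom R M N"
    and z: "\<And>x. x \<in> carrier M \<Longrightarrow> f x = \<zero>\<^bsub>N\<^esub> \<Longrightarrow> x = \<zero>\<^bsub>M\<^esub>"
  shows "inj_on f (carrier M)"
proof
  fix x y assume xy: "x \<in> carrier M" "y \<in> carrier M" "f x = f y"
  then have "f (x \<ominus>\<^bsub>M\<^esub> y) = \<zero>\<^bsub>N\<^esub>"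
    by (simp add: mod_hom_minus[OF M N f] left_module_minus[OF N] mod_hom_closed[OF f])
  then show "x = y" using z[of "x \<ominus>\<^bsub>M\<^esub> y"] xy left_module_minus[OF M] by auto
qed

lemma mod_hom_factor:
  assumes M: "left_module R M" and N: "left_module R N" and Q: "left_module R Q"
    and p: "p \<in> mod_hom R M N" "p ` carrier M = carrier N"
    and f: "f \<in> mod_hom R M Q" "\<And>x. x \<in> carrier M \<Longrightarrow> p x = \<zero>\<^bsub>N\<^esub> \<Longrightarrow> f x = \<zero>\<^bsub>Q\<^esub>"
  shows "\<exists>g\<in>mod_hom R N Q. \<forall>x\<in>carrier M. g (p x) = f x"
proof -
  let ?s = "inv_into (carrier M) p"
  have s: "?s y \<in> carrier M" "p (?s y) = y" if "y \<in> carrier N" for y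
    using that unfolding p(2)[symmetric] by (rule inv_into_into, rule f_inv_into_f)
  have eq: "f x = f y" if "x \<in> carrier M" "y \<in> carrier M" "p x = p y" for x y
  proof -
    have "p (x \<ominus>\<^bsub>M\<^esub> y) = \<zero>\<^bsub>N\<^esub>"
      using that by (simp add: mod_hom_minus[OF M N p(1)] left_module_minus[OF N] mod_hom_closed[OF p(1)])
    then have "f (x \<ominus>\<^bsub>M\<^esub> y) = \<zero>\<^bsub>Q\<^esub>"
      using that by (intro f(2) left_module_minus(1)[OF M])
    then show ?thesis using that
      by (simp add: mod_hom_minus[OF M Q f(1)] left_module_minus[OF Q] mod_hom_closed[OF f(1)])
  qed
  have gp: "f (?s (p x)) = f x" if "x \<in> carrier M" for x
    using that s[of "p x"] mod_hom_closed[OF p(1) that] by (intro eq)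
  have "(\<lambda>y. f (?s y)) \<in> mod_hom R N Q"
  proof (rule mod_homI)
    fix x y assume xy: "x \<in> carrier N" "y \<in> carrier N"
    have "f (?s (x \<oplus>\<^bsub>N\<^esub> y)) = f (?s x \<oplus>\<^bsub>M\<^esub> ?s y)"
      using xy s(1) by (intro eq)
        (simp_all add: mod_hom_add[OF p(1)] s left_module_basics(4)[OF M] left_module_basics(4)[OF N])
    then show "f (?s (x \<oplus>\<^bsub>N\<^esub> y)) = f (?s x) \<oplus>\<^bsub>Q\<^esub> f (?s y)"
      using xy s by (simp add: mod_hom_add[OF f(1)])
  next
    fix a x assume ax: "a \<in> carrier R" "x \<in> carrier N"
    have "f (?s (a \<odot>\<^bsub>N\<^esub> x)) = f (a \<odot>\<^bsub>M\<^esub> ?s x)"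
      using ax s(1) by (intro eq)
        (simp_all add: mod_hom_smult[OF p(1)] s left_module_basics(5)[OF M] left_module_basics(5)[OF N])
    then show "f (?s (a \<odot>\<^bsub>N\<^esub> x)) = a \<odot>\<^bsub>Q\<^esub> f (?s x)"
      using ax s by (simp add: mod_hom_smult[OF f(1)])
  qed (simp add: s mod_hom_closed[OF f(1)])
  then show ?thesis
  proof (rule bexI[rotated])
    show "\<forall>x\<in>carrier M. f (?s (p x)) = f x" by (rule ballI) (rule gp)
  qed
qed

lemma mod_hom_corestrict:
  assumes L: "left_module R L" and M: "left_module R M"
    and i: "i \<in> mod_hom R L M" "inj_on i (carrier L)"
    and f: "f \<in> mod_hom R Q M" "f ` carrier Q \<subseteq> i ` carrier L" and Q: "left_module R Q"
  shows "\<exists>g\<in>mod_hom R Q L. \<forall>x\<in>carrier Q. i (g x) = f x"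
proof -
  let ?g = "\<lambda>x. inv_into (carrier L) i (f x)"
  have g: "?g x \<in> carrier L" "i (?g x) = f x" if "x \<in> carrier Q" for x
    using that f(2) by (auto simp: inv_into_into f_inv_into_f image_subset_iff)
  have eq: "x = y" if "i x = i y" "x \<in> carrier L" "y \<in> carrier L" for x y
    using i(2) that by (auto dest: inj_onD)
  have "?g \<in> mod_hom R Q L"
  proof (rule mod_homI)
    fix x y assume xy: "x \<in> carrier Q" "y \<in> carrier Q"
    note c = left_module_basics(4)[OF L] left_module_basics(4)[OF Q]
    show "?g (x \<oplus>\<^bsub>Q\<^esub> y) = ?g x \<oplus>\<^bsub>L\<^esub> ?g y"
      using xy c g(1)[of x] g(1)[of y] g(1)[of "x \<oplus>\<^bsub>Q\<^esub> y"] g(2)[of "x \<oplus>\<^bsub>Q\<^esub> y"]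
        g(2)[of x] g(2)[of y] mod_hom_add[OF f(1) xy]
      by (intro eq) (simp_all add: mod_hom_add[OF i(1)])
  next
    fix a x assume ax: "a \<in> carrier R" "x \<in> carrier Q"
    note c = left_module_basics(5)[OF L] left_module_basics(5)[OF Q]
    show "?g (a \<odot>\<^bsub>Q\<^esub> x) = a \<odot>\<^bsub>L\<^esub> ?g x"
      using ax c g(1)[of x] g(1)[of "a \<odot>\<^bsub>Q\<^esub> x"] g(2)[of "a \<odot>\<^bsub>Q\<^esub> x"] g(2)[of x] mod_hom_smult[OF f(1) ax]
      by (intro eq) (simp_all add: mod_hom_smult[OF i(1)])
  qed (use g in auto)
  then show ?thesis
  proof (rule bexI[rotated])
    show "\<forall>x\<in>carrier Q. i (?g x) = f x" by (rule ballI) (rule g(2))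
  qed
qed

lemma submoduleI':
  assumes M: "left_module R M" and sub: "H \<subseteq> carrier M" and ze: "\<zero>\<^bsub>M\<^esub> \<in> H"
    and ad: "\<And>x y. x \<in> H \<Longrightarrow> y \<in> H \<Longrightarrow> x \<oplus>\<^bsub>M\<^esub> y \<in> H"
    and sm: "\<And>a x. a \<in> carrier R \<Longrightarrow> x \<in> H \<Longrightarrow> a \<odot>\<^bsub>M\<^esub> x \<in> H"
  shows "submodule H R M"
proof -
  interpret left_module R M by (rule M)
  have inv: "\<ominus>\<^bsub>M\<^esub> x \<in> H" if x: "x \<in> H" for x
    using sm[OF _ x, of "\<ominus>\<^bsub>R\<^esub> \<one>\<^bsub>R\<^esub>"] sub x by (auto simp: smult_minus_one subset_iff)
  show ?thesis
  proof (intro submodule.intro subgroup.intro submodule_axioms.intro)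
    show "inv\<^bsub>add_monoid M\<^esub> x \<in> H" if "x \<in> H" for x
      using inv[OF that] by (simp add: a_inv_def)
  qed (use sub ad ze sm in auto)
qed

lemma submoduleD:
  assumes "submodule H R M"
  shows "H \<subseteq> carrier M" "\<zero>\<^bsub>M\<^esub> \<in> H" "x \<in> H \<Longrightarrow> y \<in> H \<Longrightarrow> x \<oplus>\<^bsub>M\<^esub> y \<in> H"
    "a \<in> carrier R \<Longrightarrow> x \<in> H \<Longrightarrow> a \<odot>\<^bsub>M\<^esub> x \<in> H"
    "x \<in> H \<Longrightarrow> \<ominus>\<^bsub>M\<^esub> x \<in> H" "x \<in> H \<Longrightarrow> y \<in> H \<Longrightarrow> x \<ominus>\<^bsub>M\<^esub> y \<in> H"
proof -
  interpret submodule H R M by (rule assms)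
  show "H \<subseteq> carrier M" "\<zero>\<^bsub>M\<^esub> \<in> H" "x \<in> H \<Longrightarrow> y \<in> H \<Longrightarrow> x \<oplus>\<^bsub>M\<^esub> y \<in> H"
    "a \<in> carrier R \<Longrightarrow> x \<in> H \<Longrightarrow> a \<odot>\<^bsub>M\<^esub> x \<in> H"
    using subset one_closed m_closed by auto
  show neg: "\<ominus>\<^bsub>M\<^esub> x \<in> H" if "x \<in> H" for x
    using m_inv_closed[OF that] by (simp add: a_inv_def)
  show "x \<in> H \<Longrightarrow> y \<in> H \<Longrightarrow> x \<ominus>\<^bsub>M\<^esub> y \<in> H"
    using m_closed[of x "\<ominus>\<^bsub>M\<^esub> y"] neg by (simp add: a_minus_def)
qed

lemma submodule_left_module:
  assumes M: "left_module R M" and H: "submodule H R M"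
  shows "left_module R (M\<lparr>carrier := H\<rparr>)"
proof -
  interpret left_module R M by (rule M)
  note h = submoduleD[OF H]
  have sub: "x \<in> H \<Longrightarrow> x \<in> carrier M" for x using h(1) by auto
  show ?thesis
  proof (rule left_moduleI)
    show "\<exists>y\<in>carrier (M\<lparr>carrier := H\<rparr>). y \<oplus>\<^bsub>M\<lparr>carrier := H\<rparr>\<^esub> x = \<zero>\<^bsub>M\<lparr>carrier := H\<rparr>\<^esub>"
      if "x \<in> carrier (M\<lparr>carrier := H\<rparr>)" for x
      using that h(5) sub by (intro bexI[of _ "\<ominus>\<^bsub>M\<^esub> x"]) (auto simp: M.l_neg)
  qed (auto simp: R.ring_axioms h sub M.a_ac smult_l_distr smult_r_distr smult_assoc1)
qed

lemma mod_hom_sub_source: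
  "f \<in> mod_hom R M N \<Longrightarrow> H \<subseteq> carrier M \<Longrightarrow> f \<in> mod_hom R (M\<lparr>carrier := H\<rparr>) N"
  by (auto simp: mod_hom_def hom_def subset_iff)

lemma mod_hom_sub_target:
  "f \<in> mod_hom R M N \<Longrightarrow> f ` carrier M \<subseteq> H \<Longrightarrow> f \<in> mod_hom R M (N\<lparr>carrier := H\<rparr>)"
  by (auto simp: mod_hom_def hom_def)

lemma kernel_submodule:
  assumes M: "left_module R M" and N: "left_module R N" and f: "f \<in> mod_hom R M N"
  shows "submodule (a_kernel M N f) R M"
  using left_module_basics[OF M] left_module_basics[OF N]
  by (intro submoduleI'[OF M])
    (auto simp: a_kernel_def' mod_hom_add[OF f] mod_hom_smult[OF f] mod_hom_zero[OF M N f])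

lemma image_submodule:
  assumes M: "left_module R M" and N: "left_module R N" and f: "f \<in> mod_hom R M N"
    and H: "submodule H R M"
  shows "submodule (f ` H) R N"
proof (rule submoduleI'[OF N])
  note h = submoduleD[OF H]
  have sub: "x \<in> H \<Longrightarrow> x \<in> carrier M" for x using h(1) by auto
  show "f ` H \<subseteq> carrier N" using sub mod_hom_closed[OF f] by auto
  show "\<zero>\<^bsub>N\<^esub> \<in> f ` H" using mod_hom_zero[OF M N f] h(2) by (metis imageI)
  show "x \<oplus>\<^bsub>N\<^esub> y \<in> f ` H" if xy: "x \<in> f ` H" "y \<in> f ` H" for x y
  proof -
    from xy obtain u v where "u \<in> H" "v \<in> H" "x = f u" "y = f v" by blast
    then show ?thesis using h(3)[of u v] sub by (auto simp: mod_hom_add[OF f, symmetric])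
  qed
  show "a \<odot>\<^bsub>N\<^esub> x \<in> f ` H" if ax: "a \<in> carrier R" "x \<in> f ` H" for a x
  proof -
    from ax obtain u where "u \<in> H" "x = f u" by blast
    then show ?thesis using h(4)[of a u] sub ax by (auto simp: mod_hom_smult[OF f, symmetric])
  qed
qed

lemma carrier_submodule: "left_module R M \<Longrightarrow> submodule (carrier M) R M"
  by (rule submoduleI') (auto simp: left_module_basics)

lemma vimage_submodule:
  assumes M: "left_module R M" and N: "left_module R N" and f: "f \<in> mod_hom R M N"
    and K: "submodule K R N"
  shows "submodule {x \<in> carrier M. f x \<in> K} R M"
  using left_module_basics[OF M] submoduleD[OF K]
  by (intro submoduleI'[OF M])
    (auto simp: mod_hom_add[OF f] mod_hom_smult[OF f] mod_hom_zero[OF M N f])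

lemma inter_submodule:
  assumes M: "left_module R M" and H: "submodule H R M" and K: "submodule K R M"
  shows "submodule (H \<inter> K) R M"
  using submoduleD[OF H] submoduleD[OF K] by (intro submoduleI'[OF M]) auto

lemma reg_mod_left_module: "ring R \<Longrightarrow> left_module R (reg_mod R)"
proof -
  assume "ring R"
  then interpret ring R .
  show ?thesis
  proof (rule left_moduleI)
    show "\<exists>y\<in>carrier (reg_mod R). y \<oplus>\<^bsub>reg_mod R\<^esub> x = \<zero>\<^bsub>reg_mod R\<^esub>"
      if "x \<in> carrier (reg_mod R)" for x
      using that by (intro bexI[of _ "\<ominus>\<^bsub>R\<^esub> x"]) (auto simp: reg_mod_def l_neg)
  qed (auto simp: reg_mod_def ring_axioms a_ac m_assoc l_distr r_distr)
qed

lemma reg_mod_simps [simp]: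
  "carrier (reg_mod R) = carrier R" "\<zero>\<^bsub>reg_mod R\<^esub> = \<zero>\<^bsub>R\<^esub>" "x \<oplus>\<^bsub>reg_mod R\<^esub> y = x \<oplus>\<^bsub>R\<^esub> y"
  "x \<odot>\<^bsub>reg_mod R\<^esub> y = x \<otimes>\<^bsub>R\<^esub> y"
  by (simp_all add: reg_mod_def)

lemma smult_elem_mod_hom:
  assumes M: "left_module R M" and x: "x \<in> carrier M"
  shows "(\<lambda>a. a \<odot>\<^bsub>M\<^esub> x) \<in> mod_hom R (reg_mod R) M"
proof -
  interpret left_module R M by (rule M)
  show ?thesis using x by (intro mod_homI) (auto simp: smult_l_distr smult_assoc1)
qed


section \<open>Finitely generated modules\<close>

definition fg_module :: "('a, 'r) ring_scheme \<Rightarrow> ('a, 'b, 'm) module_scheme \<Rightarrow> bool" where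
  "fg_module R M \<longleftrightarrow> left_module R M \<and> fin_gen R M"

lemma fg_mod_iff: "M \<in> fg_mod R \<longleftrightarrow> fg_module R M"
  by (simp add: fg_mod_def fg_module_def)

lemma fg_moduleD: "fg_module R M \<Longrightarrow> left_module R M"
  by (simp add: fg_module_def)

text \<open>Submodules of a submodule are submodules of the ambient module, so that finite generation can be
  tested there.\<close>

lemma fin_gen_submodule_iff:
  assumes M: "left_module R M" and H: "submodule H R M"
  shows "fin_gen R (M\<lparr>carrier := H\<rparr>) \<longleftrightarrow>
    (\<exists>S. finite S \<and> S \<subseteq> H \<and> (\<forall>K. submodule K R M \<longrightarrow> S \<subseteq> K \<longrightarrow> H \<subseteq> K))"
proof -
  note HM = submodule_left_module[OF M H]
  note hD = submoduleD[OF H]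
  have 1: "submodule K R M" if "submodule K R (M\<lparr>carrier := H\<rparr>)" for K
    using submoduleD[OF that] hD by (intro submoduleI'[OF M]) auto
  have 2: "submodule (K \<inter> H) R (M\<lparr>carrier := H\<rparr>)" if "submodule K R M" for K
    using submoduleD[OF that] hD by (intro submoduleI'[OF HM]) auto
  have 3: "K \<subseteq> H" if "submodule K R (M\<lparr>carrier := H\<rparr>)" for K
    using submoduleD(1)[OF that] by auto
  show ?thesis
  proof
    assume "fin_gen R (M\<lparr>carrier := H\<rparr>)"
    then obtain S where S: "finite S" "S \<subseteq> H"
      "\<And>K. submodule K R (M\<lparr>carrier := H\<rparr>) \<Longrightarrow> S \<subseteq> K \<Longrightarrow> K = H"
      unfolding fin_gen_def by auto
    have "H \<subseteq> K" if "submodule K R M" "S \<subseteq> K" for K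
      using S(3)[OF 2[OF that(1)]] that S(2) by blast
    with S(1,2) show "\<exists>S. finite S \<and> S \<subseteq> H \<and> (\<forall>K. submodule K R M \<longrightarrow> S \<subseteq> K \<longrightarrow> H \<subseteq> K)"
      by blast
  next
    assume "\<exists>S. finite S \<and> S \<subseteq> H \<and> (\<forall>K. submodule K R M \<longrightarrow> S \<subseteq> K \<longrightarrow> H \<subseteq> K)"
    then obtain S where S: "finite S" "S \<subseteq> H"
      "\<And>K. submodule K R M \<Longrightarrow> S \<subseteq> K \<Longrightarrow> H \<subseteq> K" by blast
    then show "fin_gen R (M\<lparr>carrier := H\<rparr>)"
      unfolding fin_gen_def using 1 3 by (intro exI[of _ S]) (simp add: subset_antisym)
  qed
qed

lemma fg_module_surj:
  assumes M: "fg_module R M" and N: "left_module R N"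
    and p: "p \<in> mod_hom R M N" "p ` carrier M = carrier N"
  shows "fg_module R N"
proof -
  note M' = fg_moduleD[OF M]
  from M obtain S where S: "finite S" "S \<subseteq> carrier M"
    "\<And>K. submodule K R M \<Longrightarrow> S \<subseteq> K \<Longrightarrow> K = carrier M"
    unfolding fg_module_def fin_gen_def by blast
  have "K = carrier N" if K: "submodule K R N" and SK: "p ` S \<subseteq> K" for K
  proof -
    have "{x \<in> carrier M. p x \<in> K} = carrier M"
      using S(2) SK by (intro S(3) vimage_submodule[OF M' N p(1) K]) auto
    then have "p ` carrier M \<subseteq> K" by blast
    then show ?thesis using submoduleD(1)[OF K] p(2) by auto
  qed
  then show ?thesis unfolding fg_module_def fin_gen_def
    using N S(1,2) mod_hom_closed[OF p(1)] by (intro conjI exI[of _ "p ` S"]) auto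
qed

lemma fg_module_image:
  assumes M: "fg_module R M" and N: "left_module R N" and f: "f \<in> mod_hom R M N"
  shows "fg_module R (N\<lparr>carrier := f ` carrier M\<rparr>)"
proof -
  note M' = fg_moduleD[OF M]
  show ?thesis
    using submodule_left_module[OF N image_submodule[OF M' N f carrier_submodule[OF M']]]
    by (intro fg_module_surj[OF M _ mod_hom_sub_target[OF f]]) auto
qed

lemma fg_module_representative:
  fixes M :: "('a, 'b, 'm) module_scheme"
  assumes "fg_module R M"
  obtains N :: "'a fgm" and f g where "fg_module R N" "f \<in> mod_hom R M N" "g \<in> mod_hom R N M"
    "\<And>x. x \<in> carrier M \<Longrightarrow> g (f x) = x" "\<And>y. y \<in> carrier N \<Longrightarrow> f (g y) = y"
proof -
  from assms obtain N :: "'a fgm" where N: "N \<in> fg_mod R" "mod_iso R M N"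
    unfolding fg_module_def using fg_mod_representative by blast
  from mod_isoE[OF fg_moduleD[OF assms] N(2)] obtain f g
    where "f \<in> mod_hom R M N" "g \<in> mod_hom R N M"
      "\<And>x. x \<in> carrier M \<Longrightarrow> g (f x) = x" "\<And>y. y \<in> carrier N \<Longrightarrow> f (g y) = y" by blast
  then show ?thesis using N(1) unfolding fg_mod_iff by (intro that)
qed

definition prod_mod :: "('a, 'b) module \<Rightarrow> ('a, 'c) module \<Rightarrow> ('a, 'b \<times> 'c) module" where
  "prod_mod M N =
    \<lparr>carrier = carrier M \<times> carrier N, mult = undefined, one = undefined, zero = (\<zero>\<^bsub>M\<^esub>, \<zero>\<^bsub>N\<^esub>),
     add = (\<lambda>x y. (fst x \<oplus>\<^bsub>M\<^esub> fst y, snd x \<oplus>\<^bsub>N\<^esub> snd y)),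
     smult = (\<lambda>a x. (a \<odot>\<^bsub>M\<^esub> fst x, a \<odot>\<^bsub>N\<^esub> snd x))\<rparr>"

lemma prod_mod_simps [simp]:
  "carrier (prod_mod M N) = carrier M \<times> carrier N" "\<zero>\<^bsub>prod_mod M N\<^esub> = (\<zero>\<^bsub>M\<^esub>, \<zero>\<^bsub>N\<^esub>)"
  "x \<oplus>\<^bsub>prod_mod M N\<^esub> y = (fst x \<oplus>\<^bsub>M\<^esub> fst y, snd x \<oplus>\<^bsub>N\<^esub> snd y)"
  "a \<odot>\<^bsub>prod_mod M N\<^esub> x = (a \<odot>\<^bsub>M\<^esub> fst x, a \<odot>\<^bsub>N\<^esub> snd x)"
  by (simp_all add: prod_mod_def)

lemma prod_mod_left_module:
  assumes M: "left_module R M" and N: "left_module R N"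
  shows "left_module R (prod_mod M N)"
proof -
  interpret M: left_module R M by (rule M)
  interpret N: left_module R N by (rule N)
  show ?thesis
  proof (rule left_moduleI)
    show "\<exists>y\<in>carrier (prod_mod M N). y \<oplus>\<^bsub>prod_mod M N\<^esub> x = \<zero>\<^bsub>prod_mod M N\<^esub>"
      if "x \<in> carrier (prod_mod M N)" for x
      using that by (intro bexI[of _ "(\<ominus>\<^bsub>M\<^esub> fst x, \<ominus>\<^bsub>N\<^esub> snd x)"]) (auto simp: M.M.l_neg N.M.l_neg)
  qed (auto simp: M.R.ring_axioms M.M.a_ac N.M.a_ac M.smult_l_distr M.smult_r_distr M.smult_assoc1
      N.smult_l_distr N.smult_r_distr N.smult_assoc1)
qed

lemma prod_mod_fg:
  assumes M: "fg_module R M" and N: "fg_module R N"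
  shows "fg_module R (prod_mod M N)"
proof -
  note M' = fg_moduleD[OF M] and N' = fg_moduleD[OF N]
  note P = prod_mod_left_module[OF M' N']
  note bM = left_module_basics[OF M'] and bN = left_module_basics[OF N']
  from M obtain S where S: "finite S" "S \<subseteq> carrier M"
    "\<And>K. submodule K R M \<Longrightarrow> S \<subseteq> K \<Longrightarrow> K = carrier M"
    unfolding fg_module_def fin_gen_def by blast
  from N obtain T where T: "finite T" "T \<subseteq> carrier N"
    "\<And>K. submodule K R N \<Longrightarrow> T \<subseteq> K \<Longrightarrow> K = carrier N"
    unfolding fg_module_def fin_gen_def by blast
  have i: "(\<lambda>x. (x, \<zero>\<^bsub>N\<^esub>)) \<in> mod_hom R M (prod_mod M N)" "(\<lambda>y. (\<zero>\<^bsub>M\<^esub>, y)) \<in> mod_hom R N (prod_mod M N)"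
    by (auto intro!: mod_homI simp: bM(3-8) bN(3-8))
  let ?U = "(\<lambda>x. (x, \<zero>\<^bsub>N\<^esub>)) ` S \<union> (\<lambda>y. (\<zero>\<^bsub>M\<^esub>, y)) ` T"
  have "K = carrier (prod_mod M N)" if K: "submodule K R (prod_mod M N)" and U: "?U \<subseteq> K" for K
  proof -
    have 1: "{x \<in> carrier M. (x, \<zero>\<^bsub>N\<^esub>) \<in> K} = carrier M"
      using S(2) U by (intro S(3) vimage_submodule[OF M' P i(1) K]) blast
    have 2: "{y \<in> carrier N. (\<zero>\<^bsub>M\<^esub>, y) \<in> K} = carrier N"
      using T(2) U by (intro T(3) vimage_submodule[OF N' P i(2) K]) blast
    have "(x, y) \<in> K" if xy: "x \<in> carrier M" "y \<in> carrier N" for x y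
    proof -
      have "(x, \<zero>\<^bsub>N\<^esub>) \<in> K" "(\<zero>\<^bsub>M\<^esub>, y) \<in> K" using 1 2 xy by blast+
      from submoduleD(3)[OF K this] show ?thesis using xy by (simp add: bM(7) bN(6))
    qed
    then show ?thesis using submoduleD(1)[OF K] by auto
  qed
  then show ?thesis unfolding fg_module_def fin_gen_def
    using P S(1,2) T(1,2) bM(3) bN(3) by (intro conjI exI[of _ ?U]) auto
qed

section \<open>Noetherian rings\<close>

definition fg_sub :: "('a, 'r) ring_scheme \<Rightarrow> ('a, 'b, 'm) module_scheme \<Rightarrow> 'b set \<Rightarrow> bool" where
  "fg_sub R M H \<longleftrightarrow>
    (\<exists>S. finite S \<and> S \<subseteq> H \<and> (\<forall>K. submodule K R M \<longrightarrow> S \<subseteq> K \<longrightarrow> H \<subseteq> K))"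

definition left_noetherian :: "('a, 'r) ring_scheme \<Rightarrow> bool" where
  "left_noetherian R \<longleftrightarrow> (\<forall>H. submodule H R (reg_mod R) \<longrightarrow> fg_sub R (reg_mod R) H)"

lemma fg_subE:
  assumes "fg_sub R M H"
  obtains S where "finite S" "S \<subseteq> H" "\<And>K. submodule K R M \<Longrightarrow> S \<subseteq> K \<Longrightarrow> H \<subseteq> K"
  using assms unfolding fg_sub_def by blast

lemma add_cyclic_submodule:
  assumes M: "left_module R M" and L: "submodule L R M" and g: "g \<in> carrier M"
  shows "submodule {y \<oplus>\<^bsub>M\<^esub> a \<odot>\<^bsub>M\<^esub> g | y a. y \<in> L \<and> a \<in> carrier R} R M"
    (is "submodule ?H R M")
proof -
  interpret left_module R M by (rule M)
  note l = submoduleD[OF L]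
  have sub: "x \<in> L \<Longrightarrow> x \<in> carrier M" for x using l(1) by auto
  show ?thesis
  proof (rule submoduleI'[OF M])
    show "?H \<subseteq> carrier M" using sub g by auto
    have "\<zero>\<^bsub>M\<^esub> = \<zero>\<^bsub>M\<^esub> \<oplus>\<^bsub>M\<^esub> \<zero>\<^bsub>R\<^esub> \<odot>\<^bsub>M\<^esub> g" using g by (simp add: smult_l_null)
    then show "\<zero>\<^bsub>M\<^esub> \<in> ?H" using l(2) by blast
    show "x \<oplus>\<^bsub>M\<^esub> x' \<in> ?H" if x: "x \<in> ?H" and x': "x' \<in> ?H" for x x'
    proof -
      obtain y a where y: "x = y \<oplus>\<^bsub>M\<^esub> a \<odot>\<^bsub>M\<^esub> g" "y \<in> L" "a \<in> carrier R" using x by blast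
      obtain y' a' where y': "x' = y' \<oplus>\<^bsub>M\<^esub> a' \<odot>\<^bsub>M\<^esub> g" "y' \<in> L" "a' \<in> carrier R" using x' by blast
      have "x \<oplus>\<^bsub>M\<^esub> x' = (y \<oplus>\<^bsub>M\<^esub> y') \<oplus>\<^bsub>M\<^esub> (a \<oplus>\<^bsub>R\<^esub> a') \<odot>\<^bsub>M\<^esub> g"
        using y y' sub g by (simp add: smult_l_distr M.a_ac)
      then show ?thesis using l(3)[OF y(2) y'(2)] y y' by blast
    qed
    show "c \<odot>\<^bsub>M\<^esub> x \<in> ?H" if c: "c \<in> carrier R" and x: "x \<in> ?H" for c x
    proof -
      obtain y a where y: "x = y \<oplus>\<^bsub>M\<^esub> a \<odot>\<^bsub>M\<^esub> g" "y \<in> L" "a \<in> carrier R" using x by blast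
      have "c \<odot>\<^bsub>M\<^esub> x = c \<odot>\<^bsub>M\<^esub> y \<oplus>\<^bsub>M\<^esub> (c \<otimes>\<^bsub>R\<^esub> a) \<odot>\<^bsub>M\<^esub> g"
        using y sub g c by (simp add: smult_r_distr smult_assoc1)
      then show ?thesis using l(4)[OF c y(2)] y c by blast
    qed
  qed
qed

lemma fg_sub_extension:
  assumes M: "left_module R M" and N: "left_module R N" and f: "f \<in> mod_hom R M N"
    and J: "submodule J R M"
    and im: "fg_sub R N (f ` J)" and ker: "fg_sub R M {x \<in> J. f x = \<zero>\<^bsub>N\<^esub>}"
  shows "fg_sub R M J"
proof -
  obtain T where T: "finite T" "T \<subseteq> f ` J" "\<And>K. submodule K R N \<Longrightarrow> T \<subseteq> K \<Longrightarrow> f ` J \<subseteq> K"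
    using im by (rule fg_subE) blast
  obtain U where U: "finite U" "U \<subseteq> J" "T = f ` U" using finite_subset_image[OF T(1,2)] by blast
  obtain S where S: "finite S" "S \<subseteq> {x \<in> J. f x = \<zero>\<^bsub>N\<^esub>}"
    "\<And>K. submodule K R M \<Longrightarrow> S \<subseteq> K \<Longrightarrow> {x \<in> J. f x = \<zero>\<^bsub>N\<^esub>} \<subseteq> K"
    using ker by (rule fg_subE) blast
  note JD = submoduleD[OF J]
  have "J \<subseteq> K" if K: "submodule K R M" and SUK: "S \<union> U \<subseteq> K" for K
  proof
    fix x assume x: "x \<in> J"
    have "T \<subseteq> f ` (K \<inter> J)" using U SUK by auto
    then have "f ` J \<subseteq> f ` (K \<inter> J)"
      by (intro T(3) image_submodule[OF M N f] inter_submodule[OF M] K J)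
    then obtain y where y: "y \<in> K" "y \<in> J" "f x = f y" using x by auto
    have xy: "x \<in> carrier M" "y \<in> carrier M" using x y JD(1) by auto
    have "f (x \<ominus>\<^bsub>M\<^esub> y) = \<zero>\<^bsub>N\<^esub>"
      using y xy by (simp add: mod_hom_minus[OF M N f] left_module_minus[OF N] mod_hom_closed[OF f])
    then have "x \<ominus>\<^bsub>M\<^esub> y \<in> K" using S(3)[OF K] SUK JD(6)[OF x y(2)] by auto
    then have "x \<ominus>\<^bsub>M\<^esub> y \<oplus>\<^bsub>M\<^esub> y \<in> K" using submoduleD(3)[OF K] y by simp
    then show "x \<in> K" by (simp add: left_module_minus[OF M xy])
  qed
  then show ?thesis unfolding fg_sub_def
    using S(1,2) U(1,2) by (intro exI[of _ "S \<union> U"]) auto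
qed

text \<open>The coefficients of \<open>g\<close> in the elements of \<open>H\<close> form a left ideal. Lifts to \<open>H\<close> of generators of this
  ideal, together with generators of \<open>H \<inter> L\<close>, generate \<open>H\<close>.\<close>

lemma noetherian_step:
  assumes R: "left_noetherian R" and M: "left_module R M" and L: "submodule L R M"
    and g: "g \<in> carrier M"
    and noeth: "\<And>H. submodule H R M \<Longrightarrow> H \<subseteq> L \<Longrightarrow> fg_sub R M H"
    and H: "submodule H R M" "H \<subseteq> {y \<oplus>\<^bsub>M\<^esub> a \<odot>\<^bsub>M\<^esub> g | y a. y \<in> L \<and> a \<in> carrier R}"
  shows "fg_sub R M H"
proof -
  interpret left_module R M by (rule M)
  note l = submoduleD[OF L]
  have sub: "x \<in> L \<Longrightarrow> x \<in> carrier M" for x using l(1) by auto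
  note reg = reg_mod_left_module[OF R.ring_axioms]
  \<comment> \<open>the left ideal of the coefficients of \<open>g\<close> that occur in \<open>K\<close>\<close>
  define I where "I K = {a \<in> carrier R. \<exists>y\<in>L. y \<oplus>\<^bsub>M\<^esub> a \<odot>\<^bsub>M\<^esub> g \<in> K}" for K
  have I: "submodule (I K) R (reg_mod R)" if K: "submodule K R M" for K
  proof (rule submoduleI'[OF reg])
    note kd = submoduleD[OF K]
    show "I K \<subseteq> carrier (reg_mod R)" by (auto simp: I_def)
    have "\<zero>\<^bsub>M\<^esub> \<oplus>\<^bsub>M\<^esub> \<zero>\<^bsub>R\<^esub> \<odot>\<^bsub>M\<^esub> g = \<zero>\<^bsub>M\<^esub>" using g by (simp add: smult_l_null)
    then have "\<exists>y\<in>L. y \<oplus>\<^bsub>M\<^esub> \<zero>\<^bsub>R\<^esub> \<odot>\<^bsub>M\<^esub> g \<in> K" using l(2) kd(2) by (intro bexI[of _ "\<zero>\<^bsub>M\<^esub>"]) auto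
    then show "\<zero>\<^bsub>reg_mod R\<^esub> \<in> I K" by (simp add: I_def)
    show "a \<oplus>\<^bsub>reg_mod R\<^esub> b \<in> I K" if ab: "a \<in> I K" "b \<in> I K" for a b
    proof -
      obtain y z where yz: "y \<in> L" "y \<oplus>\<^bsub>M\<^esub> a \<odot>\<^bsub>M\<^esub> g \<in> K" "z \<in> L" "z \<oplus>\<^bsub>M\<^esub> b \<odot>\<^bsub>M\<^esub> g \<in> K"
        and c: "a \<in> carrier R" "b \<in> carrier R"
        using ab by (auto simp: I_def)
      have "(y \<oplus>\<^bsub>M\<^esub> z) \<oplus>\<^bsub>M\<^esub> (a \<oplus>\<^bsub>R\<^esub> b) \<odot>\<^bsub>M\<^esub> g = (y \<oplus>\<^bsub>M\<^esub> a \<odot>\<^bsub>M\<^esub> g) \<oplus>\<^bsub>M\<^esub> (z \<oplus>\<^bsub>M\<^esub> b \<odot>\<^bsub>M\<^esub> g)"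
        using yz(1,3) c sub g by (simp add: smult_l_distr M.a_ac)
      then show ?thesis unfolding I_def using kd(3)[OF yz(2,4)] c l(3)[OF yz(1,3)]
        by (auto intro!: bexI[of _ "y \<oplus>\<^bsub>M\<^esub> z"])
    qed
    show "c \<odot>\<^bsub>reg_mod R\<^esub> a \<in> I K" if ca: "c \<in> carrier R" "a \<in> I K" for c a
    proof -
      obtain y where yz: "y \<in> L" "y \<oplus>\<^bsub>M\<^esub> a \<odot>\<^bsub>M\<^esub> g \<in> K" and c: "a \<in> carrier R"
        using ca by (auto simp: I_def)
      have "c \<odot>\<^bsub>M\<^esub> y \<oplus>\<^bsub>M\<^esub> (c \<otimes>\<^bsub>R\<^esub> a) \<odot>\<^bsub>M\<^esub> g = c \<odot>\<^bsub>M\<^esub> (y \<oplus>\<^bsub>M\<^esub> a \<odot>\<^bsub>M\<^esub> g)"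
        using yz(1) c ca sub g by (simp add: smult_r_distr smult_assoc1)
      then show ?thesis unfolding I_def using kd(4)[OF ca(1) yz(2)] c l(4)[OF ca(1) yz(1)] ca(1)
        by (auto intro!: bexI[of _ "c \<odot>\<^bsub>M\<^esub> y"])
    qed
  qed
  obtain T where T: "finite T" "T \<subseteq> I H" "\<And>K. submodule K R (reg_mod R) \<Longrightarrow> T \<subseteq> K \<Longrightarrow> I H \<subseteq> K"
    using R I[OF H(1)] unfolding left_noetherian_def by (auto elim!: fg_subE)
  have "\<forall>t\<in>T. \<exists>h. h \<in> H \<and> (\<exists>y\<in>L. h = y \<oplus>\<^bsub>M\<^esub> t \<odot>\<^bsub>M\<^esub> g)" using T(2) unfolding I_def by blast
  then obtain h where h: "\<And>t. t \<in> T \<Longrightarrow> h t \<in> H \<and> (\<exists>y\<in>L. h t = y \<oplus>\<^bsub>M\<^esub> t \<odot>\<^bsub>M\<^esub> g)"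
    by (metis (lifting) bchoice)
  have "fg_sub R M (H \<inter> L)" by (intro noeth inter_submodule[OF M H(1) L]) auto
  then obtain S where S: "finite S" "S \<subseteq> H \<inter> L" "\<And>K. submodule K R M \<Longrightarrow> S \<subseteq> K \<Longrightarrow> H \<inter> L \<subseteq> K"
    by (rule fg_subE) blast
  have "H \<subseteq> K" if K: "submodule K R M" and SK: "S \<union> h ` T \<subseteq> K" for K
  proof
    fix x assume x: "x \<in> H"
    then obtain y a where ya: "x = y \<oplus>\<^bsub>M\<^esub> a \<odot>\<^bsub>M\<^esub> g" "y \<in> L" "a \<in> carrier R" using H(2) by blast
    have HK: "submodule (H \<inter> K) R M" by (rule inter_submodule[OF M H(1) K])
    have "T \<subseteq> I (H \<inter> K)"
    proof
      fix t assume t: "t \<in> T"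
      then have "t \<in> carrier R" using T(2) by (auto simp: I_def)
      moreover have "h t \<in> H \<inter> K" using h[OF t] SK t by auto
      ultimately show "t \<in> I (H \<inter> K)" using h[OF t] by (auto simp: I_def)
    qed
    then have "I H \<subseteq> I (H \<inter> K)" by (rule T(3)[OF I[OF HK]])
    moreover have "a \<in> I H" using x ya by (auto simp: I_def)
    ultimately obtain z where z: "z \<in> L" "z \<oplus>\<^bsub>M\<^esub> a \<odot>\<^bsub>M\<^esub> g \<in> H \<inter> K" by (auto simp: I_def)
    have c: "y \<in> carrier M" "z \<in> carrier M" "a \<odot>\<^bsub>M\<^esub> g \<in> carrier M" using ya z sub g by auto
    have "x \<ominus>\<^bsub>M\<^esub> (z \<oplus>\<^bsub>M\<^esub> a \<odot>\<^bsub>M\<^esub> g) = y \<ominus>\<^bsub>M\<^esub> z"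
    proof -
      have "x = (y \<ominus>\<^bsub>M\<^esub> z) \<oplus>\<^bsub>M\<^esub> (z \<oplus>\<^bsub>M\<^esub> a \<odot>\<^bsub>M\<^esub> g)"
        using c left_module_minus[OF M c(1,2)] by (simp add: ya(1) M.a_assoc[symmetric])
      then show ?thesis using left_module_minus[OF M, of "y \<ominus>\<^bsub>M\<^esub> z" "z \<oplus>\<^bsub>M\<^esub> a \<odot>\<^bsub>M\<^esub> g"] c by simp
    qed
    then have "y \<ominus>\<^bsub>M\<^esub> z \<in> H" using submoduleD(6)[OF H(1) x, of "z \<oplus>\<^bsub>M\<^esub> a \<odot>\<^bsub>M\<^esub> g"] z by simp
    then have "y \<ominus>\<^bsub>M\<^esub> z \<in> K" using S(3)[OF K] SK l(6)[OF ya(2) z(1)] by auto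
    then have "(y \<ominus>\<^bsub>M\<^esub> z) \<oplus>\<^bsub>M\<^esub> (z \<oplus>\<^bsub>M\<^esub> a \<odot>\<^bsub>M\<^esub> g) \<in> K" using submoduleD(3)[OF K] z by auto
    then show "x \<in> K"
      using c left_module_minus[OF M c(1,2)] by (simp add: ya(1) M.a_assoc[symmetric])
  qed
  then show ?thesis unfolding fg_sub_def
    using S(1,2) T(1) h by (intro exI[of _ "S \<union> h ` T"]) auto
qed

lemma noetherian_fg_sub:
  assumes R: "left_noetherian R" and M: "left_module R M" "fin_gen R M" and H: "submodule H R M"
  shows "fg_sub R M H"
proof -
  interpret left_module R M by (rule M)
  obtain S where S: "finite S" "S \<subseteq> carrier M" "\<And>K. submodule K R M \<Longrightarrow> S \<subseteq> K \<Longrightarrow> K = carrier M"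
    using M(2) unfolding fin_gen_def by blast
  have "\<exists>L. submodule L R M \<and> S \<subseteq> L \<and> (\<forall>H. submodule H R M \<longrightarrow> H \<subseteq> L \<longrightarrow> fg_sub R M H)"
    using S(1,2)
  proof (induction rule: finite_induct)
    case empty
    have "submodule {\<zero>\<^bsub>M\<^esub>} R M" by (rule submoduleI'[OF M(1)]) (auto simp: smult_r_null)
    moreover have "fg_sub R M H" if "submodule H R M" "H \<subseteq> {\<zero>\<^bsub>M\<^esub>}" for H
      unfolding fg_sub_def using that submoduleD(2) by (intro exI[of _ "{}"]) blast
    ultimately show ?case by blast
  next
    case (insert g S)
    then obtain L where L: "submodule L R M" "S \<subseteq> L"
      "\<And>H. submodule H R M \<Longrightarrow> H \<subseteq> L \<Longrightarrow> fg_sub R M H" by auto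
    let ?L = "{y \<oplus>\<^bsub>M\<^esub> a \<odot>\<^bsub>M\<^esub> g | y a. y \<in> L \<and> a \<in> carrier R}"
    have g: "g \<in> carrier M" using insert by simp
    have "x \<in> ?L" if "x \<in> L" for x
    proof -
      have "x = x \<oplus>\<^bsub>M\<^esub> \<zero>\<^bsub>R\<^esub> \<odot>\<^bsub>M\<^esub> g" using that submoduleD(1)[OF L(1)] g by (auto simp: smult_l_null)
      then show ?thesis using that by blast
    qed
    moreover have "g \<in> ?L"
    proof -
      have "g = \<zero>\<^bsub>M\<^esub> \<oplus>\<^bsub>M\<^esub> \<one>\<^bsub>R\<^esub> \<odot>\<^bsub>M\<^esub> g" using g by simp
      then show ?thesis using submoduleD(2)[OF L(1)] by blast
    qed
    ultimately have "insert g S \<subseteq> ?L" using L(2) by blast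
    then show ?case
      using add_cyclic_submodule[OF M(1) L(1) g] noetherian_step[OF R M(1) L(1) g L(3)] by blast
  qed
  then obtain L where L: "submodule L R M" "S \<subseteq> L"
    "\<And>H. submodule H R M \<Longrightarrow> H \<subseteq> L \<Longrightarrow> fg_sub R M H" by blast
  then show ?thesis using S(3)[OF L(1,2)] submoduleD(1)[OF H] H by blast
qed

lemma noetherian_submodule_fg:
  assumes R: "left_noetherian R" and M: "fg_module R M" and H: "submodule H R M"
  shows "fg_module R (M\<lparr>carrier := H\<rparr>)"
  using M submodule_left_module[OF _ H] noetherian_fg_sub[OF R _ _ H] fin_gen_submodule_iff[OF _ H]
  unfolding fg_module_def fg_sub_def by blast

lemma noetherian_inj_fg:
  assumes R: "left_noetherian R" and M: "fg_module R M" and L: "left_module R L"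
    and i: "i \<in> mod_hom R L M" "inj_on i (carrier L)"
  shows "fg_module R L"
proof -
  note M' = fg_moduleD[OF M]
  have H: "submodule (i ` carrier L) R M" by (rule image_submodule[OF L M' i(1) carrier_submodule[OF L]])
  have "i \<in> mod_hom R L (M\<lparr>carrier := i ` carrier L\<rparr>)" by (rule mod_hom_sub_target[OF i(1)]) simp
  from mod_hom_inverse[OF L this] noetherian_submodule_fg[OF R M H] L i(2) show ?thesis
    by (intro fg_module_surj[of R "M\<lparr>carrier := i ` carrier L\<rparr>" L "inv_into (carrier L) i"])
      (auto simp: bij_betw_def image_image)
qed


subsection \<open>Artinian commutative rings are Noetherian\<close>

lemma submodule_reg_mod_ideal:
  assumes "cring R" and J: "submodule J R (reg_mod R)"
  shows "ideal J R"
proof -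
  interpret cring R by (rule assms)
  interpret J: submodule J R "reg_mod R" by (rule J)
  have eq: "x \<otimes>\<^bsub>R\<^esub> a = a \<otimes>\<^bsub>R\<^esub> x" if "a \<in> J" "x \<in> carrier R" for a x
    using that J.subset by (intro m_comm) auto
  show ?thesis
  proof (rule idealI)
    show "subgroup J (add_monoid R)"
    proof (rule subgroup.intro)
      fix x assume x: "x \<in> J"
      then have "(\<ominus>\<^bsub>R\<^esub> \<one>\<^bsub>R\<^esub>) \<odot>\<^bsub>reg_mod R\<^esub> x \<in> J" by (rule J.smult_closed[OF a_inv_closed[OF one_closed]])
      moreover have "x \<in> carrier R" using x submoduleD(1)[OF J] by (simp add: subset_iff)
      ultimately have "\<ominus>\<^bsub>R\<^esub> x \<in> J" by (simp add: l_minus)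
      then show "inv\<^bsub>add_monoid R\<^esub> x \<in> J" by (simp add: a_inv_def)
    qed (use submoduleD(1-3)[OF J] in simp_all)
    show 1: "x \<otimes>\<^bsub>R\<^esub> a \<in> J" if "a \<in> J" "x \<in> carrier R" for a x
      using J.smult_closed[of x a] that by simp
    show "a \<otimes>\<^bsub>R\<^esub> x \<in> J" if "a \<in> J" "x \<in> carrier R" for a x
      using 1[OF that] eq[OF that] by simp
  qed (rule ring_axioms)
qed

lemma artinian_minimal:
  assumes k: "artinian_cring k" and ne: "J0 \<in> C" and C: "\<And>J. J \<in> C \<Longrightarrow> submodule J k (reg_mod k)"
  shows "\<exists>J\<in>C. \<forall>J'\<in>C. J' \<subseteq> J \<longrightarrow> J' = J"
proof (rule ccontr)
  assume "\<not> ?thesis"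
  then have step: "\<And>J. J \<in> C \<Longrightarrow> \<exists>J'. J' \<in> C \<and> J' \<subset> J" by blast
  have "\<exists>I. \<forall>n::nat. I n \<in> C \<and> I (Suc n) \<subset> I n"
    using ne step by (intro dependent_nat_choice) auto
  then obtain I where I: "\<And>n::nat. I n \<in> C" "\<And>n. I (Suc n) \<subset> I n" by blast
  have "ideal (I n) k" for n
    using submodule_reg_mod_ideal[OF _ C[OF I(1)]] k by (auto simp: artinian_cring_def)
  then have "\<exists>n. \<forall>m\<ge>n. I m = I n" using k I(2) unfolding artinian_cring_def by blast
  then obtain n where "I (Suc n) = I n" by (meson le_SucI order_refl)
  then show False using I(2)[of n] by blast
qed

text \<open>Otherwise there is an ideal \<open>J\<close> that is minimal among the ideals that are not finitely generated. For
  every \<open>a\<close> either \<open>a J = 0\<close> or \<open>a J = J\<close>: if \<open>a J\<close> and the kernel of \<open>a\<close> on \<open>J\<close> were both smaller than \<open>J\<close>,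
  they would be finitely generated, and so would \<open>J\<close>. By the descending chain condition it follows
  that \<open>k\<close> acts on \<open>J\<close> through a field. The complement of a line in the vector space \<open>J\<close> is a smaller
  ideal, hence finitely generated, and then \<open>J\<close> is finitely generated as well.\<close>

lemma artinian_noetherian:
  assumes k: "artinian_cring k"
  shows "left_noetherian k"
proof (rule ccontr)
  interpret cring k using k by (simp add: artinian_cring_def)
  let ?M = "reg_mod k"
  have M: "left_module k ?M" by (rule reg_mod_left_module[OF ring_axioms])
  assume "\<not> ?thesis"
  then obtain J0 where "J0 \<in> {J. submodule J k ?M \<and> \<not> fg_sub k ?M J}"
    unfolding left_noetherian_def by blast
  from artinian_minimal[OF k this] obtain J where J: "submodule J k ?M" "\<not> fg_sub k ?M J"
    and min: "\<And>H. submodule H k ?M \<Longrightarrow> H \<subseteq> J \<Longrightarrow> H \<noteq> J \<Longrightarrow> fg_sub k ?M H"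
    by blast
  note JD = submoduleD[OF J(1)]
  have Jc: "x \<in> J \<Longrightarrow> x \<in> carrier k" for x using JD(1) by auto
  have mult: "(\<lambda>x. a \<otimes>\<^bsub>k\<^esub> x) \<in> mod_hom k ?M ?M" if "a \<in> carrier k" for a
    using that by (intro mod_homI) (auto simp: r_distr m_lcomm)
  define p where "p = {a \<in> carrier k. \<forall>x\<in>J. a \<otimes>\<^bsub>k\<^esub> x = \<zero>\<^bsub>k\<^esub>}"
  have surj: "(\<lambda>x. a \<otimes>\<^bsub>k\<^esub> x) ` J = J" if a: "a \<in> carrier k" "a \<notin> p" for a
  proof (rule ccontr)
    assume ne: "(\<lambda>x. a \<otimes>\<^bsub>k\<^esub> x) ` J \<noteq> J"
    have "fg_sub k ?M ((\<lambda>x. a \<otimes>\<^bsub>k\<^esub> x) ` J)"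
      using JD(4)[OF a(1)] ne by (intro min image_submodule[OF M M mult[OF a(1)] J(1)]) auto
    moreover have "fg_sub k ?M {x \<in> J. a \<otimes>\<^bsub>k\<^esub> x = \<zero>\<^bsub>?M\<^esub>}"
    proof (rule min)
      have "submodule (J \<inter> a_kernel ?M ?M (\<lambda>x. a \<otimes>\<^bsub>k\<^esub> x)) k ?M"
        by (intro inter_submodule[OF M J(1)] kernel_submodule[OF M M mult[OF a(1)]])
      moreover have "J \<inter> a_kernel ?M ?M (\<lambda>x. a \<otimes>\<^bsub>k\<^esub> x) = {x \<in> J. a \<otimes>\<^bsub>k\<^esub> x = \<zero>\<^bsub>?M\<^esub>}"
        using Jc by (auto simp: a_kernel_def')
      ultimately show "submodule {x \<in> J. a \<otimes>\<^bsub>k\<^esub> x = \<zero>\<^bsub>?M\<^esub>} k ?M" by simp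
      show "{x \<in> J. a \<otimes>\<^bsub>k\<^esub> x = \<zero>\<^bsub>?M\<^esub>} \<noteq> J" using a by (auto simp: p_def)
    qed auto
    ultimately show False using fg_sub_extension[OF M M mult[OF a(1)] J(1)] J(2) by simp
  qed
  have Jne: "\<exists>x\<in>J. x \<noteq> \<zero>\<^bsub>k\<^esub>"
  proof (rule ccontr)
    assume "\<not> ?thesis"
    then have "fg_sub k ?M J"
      unfolding fg_sub_def using submoduleD(2)[of _ k ?M] by (intro exI[of _ "{}"]) auto
    then show False using J(2) by blast
  qed
  then obtain x0 where x0: "x0 \<in> J" "x0 \<noteq> \<zero>\<^bsub>k\<^esub>" by blast
  have onep: "\<one>\<^bsub>k\<^esub> \<notin> p" using x0 Jc by (auto simp: p_def)
  \<comment> \<open>modulo the annihilator of \<open>J\<close> every element is invertible\<close>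
  have inv: "\<exists>b\<in>carrier k. \<forall>x\<in>J. b \<otimes>\<^bsub>k\<^esub> (a \<otimes>\<^bsub>k\<^esub> x) = x" if a: "a \<in> carrier k" "a \<notin> p" for a
  proof -
    \<comment> \<open>a minimal principal ideal \<open>k c\<close> with \<open>c J \<noteq> 0\<close> is also generated by \<open>a c\<close>\<close>
    let ?C = "{(\<lambda>b. b \<otimes>\<^bsub>k\<^esub> c) ` carrier k | c. c \<in> carrier k \<and> c \<notin> p}"
    have "\<exists>I\<in>?C. \<forall>I'\<in>?C. I' \<subseteq> I \<longrightarrow> I' = I"
    proof (rule artinian_minimal[OF k])
      show "(\<lambda>b. b \<otimes>\<^bsub>k\<^esub> \<one>\<^bsub>k\<^esub>) ` carrier k \<in> ?C"
        by (intro CollectI exI[of _ "\<one>\<^bsub>k\<^esub>"] conjI refl one_closed onep)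
      show "submodule I k ?M" if I: "I \<in> ?C" for I
      proof -
        obtain c where c: "c \<in> carrier k" "I = (\<lambda>b. b \<otimes>\<^bsub>k\<^esub> c) ` carrier k"
          using I by blast
        have "(\<lambda>b. b \<odot>\<^bsub>?M\<^esub> c) \<in> mod_hom k ?M ?M" using c by (intro smult_elem_mod_hom[OF M]) simp
        from image_submodule[OF M M this carrier_submodule[OF M]] show ?thesis by (simp add: c)
      qed
    qed
    then obtain c where c: "c \<in> carrier k" "c \<notin> p"
      and cmin': "\<forall>I'\<in>?C. I' \<subseteq> (\<lambda>b. b \<otimes>\<^bsub>k\<^esub> c) ` carrier k \<longrightarrow> I' = (\<lambda>b. b \<otimes>\<^bsub>k\<^esub> c) ` carrier k"
      by (elim bexE CollectE exE conjE) simp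
    have cmin: "(\<lambda>b. b \<otimes>\<^bsub>k\<^esub> c') ` carrier k = (\<lambda>b. b \<otimes>\<^bsub>k\<^esub> c) ` carrier k"
      if "c' \<in> carrier k" "c' \<notin> p"
        "(\<lambda>b. b \<otimes>\<^bsub>k\<^esub> c') ` carrier k \<subseteq> (\<lambda>b. b \<otimes>\<^bsub>k\<^esub> c) ` carrier k" for c'
    proof -
      have "(\<lambda>b. b \<otimes>\<^bsub>k\<^esub> c') ` carrier k \<in> ?C" using that(1,2) by blast
      from bspec[OF cmin' this] that(3) show ?thesis by (rule mp)
    qed
    have ac: "a \<otimes>\<^bsub>k\<^esub> c \<in> carrier k" using a c by simp
    have "a \<otimes>\<^bsub>k\<^esub> c \<notin> p"
    proof
      assume "a \<otimes>\<^bsub>k\<^esub> c \<in> p"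
      then have "a \<otimes>\<^bsub>k\<^esub> (c \<otimes>\<^bsub>k\<^esub> x) = \<zero>\<^bsub>k\<^esub>" if "x \<in> J" for x
        using that a(1) c(1) Jc by (simp add: p_def m_assoc)
      then have "\<forall>y\<in>(\<lambda>x. c \<otimes>\<^bsub>k\<^esub> x) ` J. a \<otimes>\<^bsub>k\<^esub> y = \<zero>\<^bsub>k\<^esub>" by blast
      then have "a \<in> p" using a(1) by (simp add: surj[OF c] p_def)
      then show False using a by blast
    qed
    moreover have "(\<lambda>b. b \<otimes>\<^bsub>k\<^esub> (a \<otimes>\<^bsub>k\<^esub> c)) ` carrier k \<subseteq> (\<lambda>b. b \<otimes>\<^bsub>k\<^esub> c) ` carrier k"
    proof
      fix z assume "z \<in> (\<lambda>b. b \<otimes>\<^bsub>k\<^esub> (a \<otimes>\<^bsub>k\<^esub> c)) ` carrier k"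
      then obtain b where "b \<in> carrier k" "z = b \<otimes>\<^bsub>k\<^esub> (a \<otimes>\<^bsub>k\<^esub> c)" by blast
      then show "z \<in> (\<lambda>b. b \<otimes>\<^bsub>k\<^esub> c) ` carrier k" using a c
        by (intro image_eqI[of _ _ "b \<otimes>\<^bsub>k\<^esub> a"]) (auto simp: m_assoc)
    qed
    ultimately have "(\<lambda>b. b \<otimes>\<^bsub>k\<^esub> (a \<otimes>\<^bsub>k\<^esub> c)) ` carrier k = (\<lambda>b. b \<otimes>\<^bsub>k\<^esub> c) ` carrier k"
      by (rule cmin[OF ac])
    moreover have "c \<in> (\<lambda>b. b \<otimes>\<^bsub>k\<^esub> c) ` carrier k" using c by (intro image_eqI[of _ _ "\<one>\<^bsub>k\<^esub>"]) auto
    ultimately obtain b where b: "b \<in> carrier k" "c = b \<otimes>\<^bsub>k\<^esub> (a \<otimes>\<^bsub>k\<^esub> c)" by blast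
    have "b \<otimes>\<^bsub>k\<^esub> (a \<otimes>\<^bsub>k\<^esub> x) = x" if x: "x \<in> J" for x
    proof -
      obtain y where y: "y \<in> J" "x = c \<otimes>\<^bsub>k\<^esub> y" using x surj[OF c] by blast
      have "b \<otimes>\<^bsub>k\<^esub> (a \<otimes>\<^bsub>k\<^esub> (c \<otimes>\<^bsub>k\<^esub> y)) = (b \<otimes>\<^bsub>k\<^esub> (a \<otimes>\<^bsub>k\<^esub> c)) \<otimes>\<^bsub>k\<^esub> y"
        using a(1) b(1) c(1) Jc[OF y(1)] by (simp add: m_assoc)
      then show ?thesis using b(2) y(2) by simp
    qed
    then show ?thesis using b by blast
  qed
  \<comment> \<open>so \<open>J\<close> is a vector space, in which the line of \<open>x0\<close> has a complement \<open>W\<close>\<close>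
  have "\<exists>W\<in>{W. submodule W k ?M \<and> W \<subseteq> J \<and> x0 \<notin> W}.
    \<forall>X\<in>{W. submodule W k ?M \<and> W \<subseteq> J \<and> x0 \<notin> W}. W \<subseteq> X \<longrightarrow> X = W"
  proof (rule subset_Zorn_nonempty)
    have "submodule {\<zero>\<^bsub>k\<^esub>} k ?M" by (rule submoduleI'[OF M]) auto
    then show "{W. submodule W k ?M \<and> W \<subseteq> J \<and> x0 \<notin> W} \<noteq> {}" using x0 JD(2) by auto
    fix C assume C: "C \<noteq> {}" "subset.chain {W. submodule W k ?M \<and> W \<subseteq> J \<and> x0 \<notin> W} C"
    have CW: "submodule W k ?M" "W \<subseteq> J" "x0 \<notin> W" if "W \<in> C" for W
      using C(2) that by (auto simp: subset.chain_def)
    have "submodule (\<Union>C) k ?M"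
    proof (rule submoduleI'[OF M])
      show "\<Union>C \<subseteq> carrier ?M" using CW(2) JD(1) by blast
      show "\<zero>\<^bsub>?M\<^esub> \<in> \<Union>C" using C(1) CW(1) submoduleD(2) by blast
      show "x \<oplus>\<^bsub>?M\<^esub> y \<in> \<Union>C" if xy: "x \<in> \<Union>C" "y \<in> \<Union>C" for x y
      proof -
        from xy obtain V W where VW: "V \<in> C" "W \<in> C" "x \<in> V" "y \<in> W" by blast
        then have "V \<subseteq> W \<or> W \<subseteq> V" using C(2) unfolding subset_chain_def by blast
        then show ?thesis
          using VW CW(1) submoduleD(3)[of V k ?M x y] submoduleD(3)[of W k ?M x y] by (elim disjE) blast+
      qed
      show "a \<odot>\<^bsub>?M\<^esub> x \<in> \<Union>C" if "a \<in> carrier k" "x \<in> \<Union>C" for a x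
        using that submoduleD(4)[OF CW(1)] by blast
    qed
    then show "\<Union>C \<in> {W. submodule W k ?M \<and> W \<subseteq> J \<and> x0 \<notin> W}" using CW by blast
  qed
  then obtain W where W': "W \<in> {W. submodule W k ?M \<and> W \<subseteq> J \<and> x0 \<notin> W}"
    and Wmax': "\<forall>X\<in>{W. submodule W k ?M \<and> W \<subseteq> J \<and> x0 \<notin> W}. W \<subseteq> X \<longrightarrow> X = W" by (rule bexE)
  have W: "submodule W k ?M" "W \<subseteq> J" "x0 \<notin> W" using W' by simp_all
  have Wmax: "X = W" if "submodule X k ?M" "X \<subseteq> J" "x0 \<notin> X" "W \<subseteq> X" for X
    using bspec[OF Wmax', of X] that by simp
  note WD = submoduleD[OF W(1)]
  have Wc: "w \<in> W \<Longrightarrow> w \<in> carrier k" for w using W(2) Jc by auto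
  have "fg_sub k ?M W" using x0 W by (intro min) auto
  then obtain S where S: "finite S" "S \<subseteq> W" "\<And>K. submodule K k ?M \<Longrightarrow> S \<subseteq> K \<Longrightarrow> W \<subseteq> K"
    by (rule fg_subE) blast
  have "J \<subseteq> K" if K: "submodule K k ?M" and SK: "insert x0 S \<subseteq> K" for K
  proof
    note KD = submoduleD[OF K]
    have WK: "W \<subseteq> K" using S(3)[OF K] SK by simp
    fix y assume y: "y \<in> J"
    show "y \<in> K"
    proof (cases "y \<in> W")
      case True then show ?thesis using WK by blast
    next
      case False
      let ?X = "{w \<oplus>\<^bsub>?M\<^esub> a \<odot>\<^bsub>?M\<^esub> y | w a. w \<in> W \<and> a \<in> carrier k}"
      have X: "submodule ?X k ?M" using Jc[OF y] by (intro add_cyclic_submodule[OF M W(1)]) simp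
      have "w \<oplus>\<^bsub>?M\<^esub> a \<odot>\<^bsub>?M\<^esub> y \<in> J" if "w \<in> W" "a \<in> carrier k" for w a
        using JD(3)[OF _ JD(4)[OF that(2) y]] that(1) W(2) by blast
      then have XJ: "?X \<subseteq> J" by blast
      have WX: "w \<in> ?X" if "w \<in> W" for w
      proof -
        have "w = w \<oplus>\<^bsub>?M\<^esub> \<zero>\<^bsub>k\<^esub> \<odot>\<^bsub>?M\<^esub> y" using Wc[OF that] Jc[OF y] by simp
        then show ?thesis using that by blast
      qed
      have "y = \<zero>\<^bsub>k\<^esub> \<oplus>\<^bsub>?M\<^esub> \<one>\<^bsub>k\<^esub> \<odot>\<^bsub>?M\<^esub> y" using Jc[OF y] by simp
      moreover have "\<zero>\<^bsub>k\<^esub> \<in> W" using WD(2) by simp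
      ultimately have "y \<in> ?X" by blast
      then have "?X \<noteq> W" using False by blast
      then have "x0 \<in> ?X" using Wmax[OF X XJ] WX by blast
      then obtain w r where wr: "x0 = w \<oplus>\<^bsub>k\<^esub> r \<otimes>\<^bsub>k\<^esub> y" "w \<in> W" "r \<in> carrier k" by auto
      have "r \<notin> p"
      proof
        assume "r \<in> p"
        then have "x0 = w" using wr y Wc by (simp add: p_def)
        then show False using wr W(3) by blast
      qed
      then obtain b where b: "b \<in> carrier k" "b \<otimes>\<^bsub>k\<^esub> (r \<otimes>\<^bsub>k\<^esub> y) = y" using inv[OF wr(3)] y by blast
      have "r \<otimes>\<^bsub>k\<^esub> y = x0 \<ominus>\<^bsub>?M\<^esub> w"
        using left_module_minus(4)[OF M, of "r \<otimes>\<^bsub>k\<^esub> y" w] wr Wc[OF wr(2)] Jc[OF y]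
        by (simp add: a_comm)
      then have "r \<otimes>\<^bsub>k\<^esub> y \<in> K" using KD(6)[of x0 w] SK WK wr(2) by auto
      then show ?thesis using KD(4)[OF b(1), of "r \<otimes>\<^bsub>k\<^esub> y"] b(2) by simp
    qed
  qed
  then have "fg_sub k ?M J" unfolding fg_sub_def
    using S(1,2) W(2) x0(1) by (intro exI[of _ "insert x0 S"]) auto
  then show False using J(2) by blast
qed


subsection \<open>Artin algebras are Noetherian on both sides\<close>

lemma op_ring_simps [simp]:
  "carrier (op_ring R) = carrier R" "\<zero>\<^bsub>op_ring R\<^esub> = \<zero>\<^bsub>R\<^esub>" "\<one>\<^bsub>op_ring R\<^esub> = \<one>\<^bsub>R\<^esub>"
  "x \<oplus>\<^bsub>op_ring R\<^esub> y = x \<oplus>\<^bsub>R\<^esub> y" "x \<otimes>\<^bsub>op_ring R\<^esub> y = y \<otimes>\<^bsub>R\<^esub> x"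
  by (simp_all add: op_ring_def)

lemma op_ring_ring: assumes "ring R" shows "ring (op_ring R)"
proof -
  interpret ring R by (rule assms)
  show ?thesis
  proof (rule ringI)
    show "abelian_group (op_ring R)"
    proof (rule abelian_groupI)
      show "\<exists>y\<in>carrier (op_ring R). y \<oplus>\<^bsub>op_ring R\<^esub> x = \<zero>\<^bsub>op_ring R\<^esub>"
        if "x \<in> carrier (op_ring R)" for x
        using that by (intro bexI[of _ "\<ominus>\<^bsub>R\<^esub> x"]) (auto simp: l_neg)
    qed (auto simp: a_ac)
    show "Group.monoid (op_ring R)" by (rule monoidI) (auto simp: m_assoc)
  qed (auto simp: l_distr r_distr)
qed

lemma (in artin_algebra) base_left_module: "left_module k A"
  by (intro left_module.intro left_module_axioms.intro)
    (auto simp: Module.module.smult_l_distr[OF module_axioms] R.ring_axioms M.abelian_group_axioms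
      smult_l_distr smult_r_distr smult_assoc1)

lemma (in artin_algebra) noetherian:
  shows "left_noetherian A" "left_noetherian (op_ring A)"
proof -
  note fg = noetherian_fg_sub[OF artinian_noetherian[OF base_artinian] base_left_module fin_gen_over_base]
  have ring: "ring A" by unfold_locales
  have 1: "submodule H k A" if H: "submodule H A (reg_mod A)" for H
  proof (rule submoduleI'[OF base_left_module])
    note h = submoduleD[OF H]
    show sub: "H \<subseteq> carrier A" using h(1) by simp
    show "c \<odot>\<^bsub>A\<^esub> x \<in> H" if "c \<in> carrier k" "x \<in> H" for c x
    proof -
      have x: "x \<in> carrier A" using sub that by auto
      have "c \<odot>\<^bsub>A\<^esub> x = (c \<odot>\<^bsub>A\<^esub> \<one>\<^bsub>A\<^esub>) \<otimes>\<^bsub>A\<^esub> x"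
        using smult_mult_left[OF that(1) _ x, of "\<one>\<^bsub>A\<^esub>"] x by simp
      then show ?thesis using h(4)[of "c \<odot>\<^bsub>A\<^esub> \<one>\<^bsub>A\<^esub>" x] that by simp
    qed
  qed (use submoduleD[OF H] in auto)
  have 2: "submodule H k A" if H: "submodule H (op_ring A) (reg_mod (op_ring A))" for H
  proof (rule submoduleI'[OF base_left_module])
    note h = submoduleD[OF H]
    show sub: "H \<subseteq> carrier A" using h(1) by simp
    show "c \<odot>\<^bsub>A\<^esub> x \<in> H" if "c \<in> carrier k" "x \<in> H" for c x
    proof -
      have x: "x \<in> carrier A" using sub that by auto
      have "c \<odot>\<^bsub>A\<^esub> x = x \<otimes>\<^bsub>A\<^esub> (c \<odot>\<^bsub>A\<^esub> \<one>\<^bsub>A\<^esub>)"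
        using smult_mult_right[OF that(1) x, of "\<one>\<^bsub>A\<^esub>"] x by simp
      then show ?thesis using h(4)[of "c \<odot>\<^bsub>A\<^esub> \<one>\<^bsub>A\<^esub>" x] that by simp
    qed
  qed (use submoduleD[OF H] in auto)
  show "left_noetherian A" "left_noetherian (op_ring A)"
    unfolding left_noetherian_def using fg 1 2 unfolding fg_sub_def by meson+
qed

section \<open>Quotients\<close>

lemma quot_mod_simps:
  "carrier (quot_mod M H) = a_rcosets\<^bsub>M\<^esub> H" "\<zero>\<^bsub>quot_mod M H\<^esub> = H"
  "X \<oplus>\<^bsub>quot_mod M H\<^esub> Y = X <+>\<^bsub>M\<^esub> Y"
  "a \<odot>\<^bsub>quot_mod M H\<^esub> X = (\<Union>x\<in>X. H +>\<^bsub>M\<^esub> (a \<odot>\<^bsub>M\<^esub> x))"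
  by (simp_all add: quot_mod_def)

lemma quot_mod_projection:
  assumes M: "left_module R M" and H: "submodule H R M"
  shows "left_module R (quot_mod M H)"
    and "(\<lambda>x. H +>\<^bsub>M\<^esub> x) \<in> mod_hom R M (quot_mod M H)"
    and "(\<lambda>x. H +>\<^bsub>M\<^esub> x) ` carrier M = carrier (quot_mod M H)"
    and "\<And>x. x \<in> carrier M \<Longrightarrow> H +>\<^bsub>M\<^esub> x = \<zero>\<^bsub>quot_mod M H\<^esub> \<longleftrightarrow> x \<in> H"
proof -
  interpret left_module R M by (rule M)
  note h = submoduleD[OF H]
  have as: "additive_subgroup H M"
    using H by (simp add: additive_subgroup_def submodule_def)
  interpret H: abelian_subgroup H M by (rule abelian_subgroupI3[OF as M.abelian_group_axioms])
  let ?Q = "quot_mod M H" and ?p = "\<lambda>x. H +>\<^bsub>M\<^esub> x"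
  have car: "carrier ?Q = ?p ` carrier M"
    by (auto simp: quot_mod_simps A_RCOSETS_def')
  have add: "?p x \<oplus>\<^bsub>?Q\<^esub> ?p y = ?p (x \<oplus>\<^bsub>M\<^esub> y)" if "x \<in> carrier M" "y \<in> carrier M" for x y
    using that by (simp add: quot_mod_simps H.a_rcos_sum)
  have zero: "?p x = H \<longleftrightarrow> x \<in> H" if "x \<in> carrier M" for x
    using that H.a_rcos_self[OF that] H.a_rcos_const[of x] by blast
  have smult: "a \<odot>\<^bsub>?Q\<^esub> ?p x = ?p (a \<odot>\<^bsub>M\<^esub> x)" if a: "a \<in> carrier R" and x: "x \<in> carrier M" for a x
  proof -
    have "?p (a \<odot>\<^bsub>M\<^esub> y) = ?p (a \<odot>\<^bsub>M\<^esub> x)" if y: "y \<in> ?p x" for y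
    proof -
      obtain z where z: "z \<in> H" "y = z \<oplus>\<^bsub>M\<^esub> x" using y by (auto simp: a_r_coset_def')
      have zc: "z \<in> carrier M" using z h(1) by auto
      have "a \<odot>\<^bsub>M\<^esub> y = a \<odot>\<^bsub>M\<^esub> z \<oplus>\<^bsub>M\<^esub> a \<odot>\<^bsub>M\<^esub> x" using z zc a x by (simp add: smult_r_distr)
      then have "a \<odot>\<^bsub>M\<^esub> y \<in> ?p (a \<odot>\<^bsub>M\<^esub> x)" using h(4)[OF a z(1)] by (auto simp: a_r_coset_def')
      then show ?thesis using a x H.a_subgroup
        by (intro M.a_repr_independence[symmetric]) auto
    qed
    moreover have "x \<in> ?p x" by (rule H.a_rcos_self[OF x])
    ultimately show ?thesis unfolding quot_mod_simps by blast
  qed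
  have zp: "\<zero>\<^bsub>?Q\<^esub> = ?p \<zero>\<^bsub>M\<^esub>" using zero[of "\<zero>\<^bsub>M\<^esub>"] h(2) by (simp add: quot_mod_simps)
  show "left_module R ?Q"
  proof (rule left_moduleI)
    show "\<exists>Y\<in>carrier ?Q. Y \<oplus>\<^bsub>?Q\<^esub> X = \<zero>\<^bsub>?Q\<^esub>" if X: "X \<in> carrier ?Q" for X
    proof -
      obtain x where x: "x \<in> carrier M" "X = ?p x" using X car by auto
      then show ?thesis unfolding car
        by (intro bexI[of _ "?p (\<ominus>\<^bsub>M\<^esub> x)"]) (simp_all add: zp add M.l_neg)
    qed
  qed (auto simp: car zp add smult R.ring_axioms M.a_ac smult_l_distr smult_r_distr smult_assoc1
      image_iff)
  show "?p \<in> mod_hom R M ?Q" by (intro mod_homI) (auto simp: car add smult)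
  show "?p ` carrier M = carrier ?Q" by (simp add: car)
  show "H +>\<^bsub>M\<^esub> x = \<zero>\<^bsub>?Q\<^esub> \<longleftrightarrow> x \<in> H" if "x \<in> carrier M" for x
    using zero[OF that] by (simp add: quot_mod_simps)
qed

lemma quot_mod_iso:
  assumes M: "left_module R M" and N: "left_module R N"
    and p: "p \<in> mod_hom R M N" "p ` carrier M = carrier N" "a_kernel M N p = H"
  shows "mod_iso R (quot_mod M H) N"
proof -
  have H: "submodule H R M" using kernel_submodule[OF M N p(1)] p(3) by simp
  note Q = quot_mod_projection[OF M H]
  from mod_hom_factor[OF M Q(1) N Q(2,3) p(1)] Q(4) p(3)
  obtain g where g: "g \<in> mod_hom R (quot_mod M H) N" "\<And>x. x \<in> carrier M \<Longrightarrow> g (H +>\<^bsub>M\<^esub> x) = p x"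
    by (auto simp: a_kernel_def')
  have "inj_on g (carrier (quot_mod M H))"
  proof (rule inj_mod_homI[OF Q(1) N g(1)])
    fix X assume X: "X \<in> carrier (quot_mod M H)" "g X = \<zero>\<^bsub>N\<^esub>"
    then obtain x where "x \<in> carrier M" "X = H +>\<^bsub>M\<^esub> x" using Q(3) by auto
    then show "X = \<zero>\<^bsub>quot_mod M H\<^esub>" using g(2) X(2) Q(4)[of x] p(3) by (auto simp: a_kernel_def')
  qed
  moreover have "g ` carrier (quot_mod M H) = carrier N"
    unfolding Q(3)[symmetric] p(2)[symmetric] image_image using g(2) by (intro image_cong) auto
  ultimately show ?thesis unfolding mod_iso_def bij_betw_def using g(1) by blast
qed


section \<open>Projective modules and their duals\<close>

text \<open>This is the image of \<open>Hom(M, R) \<otimes> N\<close> in \<open>Hom(M, N)\<close>. The inductive form makes induction available in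
  place of calculations with sums. That the identity of \<open>P\<close> has finite rank is the dual basis criterion
  for finitely generated projective modules.\<close>

inductive_set finite_rank ::
  "('a, 'r) ring_scheme \<Rightarrow> ('a, 'b, 'm) module_scheme \<Rightarrow> ('a, 'c, 'n) module_scheme \<Rightarrow> ('b \<Rightarrow> 'c) set"
  for R :: "('a, 'r) ring_scheme" and M :: "('a, 'b, 'm) module_scheme"
    and N :: "('a, 'c, 'n) module_scheme" where
  zero: "(\<lambda>_. \<zero>\<^bsub>N\<^esub>) \<in> finite_rank R M N"
| add: "h \<in> finite_rank R M N \<Longrightarrow> \<phi> \<in> mod_hom R M (reg_mod R) \<Longrightarrow> y \<in> carrier N \<Longrightarrow>
    (\<lambda>x. h x \<oplus>\<^bsub>N\<^esub> \<phi> x \<odot>\<^bsub>N\<^esub> y) \<in> finite_rank R M N"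

definition dualizable :: "('a, 'r) ring_scheme \<Rightarrow> ('a, 'b, 'm) module_scheme \<Rightarrow> bool" where
  "dualizable R P \<longleftrightarrow> left_module R P \<and> (\<exists>h\<in>finite_rank R P P. \<forall>x\<in>carrier P. h x = x)"

lemma dualizableD: "dualizable R P \<Longrightarrow> left_module R P"
  by (simp add: dualizable_def)

lemma finite_rank_hom:
  assumes N: "left_module R N" and h: "h \<in> finite_rank R M N"
  shows "h \<in> mod_hom R M N"
  using h
proof (induction rule: finite_rank.induct)
  case (add h \<phi> y)
  show ?case
    by (rule mod_hom_sum[OF N add.IH mod_hom_compose[OF add.hyps(2) smult_elem_mod_hom[OF N add.hyps(3)]]])
qed (rule zero_in_mod_hom[OF N])

lemma finite_rank_comp_right:
  assumes h: "h \<in> finite_rank R M N" and v: "v \<in> mod_hom R L M"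
  shows "(\<lambda>x. h (v x)) \<in> finite_rank R L N"
  using h
proof (induction rule: finite_rank.induct)
  case (add h \<phi> y)
  then show ?case using mod_hom_compose[OF v] by (intro finite_rank.add)
qed (rule finite_rank.zero)

lemma finite_rank_comp_left:
  assumes N: "left_module R N" and P: "left_module R P"
    and h: "h \<in> finite_rank R M N" and u: "u \<in> mod_hom R N P"
  shows "\<exists>h'\<in>finite_rank R M P. \<forall>x\<in>carrier M. h' x = u (h x)"
  using h
proof (induction rule: finite_rank.induct)
  case zero
  show ?case using mod_hom_zero[OF N P u] finite_rank.zero
    by (intro bexI[of _ "\<lambda>_. \<zero>\<^bsub>P\<^esub>"]) auto
next
  case (add h \<phi> y)
  then obtain h' where h': "h' \<in> finite_rank R M P" "\<forall>x\<in>carrier M. h' x = u (h x)" by blast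
  have "u (h x \<oplus>\<^bsub>N\<^esub> \<phi> x \<odot>\<^bsub>N\<^esub> y) = h' x \<oplus>\<^bsub>P\<^esub> \<phi> x \<odot>\<^bsub>P\<^esub> u y" if x: "x \<in> carrier M" for x
    using x h'(2) mod_hom_closed[OF finite_rank_hom[OF N add.hyps(1)] x] add.hyps(3)
      mod_hom_closed[OF add.hyps(2) x] left_module_basics(5)[OF N]
    by (simp add: mod_hom_add[OF u] mod_hom_smult[OF u])
  then show ?case
    using finite_rank.add[OF h'(1) add.hyps(2) mod_hom_closed[OF u add.hyps(3)]]
    by (intro bexI[of _ "\<lambda>x. h' x \<oplus>\<^bsub>P\<^esub> \<phi> x \<odot>\<^bsub>P\<^esub> u y"]) auto
qed

lemma finite_rank_sum:
  assumes N: "left_module R N" and h: "h \<in> finite_rank R M N" and g: "g \<in> finite_rank R M N"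
  shows "\<exists>h'\<in>finite_rank R M N. \<forall>x\<in>carrier M. h' x = h x \<oplus>\<^bsub>N\<^esub> g x"
  using g
proof (induction rule: finite_rank.induct)
  case zero
  show ?case using mod_hom_closed[OF finite_rank_hom[OF N h]] left_module_basics(7)[OF N] h
    by (intro bexI[of _ h]) auto
next
  case (add g \<phi> y)
  interpret left_module R N by (rule N)
  from add obtain h' where h': "h' \<in> finite_rank R M N" "\<forall>x\<in>carrier M. h' x = h x \<oplus>\<^bsub>N\<^esub> g x" by blast
  have "h' x \<oplus>\<^bsub>N\<^esub> \<phi> x \<odot>\<^bsub>N\<^esub> y = h x \<oplus>\<^bsub>N\<^esub> (g x \<oplus>\<^bsub>N\<^esub> \<phi> x \<odot>\<^bsub>N\<^esub> y)" if x: "x \<in> carrier M" for x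
    using x h'(2) mod_hom_closed[OF finite_rank_hom[OF N h] x]
      mod_hom_closed[OF finite_rank_hom[OF N add.hyps(1)] x] mod_hom_closed[OF add.hyps(2) x]
      add.hyps(3) by (simp add: M.a_assoc)
  then show ?case using finite_rank.add[OF h'(1) add.hyps(2,3)]
    by (intro bexI[of _ "\<lambda>x. h' x \<oplus>\<^bsub>N\<^esub> \<phi> x \<odot>\<^bsub>N\<^esub> y"]) auto
qed

lemma dualizable_retract:
  assumes P: "dualizable R P" and Q: "left_module R Q"
    and i: "i \<in> mod_hom R Q P" and p: "p \<in> mod_hom R P Q"
    and pi: "\<And>x. x \<in> carrier Q \<Longrightarrow> p (i x) = x"
  shows "dualizable R Q"
proof -
  note P' = dualizableD[OF P]
  obtain h where h: "h \<in> finite_rank R P P" "\<forall>x\<in>carrier P. h x = x"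
    using P unfolding dualizable_def by blast
  from finite_rank_comp_left[OF P' Q finite_rank_comp_right[OF h(1) i] p]
  obtain h' where h': "h' \<in> finite_rank R Q Q" "\<forall>x\<in>carrier Q. h' x = p (h (i x))" by blast
  have "h' x = x" if "x \<in> carrier Q" for x
    using h'(2) h(2) that mod_hom_closed[OF i that] pi by simp
  then show ?thesis unfolding dualizable_def using Q h'(1) by blast
qed

lemma dualizable_reg_mod:
  assumes R: "ring R" shows "dualizable R (reg_mod R)"
proof -
  interpret ring R by (rule R)
  have "(\<lambda>x. \<zero>\<^bsub>reg_mod R\<^esub> \<oplus>\<^bsub>reg_mod R\<^esub> x \<odot>\<^bsub>reg_mod R\<^esub> \<one>\<^bsub>R\<^esub>) \<in> finite_rank R (reg_mod R) (reg_mod R)"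
    by (intro finite_rank.add finite_rank.zero id_in_mod_hom) simp
  then show ?thesis unfolding dualizable_def
    using reg_mod_left_module[OF R]
    by (intro conjI bexI[of _ "\<lambda>x. \<zero>\<^bsub>reg_mod R\<^esub> \<oplus>\<^bsub>reg_mod R\<^esub> x \<odot>\<^bsub>reg_mod R\<^esub> \<one>\<^bsub>R\<^esub>"]) auto
qed

lemma dualizable_prod_mod:
  assumes P: "dualizable R P" and Q: "dualizable R Q"
  shows "dualizable R (prod_mod P Q)"
proof -
  note P' = dualizableD[OF P] and Q' = dualizableD[OF Q]
  note PQ = prod_mod_left_module[OF P' Q']
  note bP = left_module_basics[OF P'] and bQ = left_module_basics[OF Q']
  obtain h where h: "h \<in> finite_rank R P P" "\<forall>x\<in>carrier P. h x = x"
    using P unfolding dualizable_def by blast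
  obtain g where g: "g \<in> finite_rank R Q Q" "\<forall>x\<in>carrier Q. g x = x"
    using Q unfolding dualizable_def by blast
  have fst: "fst \<in> mod_hom R (prod_mod P Q) P" and snd: "snd \<in> mod_hom R (prod_mod P Q) Q"
    by (auto intro!: mod_homI)
  have i: "(\<lambda>x. (x, \<zero>\<^bsub>Q\<^esub>)) \<in> mod_hom R P (prod_mod P Q)"
    and j: "(\<lambda>y. (\<zero>\<^bsub>P\<^esub>, y)) \<in> mod_hom R Q (prod_mod P Q)"
    by (auto intro!: mod_homI simp: bP(3-8) bQ(3-8))
  from finite_rank_comp_left[OF P' PQ finite_rank_comp_right[OF h(1) fst] i]
  obtain h' where h': "h' \<in> finite_rank R (prod_mod P Q) (prod_mod P Q)"
    "\<forall>x\<in>carrier (prod_mod P Q). h' x = (h (fst x), \<zero>\<^bsub>Q\<^esub>)" by blast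
  from finite_rank_comp_left[OF Q' PQ finite_rank_comp_right[OF g(1) snd] j]
  obtain g' where g': "g' \<in> finite_rank R (prod_mod P Q) (prod_mod P Q)"
    "\<forall>x\<in>carrier (prod_mod P Q). g' x = (\<zero>\<^bsub>P\<^esub>, g (snd x))" by blast
  from finite_rank_sum[OF PQ h'(1) g'(1)] obtain f
    where f: "f \<in> finite_rank R (prod_mod P Q) (prod_mod P Q)"
      "\<forall>x\<in>carrier (prod_mod P Q). f x = h' x \<oplus>\<^bsub>prod_mod P Q\<^esub> g' x" by blast
  have "f x = x" if "x \<in> carrier (prod_mod P Q)" for x
    using that f(2) g'(2) h'(2) h(2) g(2) by (auto simp: bP(7) bQ(6))
  then show ?thesis unfolding dualizable_def using PQ f(1) by blast
qed

lemma dualizable_fg: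
  assumes P: "dualizable R P" shows "fg_module R P"
proof -
  note P' = dualizableD[OF P]
  have "\<exists>S. finite S \<and> S \<subseteq> carrier P \<and>
    (\<forall>K. submodule K R P \<longrightarrow> S \<subseteq> K \<longrightarrow> (\<forall>x\<in>carrier P. h x \<in> K))"
    if "h \<in> finite_rank R P P" for h
    using that
  proof (induction rule: finite_rank.induct)
    case zero
    show ?case using submoduleD(2) by (intro exI[of _ "{}"]) blast
  next
    case (add h \<phi> y)
    from add.IH obtain S where S: "finite S" "S \<subseteq> carrier P"
      and S': "\<forall>K. submodule K R P \<longrightarrow> S \<subseteq> K \<longrightarrow> (\<forall>x\<in>carrier P. h x \<in> K)"
      by (elim exE conjE)
    have "h x \<oplus>\<^bsub>P\<^esub> \<phi> x \<odot>\<^bsub>P\<^esub> y \<in> K" if K: "submodule K R P" "insert y S \<subseteq> K" "x \<in> carrier P" for K x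
      using submoduleD(3,4)[OF K(1)] S' K mod_hom_closed[OF add.hyps(2) K(3)] by simp
    then show ?case using S(1,2) add.hyps(3) by (intro exI[of _ "insert y S"]) auto
  qed
  moreover obtain h where h: "h \<in> finite_rank R P P" "\<forall>x\<in>carrier P. h x = x"
    using P unfolding dualizable_def by blast
  ultimately obtain S where S: "finite S" "S \<subseteq> carrier P"
    and S': "\<forall>K. submodule K R P \<longrightarrow> S \<subseteq> K \<longrightarrow> (\<forall>x\<in>carrier P. h x \<in> K)"
    by (elim meta_allE[of _ h] meta_impE exE conjE)
  have "K = carrier P" if K: "submodule K R P" "S \<subseteq> K" for K
    using S' K h(2) submoduleD(1)[OF K(1)] by fastforce
  then show ?thesis unfolding fg_module_def fin_gen_def using P' S(1,2) by blast
qed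

lemma dualizable_lift:
  assumes P: "dualizable R P" and M: "left_module R M" and N: "left_module R N"
    and g: "g \<in> mod_hom R M N" "g ` carrier M = carrier N" and f: "f \<in> mod_hom R P N"
  shows "\<exists>l\<in>mod_hom R P M. \<forall>x\<in>carrier P. g (l x) = f x"
proof -
  obtain h where h: "h \<in> finite_rank R P P" "\<forall>x\<in>carrier P. h x = x"
    using P unfolding dualizable_def by blast
  have lift: "\<exists>l\<in>mod_hom R P M. \<forall>x\<in>carrier P. g (l x) = h x" if "h \<in> finite_rank R P N" for h
    using that
  proof (induction rule: finite_rank.induct)
    case zero
    show ?case using mod_hom_zero[OF M N g(1)] zero_in_mod_hom[OF M]
      by (intro bexI[of _ "\<lambda>_. \<zero>\<^bsub>M\<^esub>"]) auto
  next
    case (add h \<phi> y)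
    then obtain l where l: "l \<in> mod_hom R P M" "\<forall>x\<in>carrier P. g (l x) = h x" by blast
    obtain z where z: "z \<in> carrier M" "g z = y" using add.hyps(3) g(2) by (metis imageE)
    have "g (l x \<oplus>\<^bsub>M\<^esub> \<phi> x \<odot>\<^bsub>M\<^esub> z) = h x \<oplus>\<^bsub>N\<^esub> \<phi> x \<odot>\<^bsub>N\<^esub> y" if x: "x \<in> carrier P" for x
      using x l(2) z mod_hom_closed[OF l(1) x] mod_hom_closed[OF add.hyps(2) x]
        left_module_basics(5)[OF M]
      by (simp add: mod_hom_add[OF g(1)] mod_hom_smult[OF g(1)])
    then show ?case
      using mod_hom_sum[OF M l(1) mod_hom_compose[OF add.hyps(2) smult_elem_mod_hom[OF M z(1)]]]
      by (intro bexI[of _ "\<lambda>x. l x \<oplus>\<^bsub>M\<^esub> \<phi> x \<odot>\<^bsub>M\<^esub> z"]) auto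
  qed
  from finite_rank_comp_left[OF dualizableD[OF P] N h(1) f] obtain h'
    where h': "h' \<in> finite_rank R P N" "\<forall>x\<in>carrier P. h' x = f (h x)" by blast
  show ?thesis using lift[OF h'(1)] h'(2) h(2) by auto
qed

text \<open>As the identity of \<open>Q\<close> has finite rank, a homomorphism to \<open>Q\<close> is given by finitely many homomorphisms
  to the regular module, and these can be extended one by one.\<close>

lemma dualizable_extend:
  assumes Q: "dualizable R Q" and M: "left_module R M"
    and ext: "\<And>\<phi>. \<phi> \<in> mod_hom R L (reg_mod R) \<Longrightarrow>
      \<exists>\<psi>\<in>mod_hom R M (reg_mod R). \<forall>x\<in>carrier L. \<psi> (i x) = \<phi> x"
    and f: "f \<in> mod_hom R L Q"
  shows "\<exists>g\<in>mod_hom R M Q. \<forall>x\<in>carrier L. g (i x) = f x"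
proof -
  note Q' = dualizableD[OF Q]
  obtain h where h: "h \<in> finite_rank R Q Q" "\<forall>x\<in>carrier Q. h x = x"
    using Q unfolding dualizable_def by blast
  have "\<exists>g\<in>mod_hom R M Q. \<forall>x\<in>carrier L. g (i x) = h x" if "h \<in> finite_rank R L Q" for h
    using that
  proof (induction rule: finite_rank.induct)
    case zero
    show ?case using zero_in_mod_hom[OF Q'] by (intro bexI[of _ "\<lambda>_. \<zero>\<^bsub>Q\<^esub>"]) auto
  next
    case (add h \<phi> y)
    then obtain g where g: "g \<in> mod_hom R M Q" "\<forall>x\<in>carrier L. g (i x) = h x" by blast
    obtain \<psi> where \<psi>: "\<psi> \<in> mod_hom R M (reg_mod R)" "\<forall>x\<in>carrier L. \<psi> (i x) = \<phi> x"
      using ext[OF add.hyps(2)] by blast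
    show ?case
      using mod_hom_sum[OF Q' g(1) mod_hom_compose[OF \<psi>(1) smult_elem_mod_hom[OF Q' add.hyps(3)]]] g(2) \<psi>(2)
      by (intro bexI[of _ "\<lambda>x. g x \<oplus>\<^bsub>Q\<^esub> \<psi> x \<odot>\<^bsub>Q\<^esub> y"]) auto
  qed
  from this[OF finite_rank_comp_right[OF h(1) f]] obtain g
    where "g \<in> mod_hom R M Q" "\<forall>x\<in>carrier L. g (i x) = h (f x)" by blast
  then show ?thesis using h(2) mod_hom_closed[OF f] by (intro bexI[of _ g]) auto
qed

definition zero_obj :: "'a fgm" where
  "zero_obj = \<lparr>carrier = {{}}, mult = undefined, one = undefined, zero = {}, add = (\<lambda>_ _. {}),
    smult = (\<lambda>_ _. {})\<rparr>"

lemma zero_obj_simps [simp]: "carrier zero_obj = {{}}" "\<zero>\<^bsub>zero_obj\<^esub> = {}"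
  by (simp_all add: zero_obj_def)

lemma zero_mod_zero_obj [simp]: "zero_mod zero_obj"
  by (simp add: zero_mod_def)

lemma dualizable_zero_mod:
  assumes "left_module R M" "zero_mod M" shows "dualizable R M"
  using assms unfolding dualizable_def zero_mod_def
  by (intro conjI bexI[of _ "\<lambda>_. \<zero>\<^bsub>M\<^esub>"] finite_rank.zero) auto

lemma zero_obj_left_module: "ring R \<Longrightarrow> left_module R zero_obj"
  by (rule left_moduleI) (auto simp: zero_obj_def)

lemma dualizable_zero_obj: "ring R \<Longrightarrow> dualizable R zero_obj"
  by (intro dualizable_zero_mod zero_obj_left_module) auto

lemma dualizable_representative:
  fixes P :: "('a, 'b) module"
  assumes P: "dualizable R P"
  obtains Q :: "'a fgm" and f g where "dualizable R Q" "f \<in> mod_hom R P Q" "g \<in> mod_hom R Q P"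
    "\<And>x. x \<in> carrier P \<Longrightarrow> g (f x) = x" "\<And>y. y \<in> carrier Q \<Longrightarrow> f (g y) = y"
proof -
  obtain Q :: "'a fgm" and f g where Q: "fg_module R Q" "f \<in> mod_hom R P Q" "g \<in> mod_hom R Q P"
    "\<And>x. x \<in> carrier P \<Longrightarrow> g (f x) = x" "\<And>y. y \<in> carrier Q \<Longrightarrow> f (g y) = y"
    by (rule fg_module_representative[OF dualizable_fg[OF P]]) blast
  have "dualizable R Q" by (rule dualizable_retract[OF P fg_moduleD[OF Q(1)] Q(3,2,5)])
  then show ?thesis using Q(2-5) by (rule that)
qed

lemma projective_surjection_exists:
  fixes M :: "('a, 'b) module"
  assumes M: "fg_module R M"
  shows "\<exists>(P :: 'a fgm) p. dualizable R P \<and> p \<in> mod_hom R P M \<and> p ` carrier P = carrier M"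
proof -
  note M' = fg_moduleD[OF M]
  interpret left_module R M by (rule M')
  obtain S where S: "finite S" "S \<subseteq> carrier M" "\<And>K. submodule K R M \<Longrightarrow> S \<subseteq> K \<Longrightarrow> K = carrier M"
    using M unfolding fg_module_def fin_gen_def by blast
  have "\<exists>(P :: 'a fgm) p. dualizable R P \<and> p \<in> mod_hom R P M \<and> S \<subseteq> p ` carrier P"
    using S(1,2)
  proof (induction rule: finite_induct)
    case empty
    show ?case using dualizable_zero_obj[OF R.ring_axioms] zero_in_mod_hom[OF M'] by blast
  next
    case (insert g S)
    then obtain P :: "'a fgm" and p where P: "dualizable R P" "p \<in> mod_hom R P M" "S \<subseteq> p ` carrier P"
      by auto
    have g: "g \<in> carrier M" using insert by simp
    let ?P = "prod_mod P (reg_mod R)"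
    have dP: "dualizable R ?P" by (rule dualizable_prod_mod[OF P(1) dualizable_reg_mod[OF R.ring_axioms]])
    have "fst \<in> mod_hom R ?P P" "snd \<in> mod_hom R ?P (reg_mod R)" by (auto intro!: mod_homI)
    from mod_hom_sum[OF M' mod_hom_compose[OF this(1) P(2)]
      mod_hom_compose[OF this(2) smult_elem_mod_hom[OF M' g]]]
    have q: "(\<lambda>x. p (fst x) \<oplus>\<^bsub>M\<^esub> snd x \<odot>\<^bsub>M\<^esub> g) \<in> mod_hom R ?P M" (is "?q \<in> _") .
    note bP = left_module_basics[OF dualizableD[OF P(1)]]
    have im: "insert g S \<subseteq> ?q ` carrier ?P"
    proof
      fix s assume "s \<in> insert g S"
      then consider "s = g" | "s \<in> S" by blast
      then show "s \<in> ?q ` carrier ?P"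
      proof cases
        case 1
        then have "s = ?q (\<zero>\<^bsub>P\<^esub>, \<one>\<^bsub>R\<^esub>)"
          using g mod_hom_zero[OF dualizableD[OF P(1)] M' P(2)] by simp
        then show ?thesis using bP(3) by (intro image_eqI[of _ _ "(\<zero>\<^bsub>P\<^esub>, \<one>\<^bsub>R\<^esub>)"]) auto
      next
        case 2
        then obtain x where x: "x \<in> carrier P" "s = p x" using P(3) by auto
        then have "s = ?q (x, \<zero>\<^bsub>R\<^esub>)" using g mod_hom_closed[OF P(2)] by (simp add: smult_l_null)
        then show ?thesis using x by (intro image_eqI[of _ _ "(x, \<zero>\<^bsub>R\<^esub>)"]) auto
      qed
    qed
    obtain Q :: "'a fgm" and u v where Q: "dualizable R Q" "u \<in> mod_hom R ?P Q" "v \<in> mod_hom R Q ?P"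
      "\<And>x. x \<in> carrier ?P \<Longrightarrow> v (u x) = x"
      by (rule dualizable_representative[OF dP]) blast
    have "?q ` carrier ?P \<subseteq> (\<lambda>y. ?q (v y)) ` carrier Q"
    proof
      fix s assume "s \<in> ?q ` carrier ?P"
      then obtain x where x: "x \<in> carrier ?P" "s = ?q x" by blast
      then have "s = ?q (v (u x))" using Q(4)[OF x(1)] by simp
      then show "s \<in> (\<lambda>y. ?q (v y)) ` carrier Q" using mod_hom_closed[OF Q(2) x(1)] by (rule image_eqI)
    qed
    then show ?case using Q(1) mod_hom_compose[OF Q(3) q] im
      by (intro exI[of _ Q] exI[of _ "\<lambda>y. ?q (v y)"]) blast
  qed
  then obtain P :: "'a fgm" and p where P: "dualizable R P" "p \<in> mod_hom R P M" "S \<subseteq> p ` carrier P" by blast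
  note P' = dualizableD[OF P(1)]
  have "p ` carrier P = carrier M"
    by (rule S(3)[OF image_submodule[OF P' M' P(2) carrier_submodule[OF P']] P(3)])
  then show ?thesis using P by blast
qed

lemma proj_obj_iff: "proj_obj R P \<longleftrightarrow> dualizable R P"
proof
  assume P: "proj_obj R P"
  then have fg: "fg_module R P" by (simp add: proj_obj_def fg_mod_iff)
  obtain Q :: "'a fgm" and p where Q: "dualizable R Q" "p \<in> mod_hom R Q P" "p ` carrier Q = carrier P"
    using projective_surjection_exists[OF fg] by blast
  have "\<forall>M\<in>fg_mod R. \<forall>N\<in>fg_mod R. \<forall>g\<in>mod_hom R M N. \<forall>f\<in>mod_hom R P N.
    g ` carrier M = carrier N \<longrightarrow> (\<exists>h\<in>mod_hom R P M. \<forall>x\<in>carrier P. g (h x) = f x)"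
    using P by (simp add: proj_obj_def)
  moreover have "Q \<in> fg_mod R" "P \<in> fg_mod R" using dualizable_fg[OF Q(1)] fg by (simp_all add: fg_mod_iff)
  ultimately have "\<exists>h\<in>mod_hom R P Q. \<forall>x\<in>carrier P. p (h x) = x"
    by (elim ballE[of _ _ Q] ballE[of _ _ P] ballE[of _ _ p] ballE[of _ _ "\<lambda>x. x"])
      (simp_all add: Q(2,3) id_in_mod_hom)
  then obtain h where h: "h \<in> mod_hom R P Q" "\<And>x. x \<in> carrier P \<Longrightarrow> p (h x) = x" by blast
  show "dualizable R P" by (rule dualizable_retract[OF Q(1) fg_moduleD[OF fg] h(1) Q(2) h(2)])
next
  assume P: "dualizable R P"
  show "proj_obj R P"
    unfolding proj_obj_def fg_mod_iff
    by (intro conjI ballI impI dualizable_fg[OF P] dualizable_lift[OF P])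
      (simp_all add: fg_mod_iff fg_moduleD)
qed


subsection \<open>The dual of a module\<close>

text \<open>The functionals on a left module form a right module. They are taken to be extensional, so that two of
  them are equal if they agree on the carrier.\<close>

definition dual_mod :: "('a, 'r) ring_scheme \<Rightarrow> ('a, 'b, 'm) module_scheme \<Rightarrow> ('a, 'b \<Rightarrow> 'a) module" where
  "dual_mod R M =
    \<lparr>carrier = mod_hom R M (reg_mod R) \<inter> extensional (carrier M), mult = undefined, one = undefined,
     zero = (\<lambda>x\<in>carrier M. \<zero>\<^bsub>R\<^esub>), add = (\<lambda>f g. \<lambda>x\<in>carrier M. f x \<oplus>\<^bsub>R\<^esub> g x),
     smult = (\<lambda>a f. \<lambda>x\<in>carrier M. f x \<otimes>\<^bsub>R\<^esub> a)\<rparr>"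

lemma dual_mod_simps:
  "carrier (dual_mod R M) = mod_hom R M (reg_mod R) \<inter> extensional (carrier M)"
  "\<zero>\<^bsub>dual_mod R M\<^esub> = (\<lambda>x\<in>carrier M. \<zero>\<^bsub>R\<^esub>)"
  "f \<oplus>\<^bsub>dual_mod R M\<^esub> g = (\<lambda>x\<in>carrier M. f x \<oplus>\<^bsub>R\<^esub> g x)"
  "a \<odot>\<^bsub>dual_mod R M\<^esub> f = (\<lambda>x\<in>carrier M. f x \<otimes>\<^bsub>R\<^esub> a)"
  by (simp_all add: dual_mod_def)

lemma dual_modI:
  assumes "left_module R M" "f \<in> mod_hom R M (reg_mod R)"
  shows "restrict f (carrier M) \<in> carrier (dual_mod R M)"
  using mod_hom_cong[OF assms, of "restrict f (carrier M)"] by (simp add: dual_mod_simps)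

lemma dual_modD: "f \<in> carrier (dual_mod R M) \<Longrightarrow> f \<in> mod_hom R M (reg_mod R)"
  by (simp add: dual_mod_simps)

lemma dual_mod_eqI:
  assumes "f \<in> extensional (carrier M)" "g \<in> extensional (carrier M)"
    "\<And>x. x \<in> carrier M \<Longrightarrow> f x = g x"
  shows "f = g"
  using assms by (rule extensionalityI)

lemma dual_mod_left_module:
  assumes M: "left_module R M" shows "left_module (op_ring R) (dual_mod R M)"
proof -
  interpret left_module R M by (rule M)
  note reg = reg_mod_left_module[OF R.ring_axioms]
  have cl: "f x \<in> carrier R" if "f \<in> carrier (dual_mod R M)" "x \<in> carrier M" for f x
    using mod_hom_closed[OF dual_modD[OF that(1)] that(2)] by simp
  have ext: "f \<in> extensional (carrier M)" if "f \<in> carrier (dual_mod R M)" for f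
    using that by (simp add: dual_mod_simps)
  show ?thesis
  proof (rule left_moduleI)
    show "ring (op_ring R)" by (rule op_ring_ring[OF R.ring_axioms])
    show "\<zero>\<^bsub>dual_mod R M\<^esub> \<in> carrier (dual_mod R M)"
      using dual_modI[OF M zero_in_mod_hom[OF reg]] by (simp add: dual_mod_simps)
    show "f \<oplus>\<^bsub>dual_mod R M\<^esub> g \<in> carrier (dual_mod R M)"
      if "f \<in> carrier (dual_mod R M)" "g \<in> carrier (dual_mod R M)" for f g
      using dual_modI[OF M mod_hom_sum[OF reg dual_modD[OF that(1)] dual_modD[OF that(2)]]]
      by (simp add: dual_mod_simps)
    show "a \<odot>\<^bsub>dual_mod R M\<^esub> f \<in> carrier (dual_mod R M)"
      if a: "a \<in> carrier (op_ring R)" and f: "f \<in> carrier (dual_mod R M)" for a f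
    proof -
      have "(\<lambda>b. b \<odot>\<^bsub>reg_mod R\<^esub> a) \<in> mod_hom R (reg_mod R) (reg_mod R)"
        using a by (intro smult_elem_mod_hom[OF reg]) simp
      from dual_modI[OF M mod_hom_compose[OF dual_modD[OF f] this]] show ?thesis
        by (simp add: dual_mod_simps)
    qed
    show "\<exists>g\<in>carrier (dual_mod R M). g \<oplus>\<^bsub>dual_mod R M\<^esub> f = \<zero>\<^bsub>dual_mod R M\<^esub>"
      if f: "f \<in> carrier (dual_mod R M)" for f
      using dual_modI[OF M mod_hom_neg_hom[OF reg dual_modD[OF f]]] cl[OF f]
      by (intro bexI[of _ "restrict (\<lambda>x. \<ominus>\<^bsub>reg_mod R\<^esub> f x) (carrier M)"])
        (auto simp: dual_mod_simps abelian_group.l_neg[OF left_module_basics(2)[OF reg], simplified]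
          intro!: restrict_ext)
  qed (auto simp: cl dual_mod_simps(2-4) R.a_ac R.m_assoc R.l_distr R.r_distr
      intro!: restrict_ext dual_mod_eqI[where M = M] dest: ext)
qed

lemma dual_mod_map:
  assumes M: "left_module R M" and N: "left_module R N" and f: "f \<in> mod_hom R M N"
  shows "(\<lambda>\<phi>. \<lambda>x\<in>carrier M. \<phi> (f x)) \<in> mod_hom (op_ring R) (dual_mod R N) (dual_mod R M)"
proof (rule mod_homI)
  fix \<phi> assume "\<phi> \<in> carrier (dual_mod R N)"
  from dual_modI[OF M mod_hom_compose[OF f dual_modD[OF this]]]
  show "(\<lambda>x\<in>carrier M. \<phi> (f x)) \<in> carrier (dual_mod R M)" .
qed (auto simp: dual_mod_simps mod_hom_closed[OF f] intro!: restrict_ext)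

lemma dual_mod_eval:
  assumes "x \<in> carrier M"
  shows "(\<lambda>\<phi>. \<phi> x) \<in> mod_hom (op_ring R) (dual_mod R M) (reg_mod (op_ring R))"
  using assms mod_hom_closed[OF dual_modD, of _ R M x]
  by (intro mod_homI) (auto simp: dual_mod_simps)

lemma dual_mod_dualizable:
  assumes P: "dualizable R P" shows "dualizable (op_ring R) (dual_mod R P)"
proof -
  note P' = dualizableD[OF P]
  interpret left_module R P by (rule P')
  note D = dual_mod_left_module[OF P']
  have "\<exists>H\<in>finite_rank (op_ring R) (dual_mod R P) (dual_mod R P).
    \<forall>\<phi>\<in>carrier (dual_mod R P). H \<phi> = (\<lambda>x\<in>carrier P. \<phi> (h x))" if "h \<in> finite_rank R P P" for h
    using that
  proof (induction rule: finite_rank.induct)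
    case zero
    have "\<phi> \<zero>\<^bsub>P\<^esub> = \<zero>\<^bsub>R\<^esub>" if "\<phi> \<in> carrier (dual_mod R P)" for \<phi>
      using mod_hom_zero[OF P' reg_mod_left_module[OF R.ring_axioms] dual_modD[OF that]] by simp
    then show ?case
      by (intro bexI[OF _ finite_rank.zero]) (simp add: dual_mod_simps(2))
  next
    case (add h \<psi> y)
    then obtain H where H: "H \<in> finite_rank (op_ring R) (dual_mod R P) (dual_mod R P)"
      "\<forall>\<phi>\<in>carrier (dual_mod R P). H \<phi> = (\<lambda>x\<in>carrier P. \<phi> (h x))" by blast
    let ?\<psi> = "restrict \<psi> (carrier P)"
    let ?H = "\<lambda>\<phi>. H \<phi> \<oplus>\<^bsub>dual_mod R P\<^esub> \<phi> y \<odot>\<^bsub>dual_mod R P\<^esub> ?\<psi>"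
    have "?H \<phi> = (\<lambda>x\<in>carrier P. \<phi> (h x \<oplus>\<^bsub>P\<^esub> \<psi> x \<odot>\<^bsub>P\<^esub> y))" if \<phi>: "\<phi> \<in> carrier (dual_mod R P)" for \<phi>
      using H(2) \<phi> mod_hom_closed[OF finite_rank_hom[OF P' add.hyps(1)]] add.hyps(3)
        mod_hom_closed[OF add.hyps(2)]
      by (auto simp: dual_mod_simps(3,4) mod_hom_add[OF dual_modD[OF \<phi>]] mod_hom_smult[OF dual_modD[OF \<phi>]]
          intro!: restrict_ext)
    moreover have "?H \<in> finite_rank (op_ring R) (dual_mod R P) (dual_mod R P)"
      by (rule finite_rank.add[OF H(1) dual_mod_eval[OF add.hyps(3)] dual_modI[OF P' add.hyps(2)]])
    ultimately show ?case by (intro bexI[of _ ?H]) auto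
  qed
  moreover obtain h where h: "h \<in> finite_rank R P P" "\<forall>x\<in>carrier P. h x = x"
    using P unfolding dualizable_def by blast
  ultimately obtain H where H: "H \<in> finite_rank (op_ring R) (dual_mod R P) (dual_mod R P)"
    "\<forall>\<phi>\<in>carrier (dual_mod R P). H \<phi> = (\<lambda>x\<in>carrier P. \<phi> (h x))" by blast
  have "H \<phi> = \<phi>" if \<phi>: "\<phi> \<in> carrier (dual_mod R P)" for \<phi>
    using H(2) h(2) \<phi> by (intro dual_mod_eqI[of _ P]) (auto simp: dual_mod_simps(1))
  then show ?thesis unfolding dualizable_def using D H(1) by blast
qed

text \<open>If the identity of \<open>P\<close> is the sum of the maps \<open>x \<mapsto> \<psi>\<^sub>i x y\<^sub>i\<close>, then \<open>G\<close> is the evaluation at the sum of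
  the elements \<open>G \<psi>\<^sub>i y\<^sub>i\<close>.\<close>

lemma dual_mod_reflexive:
  assumes P: "dualizable R P"
    and G: "G \<in> mod_hom (op_ring R) (dual_mod R P) (reg_mod (op_ring R))"
  shows "\<exists>z\<in>carrier P. \<forall>\<phi>\<in>carrier (dual_mod R P). G \<phi> = \<phi> z"
proof -
  note P' = dualizableD[OF P]
  interpret left_module R P by (rule P')
  note D = dual_mod_left_module[OF P']
  note op = op_ring_ring[OF R.ring_axioms]
  have "\<exists>z\<in>carrier P. \<forall>\<phi>\<in>carrier (dual_mod R P). G (\<lambda>x\<in>carrier P. \<phi> (h x)) = \<phi> z"
    if "h \<in> finite_rank R P P" for h
    using that
  proof (induction rule: finite_rank.induct)
    case zero
    have "\<phi> \<zero>\<^bsub>P\<^esub> = \<zero>\<^bsub>R\<^esub>" if "\<phi> \<in> carrier (dual_mod R P)" for \<phi>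
      using mod_hom_zero[OF P' reg_mod_left_module[OF R.ring_axioms] dual_modD[OF that]] by simp
    moreover have "G (\<lambda>x\<in>carrier P. \<zero>\<^bsub>R\<^esub>) = \<zero>\<^bsub>R\<^esub>"
      using mod_hom_zero[OF D reg_mod_left_module[OF op] G] by (simp add: dual_mod_simps(2))
    ultimately have "G (\<lambda>x\<in>carrier P. \<phi> \<zero>\<^bsub>P\<^esub>) = \<phi> \<zero>\<^bsub>P\<^esub>" if "\<phi> \<in> carrier (dual_mod R P)" for \<phi>
      using that by metis
    then show ?case by (intro bexI[of _ "\<zero>\<^bsub>P\<^esub>"] ballI) (simp_all del: restrict_apply)
  next
    case (add h \<psi> y)
    then obtain z where z: "z \<in> carrier P"
      "\<forall>\<phi>\<in>carrier (dual_mod R P). G (\<lambda>x\<in>carrier P. \<phi> (h x)) = \<phi> z" by blast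
    let ?\<psi> = "restrict \<psi> (carrier P)"
    note psi = dual_modI[OF P' add.hyps(2)]
    have Gpsi: "G ?\<psi> \<in> carrier R" using mod_hom_closed[OF G psi] by simp
    have "G (\<lambda>x\<in>carrier P. \<phi> (h x \<oplus>\<^bsub>P\<^esub> \<psi> x \<odot>\<^bsub>P\<^esub> y)) = \<phi> (z \<oplus>\<^bsub>P\<^esub> G ?\<psi> \<odot>\<^bsub>P\<^esub> y)"
      if \<phi>: "\<phi> \<in> carrier (dual_mod R P)" for \<phi>
    proof -
      note ph = dual_modD[OF \<phi>]
      note hh = finite_rank_hom[OF P' add.hyps(1)]
      have c: "(\<lambda>x\<in>carrier P. \<phi> (h x)) \<in> carrier (dual_mod R P)"
        by (rule dual_modI[OF P' mod_hom_compose[OF hh ph]])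
      have py: "\<phi> y \<in> carrier R" using mod_hom_closed[OF ph add.hyps(3)] by simp
      have eq: "(\<lambda>x\<in>carrier P. \<phi> (h x \<oplus>\<^bsub>P\<^esub> \<psi> x \<odot>\<^bsub>P\<^esub> y)) =
        (\<lambda>x\<in>carrier P. \<phi> (h x)) \<oplus>\<^bsub>dual_mod R P\<^esub> \<phi> y \<odot>\<^bsub>dual_mod R P\<^esub> ?\<psi>"
        using mod_hom_closed[OF hh] add.hyps(3) mod_hom_closed[OF add.hyps(2)]
        by (auto simp: dual_mod_simps(3,4) mod_hom_add[OF ph] mod_hom_smult[OF ph] intro!: restrict_ext)
      have "G ((\<lambda>x\<in>carrier P. \<phi> (h x)) \<oplus>\<^bsub>dual_mod R P\<^esub> \<phi> y \<odot>\<^bsub>dual_mod R P\<^esub> ?\<psi>) = \<phi> z \<oplus>\<^bsub>R\<^esub> G ?\<psi> \<otimes>\<^bsub>R\<^esub> \<phi> y"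
        using py psi c left_module_basics(5)[OF D] z(2) \<phi>
        by (simp add: mod_hom_add[OF G] mod_hom_smult[OF G])
      also have "\<dots> = \<phi> (z \<oplus>\<^bsub>P\<^esub> G ?\<psi> \<odot>\<^bsub>P\<^esub> y)"
        using z(1) Gpsi add.hyps(3) by (simp add: mod_hom_add[OF ph] mod_hom_smult[OF ph])
      finally show ?thesis by (simp only: eq)
    qed
    then show ?case using z(1) Gpsi add.hyps(3)
      by (intro bexI[of _ "z \<oplus>\<^bsub>P\<^esub> G ?\<psi> \<odot>\<^bsub>P\<^esub> y"] ballI) (simp_all del: restrict_apply)
  qed
  moreover obtain h where h: "h \<in> finite_rank R P P" "\<forall>x\<in>carrier P. h x = x"
    using P unfolding dualizable_def by blast
  ultimately obtain z where z: "z \<in> carrier P"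
    "\<forall>\<phi>\<in>carrier (dual_mod R P). G (\<lambda>x\<in>carrier P. \<phi> (h x)) = \<phi> z" by blast
  have "(\<lambda>x\<in>carrier P. \<phi> (h x)) = \<phi>" if \<phi>: "\<phi> \<in> carrier (dual_mod R P)" for \<phi>
    using h(2) \<phi> by (intro dual_mod_eqI[of _ P]) (auto simp: dual_mod_simps(1))
  then show ?thesis using z by auto
qed

lemma dualizable_separates:
  assumes P: "dualizable R P" and x: "x \<in> carrier P"
    and z: "\<And>\<phi>. \<phi> \<in> mod_hom R P (reg_mod R) \<Longrightarrow> \<phi> x = \<zero>\<^bsub>R\<^esub>"
  shows "x = \<zero>\<^bsub>P\<^esub>"
proof -
  interpret left_module R P by (rule dualizableD[OF P])
  have "h x = \<zero>\<^bsub>P\<^esub>" if "h \<in> finite_rank R P P" for h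
    using that by induction (auto simp: z smult_l_null)
  moreover obtain h where h: "h \<in> finite_rank R P P" "\<forall>x\<in>carrier P. h x = x"
    using P unfolding dualizable_def by blast
  ultimately show ?thesis using x by metis
qed

section \<open>Short exact sequences and complexes\<close>

definition ses ::
  "('a, 'r) ring_scheme \<Rightarrow> ('a, 'b) module \<Rightarrow> ('b \<Rightarrow> 'c) \<Rightarrow> ('a, 'c) module \<Rightarrow> ('c \<Rightarrow> 'd) \<Rightarrow> ('a, 'd) module \<Rightarrow> bool"
  where "ses R L i M p N \<longleftrightarrow>
    left_module R L \<and> left_module R M \<and> left_module R N \<and>
    i \<in> mod_hom R L M \<and> inj_on i (carrier L) \<and> p \<in> mod_hom R M N \<and> p ` carrier M = carrier N \<and>
    i ` carrier L = a_kernel M N p"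

lemma sesD:
  assumes "ses R L i M p N"
  shows "left_module R L" "left_module R M" "left_module R N" "i \<in> mod_hom R L M" "inj_on i (carrier L)"
    "p \<in> mod_hom R M N" "p ` carrier M = carrier N" "i ` carrier L = a_kernel M N p"
    "y \<in> carrier L \<Longrightarrow> p (i y) = \<zero>\<^bsub>N\<^esub>" "y \<in> carrier L \<Longrightarrow> i y \<in> carrier M"
    "x \<in> carrier M \<Longrightarrow> p x = \<zero>\<^bsub>N\<^esub> \<Longrightarrow> \<exists>y\<in>carrier L. x = i y" "x \<in> carrier M \<Longrightarrow> p x \<in> carrier N"
    "z \<in> carrier N \<Longrightarrow> \<exists>x\<in>carrier M. z = p x"
proof -
  show 1: "left_module R L" "left_module R M" "left_module R N" "i \<in> mod_hom R L M" "inj_on i (carrier L)"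
    "p \<in> mod_hom R M N" "p ` carrier M = carrier N" "i ` carrier L = a_kernel M N p"
    using assms by (auto simp: ses_def)
  show "p (i y) = \<zero>\<^bsub>N\<^esub>" if "y \<in> carrier L"
  proof -
    have "i y \<in> a_kernel M N p" using 1(8) that by blast
    then show ?thesis by (simp add: a_kernel_def')
  qed
  show "\<exists>y\<in>carrier L. x = i y" if "x \<in> carrier M" "p x = \<zero>\<^bsub>N\<^esub>"
  proof -
    have "x \<in> i ` carrier L" using 1(8) that by (simp add: a_kernel_def')
    then show ?thesis by blast
  qed
  show "y \<in> carrier L \<Longrightarrow> i y \<in> carrier M" "x \<in> carrier M \<Longrightarrow> p x \<in> carrier N"
    using mod_hom_closed[OF 1(4)] mod_hom_closed[OF 1(6)] by auto
  show "z \<in> carrier N \<Longrightarrow> \<exists>x\<in>carrier M. z = p x" using 1(7) by blast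
qed

lemma ses_kernel:
  assumes M: "left_module R M" and N: "left_module R N"
    and p: "p \<in> mod_hom R M N" "p ` carrier M = carrier N"
  shows "ses R (M\<lparr>carrier := a_kernel M N p\<rparr>) (\<lambda>x. x) M p N"
  unfolding ses_def using assms submodule_left_module[OF M kernel_submodule[OF M N p(1)]]
    mod_hom_sub_source[OF id_in_mod_hom, of "a_kernel M N p" M R]
  by (auto simp: a_kernel_def')

lemma ses_cokernel:
  fixes M :: "('a, 'c) module"
  assumes L: "left_module R L" and M: "fg_module R M" and i: "i \<in> mod_hom R L M" "inj_on i (carrier L)"
  shows "\<exists>(N :: 'a fgm) p. fg_module R N \<and> ses R L i M p N"
proof -
  note M' = fg_moduleD[OF M]
  have H: "submodule (i ` carrier L) R M" by (rule image_submodule[OF L M' i(1) carrier_submodule[OF L]])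
  note Q = quot_mod_projection[OF M' H]
  obtain N :: "'a fgm" and f g where N: "fg_module R N" "f \<in> mod_hom R (quot_mod M (i ` carrier L)) N"
    "g \<in> mod_hom R N (quot_mod M (i ` carrier L))"
    "\<And>x. x \<in> carrier (quot_mod M (i ` carrier L)) \<Longrightarrow> g (f x) = x" "\<And>y. y \<in> carrier N \<Longrightarrow> f (g y) = y"
    by (rule fg_module_representative[OF fg_module_surj[OF M Q(1-3)]]) blast
  note N' = fg_moduleD[OF N(1)]
  let ?p = "\<lambda>x. f (i ` carrier L +>\<^bsub>M\<^esub> x)"
  have p: "?p \<in> mod_hom R M N" by (rule mod_hom_compose[OF Q(2) N(2)])
  have "f ` carrier (quot_mod M (i ` carrier L)) = carrier N"
    using mod_hom_closed[OF N(2)] mod_hom_closed[OF N(3)] N(5) by (auto simp: image_iff) metis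
  then have im: "?p ` carrier M = carrier N" unfolding Q(3)[symmetric] image_image .
  have ker: "?p x = \<zero>\<^bsub>N\<^esub> \<longleftrightarrow> x \<in> i ` carrier L" if x: "x \<in> carrier M" for x
  proof -
    have c: "i ` carrier L +>\<^bsub>M\<^esub> x \<in> carrier (quot_mod M (i ` carrier L))" by (rule mod_hom_closed[OF Q(2) x])
    have "?p x = \<zero>\<^bsub>N\<^esub> \<longleftrightarrow> i ` carrier L +>\<^bsub>M\<^esub> x = \<zero>\<^bsub>quot_mod M (i ` carrier L)\<^esub>"
      using N(4)[OF c] mod_hom_zero[OF Q(1) N' N(2)] mod_hom_zero[OF N' Q(1) N(3)] by metis
    then show ?thesis using Q(4)[OF x] by simp
  qed
  have "i ` carrier L = a_kernel M N ?p"
    unfolding a_kernel_def' using ker submoduleD(1)[OF H] by blast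
  then show ?thesis unfolding ses_def using L M' N(1) N' i p im by blast
qed

lemma ses_factor:
  assumes s: "ses R L i M p N" and Q: "left_module R Q" and f: "f \<in> mod_hom R M Q"
    and z: "\<And>y. y \<in> carrier L \<Longrightarrow> f (i y) = \<zero>\<^bsub>Q\<^esub>"
  shows "\<exists>g\<in>mod_hom R N Q. \<forall>x\<in>carrier M. g (p x) = f x"
proof (rule mod_hom_factor[OF sesD(2,3)[OF s] Q sesD(6,7)[OF s] f])
  fix x assume "x \<in> carrier M" "p x = \<zero>\<^bsub>N\<^esub>"
  from sesD(11)[OF s this] show "f x = \<zero>\<^bsub>Q\<^esub>" using z by blast
qed

text \<open>Every exact complex that has to be constructed is spliced from short exact sequences.\<close>

lemma exact_complex_splice:
  fixes K X :: "int \<Rightarrow> 'a fgm"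
  assumes s: "\<And>k. ses R (K (k + 1)) (j k) (X k) (p k) (K k)" and fg: "\<And>k. fg_module R (X k)"
  shows "exact_complex R X (\<lambda>k x. j (k - 1) (p k x))"
proof -
  let ?d = "\<lambda>k x. j (k - 1) (p k x)"
  have s': "ses R (K k) (j (k - 1)) (X (k - 1)) (p (k - 1)) (K (k - 1))" for k using s[of "k - 1"] by simp
  have d: "?d k \<in> mod_hom R (X k) (X (k - 1))" for k
    by (rule mod_hom_compose[OF sesD(6)[OF s] sesD(4)[OF s']])
  have jz: "j (k - 1) \<zero>\<^bsub>K k\<^esub> = \<zero>\<^bsub>X (k - 1)\<^esub>" for k
    by (rule mod_hom_zero[OF sesD(1,2,4)[OF s']])
  have dz: "?d k x = \<zero>\<^bsub>X (k - 1)\<^esub> \<longleftrightarrow> p k x = \<zero>\<^bsub>K k\<^esub>" if "x \<in> carrier (X k)" for k x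
    using inj_onD[OF sesD(5)[OF s'], of k "p k x" "\<zero>\<^bsub>K k\<^esub>"] jz[of k] sesD(12)[OF s that]
      left_module_basics(3)[OF sesD(3)[OF s]] by auto
  have im: "?d (k + 1) ` carrier (X (k + 1)) = a_kernel (X k) (X (k - 1)) (?d k)" for k
  proof -
    have "?d (k + 1) ` carrier (X (k + 1)) = j k ` (p (k + 1) ` carrier (X (k + 1)))"
      by (simp add: image_image)
    also have "\<dots> = a_kernel (X k) (K k) (p k)" using sesD(7)[OF s, of "k + 1"] sesD(8)[OF s, of k] by simp
    also have "\<dots> = a_kernel (X k) (X (k - 1)) (?d k)" unfolding a_kernel_def' using dz[of _ k] by blast
    finally show ?thesis .
  qed
  have "?d (k - 1) (?d k x) = \<zero>\<^bsub>X (k - 2)\<^esub>" if "x \<in> carrier (X k)" for k x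
  proof -
    have "?d (k - 1 + 1) x \<in> ?d (k - 1 + 1) ` carrier (X (k - 1 + 1))" using that by simp
    then have "?d k x \<in> a_kernel (X (k - 1)) (X (k - 1 - 1)) (?d (k - 1))" unfolding im by simp
    then show ?thesis by (simp add: a_kernel_def')
  qed
  then show ?thesis unfolding exact_complex_def mod_complex_def fg_mod_iff using fg d im by blast
qed

definition cycles :: "(int \<Rightarrow> 'a fgm) \<Rightarrow> (int \<Rightarrow> 'a fgmap) \<Rightarrow> int \<Rightarrow> 'a fgm" where
  "cycles X d k = (X k)\<lparr>carrier := a_kernel (X k) (X (k - 1)) (d k)\<rparr>"

lemma cycles_simps [simp]:
  "carrier (cycles X d k) = a_kernel (X k) (X (k - 1)) (d k)" "\<zero>\<^bsub>cycles X d k\<^esub> = \<zero>\<^bsub>X k\<^esub>"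
  "x \<oplus>\<^bsub>cycles X d k\<^esub> y = x \<oplus>\<^bsub>X k\<^esub> y" "a \<odot>\<^bsub>cycles X d k\<^esub> x = a \<odot>\<^bsub>X k\<^esub> x"
  by (simp_all add: cycles_def)

lemma mod_complexD:
  assumes "mod_complex R X d"
  shows "fg_module R (X k)" "left_module R (X k)" "d k \<in> mod_hom R (X k) (X (k - 1))"
    "x \<in> carrier (X k) \<Longrightarrow> d (k - 1) (d k x) = \<zero>\<^bsub>X (k - 2)\<^esub>"
    "x \<in> carrier (X k) \<Longrightarrow> d k x \<in> carrier (X (k - 1))"
  using assms mod_hom_closed[of "d k" R "X k" "X (k - 1)"]
  unfolding mod_complex_def fg_mod_iff fg_module_def by auto

lemma exact_complexD:
  assumes "exact_complex R X d"
  shows "mod_complex R X d" "x \<in> carrier (X k) \<Longrightarrow> d k x = \<zero>\<^bsub>X (k - 1)\<^esub> \<Longrightarrow> \<exists>y\<in>carrier (X (k + 1)). d (k + 1) y = x"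
proof -
  show "mod_complex R X d" using assms by (simp add: exact_complex_def)
  assume "x \<in> carrier (X k)" "d k x = \<zero>\<^bsub>X (k - 1)\<^esub>"
  then have "x \<in> d (k + 1) ` carrier (X (k + 1))"
    using assms by (simp add: exact_complex_def a_kernel_def')
  then show "\<exists>y\<in>carrier (X (k + 1)). d (k + 1) y = x" by blast
qed

lemma cycles_left_module:
  assumes "mod_complex R X d" shows "left_module R (cycles X d k)"
  unfolding cycles_def
  by (intro submodule_left_module kernel_submodule mod_complexD[OF assms])

lemma ses_cycles:
  assumes X: "exact_complex R X d"
  shows "ses R (cycles X d k) (\<lambda>x. x) (X k) (d k) (cycles X d (k - 1))"
proof -
  note C = mod_complexD[OF exact_complexD(1)[OF X]]
  have im: "d k ` carrier (X k) = a_kernel (X (k - 1)) (X (k - 1 - 1)) (d (k - 1))"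
    using X unfolding exact_complex_def by (metis diff_add_cancel)
  have d: "d k \<in> mod_hom R (X k) (cycles X d (k - 1))"
    unfolding cycles_def using im by (intro mod_hom_sub_target C) auto
  have "ses R ((X k)\<lparr>carrier := a_kernel (X k) (cycles X d (k - 1)) (d k)\<rparr>) (\<lambda>x. x) (X k) (d k) (cycles X d (k - 1))"
    using im by (intro ses_kernel C d cycles_left_module exact_complexD[OF X]) simp
  then show ?thesis by (simp add: cycles_def a_kernel_def')
qed


section \<open>Vanishing of Ext\<close>

text \<open>For a complex \<open>Y\<close> this says that the homology of \<open>Hom(M, Y)\<close> vanishes in degree \<open>a\<close>. If \<open>Y\<close>
  is an injective coresolution of \<open>N\<close>, placed in degrees \<open>0, -1, -2, \<dots>\<close>, then this homology is
  the group \<open>Ext(M, N)\<close> of degree \<open>-a\<close>.\<close>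

definition hom_acyclic ::
  "('a, 'r) ring_scheme \<Rightarrow> (int \<Rightarrow> 'a fgm) \<Rightarrow> (int \<Rightarrow> 'a fgmap) \<Rightarrow> int \<Rightarrow> ('a, 'b) module \<Rightarrow> bool" where
  "hom_acyclic R Y d a M \<longleftrightarrow>
    (\<forall>f\<in>mod_hom R M (Y a). (\<forall>x\<in>carrier M. d a (f x) = \<zero>\<^bsub>Y (a - 1)\<^esub>) \<longrightarrow>
      (\<exists>g\<in>mod_hom R M (Y (a + 1)). \<forall>x\<in>carrier M. d (a + 1) (g x) = f x))"

lemma hom_acyclicD:
  assumes "hom_acyclic R Y d a M" "f \<in> mod_hom R M (Y a)"
    "\<And>x. x \<in> carrier M \<Longrightarrow> d a (f x) = \<zero>\<^bsub>Y (a - 1)\<^esub>"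
  obtains g where "g \<in> mod_hom R M (Y (a + 1))" "\<And>x. x \<in> carrier M \<Longrightarrow> d (a + 1) (g x) = f x"
proof -
  have "\<exists>g\<in>mod_hom R M (Y (a + 1)). \<forall>x\<in>carrier M. d (a + 1) (g x) = f x"
    using assms(1)[unfolded hom_acyclic_def, THEN bspec, OF assms(2)] assms(3) by simp
  then obtain g where "g \<in> mod_hom R M (Y (a + 1))" "\<forall>x\<in>carrier M. d (a + 1) (g x) = f x" ..
  then show ?thesis using that by blast
qed

text \<open>Injectivity is a statement about the modules with elements in one type; it extends to all finitely
  generated modules through their representatives in this type.\<close>

lemma inj_obj_extend:
  assumes I: "inj_obj R I" and M: "fg_module R M" and N: "fg_module R N"
    and g: "g \<in> mod_hom R M N" "inj_on g (carrier M)" and f: "f \<in> mod_hom R M I"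
  shows "\<exists>h\<in>mod_hom R N I. \<forall>x\<in>carrier M. h (g x) = f x"
proof -
  obtain M' :: "'a fgm" and u v where M': "fg_module R M'" "u \<in> mod_hom R M M'" "v \<in> mod_hom R M' M"
    "\<And>x. x \<in> carrier M \<Longrightarrow> v (u x) = x" "\<And>y. y \<in> carrier M' \<Longrightarrow> u (v y) = y"
    by (rule fg_module_representative[OF M]) blast
  obtain N' :: "'a fgm" and s t where N': "fg_module R N'" "s \<in> mod_hom R N N'" "t \<in> mod_hom R N' N"
    "\<And>x. x \<in> carrier N \<Longrightarrow> t (s x) = x" "\<And>y. y \<in> carrier N' \<Longrightarrow> s (t y) = y"
    by (rule fg_module_representative[OF N]) blast
  let ?g = "\<lambda>x. s (g (v x))"
  have g': "?g \<in> mod_hom R M' N'" by (intro mod_hom_compose[OF _ N'(2)] mod_hom_compose[OF M'(3) g(1)])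
  have inj: "inj_on ?g (carrier M')"
  proof
    fix x y assume xy: "x \<in> carrier M'" "y \<in> carrier M'" "?g x = ?g y"
    note vc = mod_hom_closed[OF M'(3) xy(1)] mod_hom_closed[OF M'(3) xy(2)]
    have "g (v x) = g (v y)" using N'(4) mod_hom_closed[OF g(1)] vc xy(3) by metis
    then have "v x = v y" using g(2) vc by (auto dest: inj_onD)
    then show "x = y" using M'(5) xy by metis
  qed
  have f': "(\<lambda>x. f (v x)) \<in> mod_hom R M' I" by (rule mod_hom_compose[OF M'(3) f])
  have "\<forall>M\<in>fg_mod R. \<forall>N\<in>fg_mod R. \<forall>g\<in>mod_hom R M N. \<forall>f\<in>mod_hom R M I.
      inj_on g (carrier M) \<longrightarrow> (\<exists>h\<in>mod_hom R N I. \<forall>x\<in>carrier M. h (g x) = f x)"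
    using I by (simp add: inj_obj_def)
  then have "\<exists>h\<in>mod_hom R N' I. \<forall>x\<in>carrier M'. h (?g x) = f (v x)"
    by (elim ballE[of _ _ M'] ballE[of _ _ N'] ballE[of _ _ ?g] ballE[of _ _ "\<lambda>x. f (v x)"])
      (simp_all add: M'(1) N'(1) fg_mod_iff g' f' inj)
  then obtain h where h: "h \<in> mod_hom R N' I" "\<forall>x\<in>carrier M'. h (?g x) = f (v x)" by blast
  have "h (s (g x)) = f x" if "x \<in> carrier M" for x
    using h(2) mod_hom_closed[OF M'(2) that] M'(4)[OF that] by force
  then show ?thesis using mod_hom_compose[OF N'(2) h(1)] by (intro bexI[of _ "\<lambda>x. h (s x)"]) auto
qed

lemma inj_obj_retract:
  assumes I: "inj_obj R I" and J: "fg_module R J" and i: "i \<in> mod_hom R J I" and p: "p \<in> mod_hom R I J"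
    and pi: "\<And>x. x \<in> carrier J \<Longrightarrow> p (i x) = x"
  shows "inj_obj R J"
  unfolding inj_obj_def fg_mod_iff
proof (intro conjI ballI impI J)
  fix M N g f assume *: "M \<in> fg_mod R" "N \<in> fg_mod R" "g \<in> mod_hom R M N" "f \<in> mod_hom R M J"
    "inj_on g (carrier M)"
  from inj_obj_extend[OF I _ _ *(3,5) mod_hom_compose[OF *(4) i]] *(1,2)
  obtain h where h: "h \<in> mod_hom R N I" "\<forall>x\<in>carrier M. h (g x) = i (f x)" by (auto simp: fg_mod_iff)
  have "\<forall>x\<in>carrier M. p (h (g x)) = f x"
    using h(2) pi mod_hom_closed[OF *(4)] by simp
  then show "\<exists>h\<in>mod_hom R N J. \<forall>x\<in>carrier M. h (g x) = f x"
    by (rule bexI[of _ "\<lambda>x. p (h x)", OF _ mod_hom_compose[OF h(1) p]])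
qed

lemma inj_obj_zero: "zero_mod I \<Longrightarrow> fg_module R I \<Longrightarrow> inj_obj R I"
  unfolding inj_obj_def fg_mod_iff
proof (intro conjI ballI impI)
  fix M N f g assume *: "zero_mod I" "fg_module R I" "f \<in> mod_hom R M I"
  have "\<forall>x\<in>carrier M. \<zero>\<^bsub>I\<^esub> = f x"
    using mod_hom_closed[OF *(3)] *(1) by (simp add: zero_mod_def)
  then show "\<exists>h\<in>mod_hom R N I. \<forall>x\<in>carrier M. h (g x) = f x"
    by (rule bexI[of _ "\<lambda>_. \<zero>\<^bsub>I\<^esub>", OF _ zero_in_mod_hom[OF fg_moduleD[OF *(2)]]])
qed

lemma hom_acyclic_zero:
  assumes M: "left_module R M" "zero_mod M" and Y: "mod_complex R Y d"
  shows "hom_acyclic R Y d a M"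
  unfolding hom_acyclic_def
proof (intro ballI impI)
  note Y' = mod_complexD(2)[OF Y]
  fix f assume f: "f \<in> mod_hom R M (Y a)"
  have "d (a + 1) \<zero>\<^bsub>Y (a + 1)\<^esub> = f x" if "x \<in> carrier M" for x
    using mod_hom_zero[OF Y' Y' mod_complexD(3)[OF Y], of "a + 1"] mod_hom_zero[OF M(1) Y' f] that M(2)
    by (simp add: zero_mod_def)
  then show "\<exists>g\<in>mod_hom R M (Y (a + 1)). \<forall>x\<in>carrier M. d (a + 1) (g x) = f x"
    using zero_in_mod_hom[OF Y'] by (intro bexI[of _ "\<lambda>_. \<zero>\<^bsub>Y (a + 1)\<^esub>"]) auto
qed

lemma hom_acyclic_retract:
  assumes N: "hom_acyclic R Y d a N" and i: "i \<in> mod_hom R M N" and p: "p \<in> mod_hom R N M"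
    and pi: "\<And>x. x \<in> carrier M \<Longrightarrow> p (i x) = x"
  shows "hom_acyclic R Y d a M"
  unfolding hom_acyclic_def
proof (intro ballI impI)
  fix f assume f: "f \<in> mod_hom R M (Y a)" "\<forall>x\<in>carrier M. d a (f x) = \<zero>\<^bsub>Y (a - 1)\<^esub>"
  obtain g where g: "g \<in> mod_hom R N (Y (a + 1))" "\<And>x. x \<in> carrier N \<Longrightarrow> d (a + 1) (g x) = f (p x)"
    using hom_acyclicD[OF N mod_hom_compose[OF p f(1)]] f(2) mod_hom_closed[OF p] by auto
  show "\<exists>g\<in>mod_hom R M (Y (a + 1)). \<forall>x\<in>carrier M. d (a + 1) (g x) = f x"
    using mod_hom_compose[OF i g(1)] g(2) mod_hom_closed[OF i] pi by (intro bexI[of _ "\<lambda>x. g (i x)"]) auto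
qed

text \<open>The next two lemmas are parts of the long exact homology sequence that a short exact sequence of modules
  induces for \<open>Hom(-, Y)\<close>, where injectivity of the terms of \<open>Y\<close> makes the restriction from \<open>M\<close> to \<open>L\<close>
  surjective.\<close>

lemma hom_acyclic_quotient:
  assumes Y: "mod_complex R Y d" and inj: "\<And>k. inj_obj R (Y k)"
    and s: "ses R L i M p N" and L: "fg_module R L" and M: "fg_module R M"
    and hL: "hom_acyclic R Y d (a + 1) L" and hM: "hom_acyclic R Y d a M"
  shows "hom_acyclic R Y d a N"
  unfolding hom_acyclic_def
proof (intro ballI impI)
  note s' = sesD[OF s] and C = mod_complexD[OF Y]
  fix f assume f: "f \<in> mod_hom R N (Y a)" "\<forall>x\<in>carrier N. d a (f x) = \<zero>\<^bsub>Y (a - 1)\<^esub>"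
  obtain g where g: "g \<in> mod_hom R M (Y (a + 1))" "\<And>x. x \<in> carrier M \<Longrightarrow> d (a + 1) (g x) = f (p x)"
    using hom_acyclicD[OF hM mod_hom_compose[OF s'(6) f(1)]] f(2) s'(12) by auto
  have d1: "d (a + 1) \<in> mod_hom R (Y (a + 1)) (Y a)" using C(3)[of "a + 1"] by simp
  have a2: "a + 2 - 1 = a + 1" "a + 2 - 2 = a" by simp_all
  have d2: "d (a + 2) \<in> mod_hom R (Y (a + 2)) (Y (a + 1))" using C(3)[of "a + 2"] by (simp only: a2)
  have "d (a + 1) (g (i y)) = \<zero>\<^bsub>Y a\<^esub>" if "y \<in> carrier L" for y
    using g(2)[OF s'(10)[OF that]] s'(9)[OF that] mod_hom_zero[OF s'(3) C(2) f(1)] by simp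
  then obtain l where l: "l \<in> mod_hom R L (Y (a + 2))" "\<And>y. y \<in> carrier L \<Longrightarrow> d (a + 2) (l y) = g (i y)"
    using hom_acyclicD[OF hL mod_hom_compose[OF s'(4) g(1)]] by (auto simp: add.assoc)
  obtain m where m: "m \<in> mod_hom R M (Y (a + 2))" "\<forall>y\<in>carrier L. m (i y) = l y"
    using inj_obj_extend[OF inj L M s'(4,5) l(1)] by blast
  note mc = mod_hom_closed[OF m(1)]
  let ?g = "\<lambda>x. g x \<ominus>\<^bsub>Y (a + 1)\<^esub> d (a + 2) (m x)"
  have g': "?g \<in> mod_hom R M (Y (a + 1))" by (rule mod_hom_diff[OF C(2) g(1) mod_hom_compose[OF m(1) d2]])
  have "?g (i y) = \<zero>\<^bsub>Y (a + 1)\<^esub>" if "y \<in> carrier L" for y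
    using m(2) l(2)[OF that] that left_module_minus(3)[OF C(2)] mod_hom_closed[OF g(1) s'(10)[OF that]] by simp
  then obtain h where h: "h \<in> mod_hom R N (Y (a + 1))" "\<forall>x\<in>carrier M. h (p x) = ?g x"
    using ses_factor[OF s C(2) g'] by blast
  have "d (a + 1) (h z) = f z" if z: "z \<in> carrier N" for z
  proof -
    obtain x where x: "x \<in> carrier M" "z = p x" using s'(13)[OF z] by blast
    have "d (a + 1) (d (a + 2) (m x)) = \<zero>\<^bsub>Y a\<^esub>" using C(4)[of "m x" "a + 2", OF mc[OF x(1)]] by (simp only: a2)
    then have "d (a + 1) (?g x) = f (p x)"
      using mod_hom_minus[OF C(2) C(2) d1 mod_hom_closed[OF g(1) x(1)] mod_hom_closed[OF d2 mc[OF x(1)]]]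
        g(2)[OF x(1)] left_module_minus(5)[OF C(2) mod_hom_closed[OF f(1) s'(12)[OF x(1)]] left_module_basics(3)[OF C(2)]]
      by simp
    then show ?thesis using h(2) x by simp
  qed
  then show "\<exists>g\<in>mod_hom R N (Y (a + 1)). \<forall>x\<in>carrier N. d (a + 1) (g x) = f x" using h(1) by blast
qed

lemma hom_acyclic_sub:
  assumes Y: "mod_complex R Y d" and inj: "\<And>k. inj_obj R (Y k)"
    and s: "ses R L i M p N" and L: "fg_module R L" and M: "fg_module R M"
    and hM: "hom_acyclic R Y d a M" and hN: "hom_acyclic R Y d (a - 1) N"
  shows "hom_acyclic R Y d a L"
  unfolding hom_acyclic_def
proof (intro ballI impI)
  note s' = sesD[OF s] and C = mod_complexD[OF Y]
  fix f assume f: "f \<in> mod_hom R L (Y a)" "\<forall>x\<in>carrier L. d a (f x) = \<zero>\<^bsub>Y (a - 1)\<^esub>"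
  obtain f' where f': "f' \<in> mod_hom R M (Y a)" "\<forall>y\<in>carrier L. f' (i y) = f y"
    using inj_obj_extend[OF inj L M s'(4,5) f(1)] by blast
  have "d a (f' (i y)) = \<zero>\<^bsub>Y (a - 1)\<^esub>" if "y \<in> carrier L" for y using that f(2) f'(2) by simp
  then obtain c where c: "c \<in> mod_hom R N (Y (a - 1))" "\<forall>x\<in>carrier M. c (p x) = d a (f' x)"
    using ses_factor[OF s C(2) mod_hom_compose[OF f'(1) C(3)]] by blast
  have "d (a - 1) (c z) = \<zero>\<^bsub>Y (a - 1 - 1)\<^esub>" if z: "z \<in> carrier N" for z
  proof -
    obtain x where x: "x \<in> carrier M" "z = p x" using s'(13)[OF z] by blast
    then show ?thesis using c(2) C(4)[of "f' x" a] mod_hom_closed[OF f'(1) x(1)] by simp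
  qed
  then obtain h where h: "h \<in> mod_hom R N (Y a)" "\<And>z. z \<in> carrier N \<Longrightarrow> d a (h z) = c z"
    using hom_acyclicD[OF hN c(1)] by auto
  let ?f = "\<lambda>x. f' x \<ominus>\<^bsub>Y a\<^esub> h (p x)"
  have f'': "?f \<in> mod_hom R M (Y a)" by (rule mod_hom_diff[OF C(2) f'(1) mod_hom_compose[OF s'(6) h(1)]])
  have "d a (?f x) = \<zero>\<^bsub>Y (a - 1)\<^esub>" if x: "x \<in> carrier M" for x
    using mod_hom_minus[OF C(2) C(2) C(3) mod_hom_closed[OF f'(1) x] mod_hom_closed[OF h(1) s'(12)[OF x]]]
      h(2)[OF s'(12)[OF x]] c(2) x left_module_minus(3)[OF C(2)] mod_hom_closed[OF c(1) s'(12)[OF x]] by simp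
  then obtain g where g: "g \<in> mod_hom R M (Y (a + 1))" "\<And>x. x \<in> carrier M \<Longrightarrow> d (a + 1) (g x) = ?f x"
    using hom_acyclicD[OF hM f''] by auto
  have "d (a + 1) (g (i y)) = f y" if y: "y \<in> carrier L" for y
    using g(2)[OF s'(10)[OF y]] f'(2) y s'(9)[OF y] mod_hom_zero[OF s'(3) C(2) h(1)]
      left_module_minus(5)[OF C(2) mod_hom_closed[OF f(1) y] left_module_basics(3)[OF C(2)]] by simp
  then show "\<exists>g\<in>mod_hom R L (Y (a + 1)). \<forall>x\<in>carrier L. d (a + 1) (g x) = f x"
    using mod_hom_compose[OF s'(4) g(1)] by (intro bexI[of _ "\<lambda>y. g (i y)"]) auto
qed


subsection \<open>Finite injective coresolutions of the regular module\<close>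

locale injective_coresolution =
  fixes R :: "('a, 'r) ring_scheme" and X :: "int \<Rightarrow> 'a fgm" and d :: "int \<Rightarrow> 'a fgmap" and n :: nat
  assumes ring: "ring R" and exact: "exact_complex R X d" and reg: "mod_iso R (reg_mod R) (X 1)"
    and inj: "\<And>i. - int n \<le> i \<Longrightarrow> i \<le> 0 \<Longrightarrow> inj_obj R (X i)"
    and zero: "\<And>i. i < - int n \<or> 1 < i \<Longrightarrow> zero_mod (X i)"
begin

text \<open>The regular module in degree \<open>1\<close> is deleted, so that the complex of injectives computes \<open>Ext(-, R)\<close> in
  all degrees, including degree zero.\<close>

definition Y :: "int \<Rightarrow> 'a fgm" where "Y i = (if i \<le> 0 then X i else zero_obj)"

definition e :: "int \<Rightarrow> 'a fgmap" where "e i = (if i \<le> 0 then d i else (\<lambda>_. \<zero>\<^bsub>Y (i - 1)\<^esub>))"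

lemmas cpx = mod_complexD[OF exact_complexD(1)[OF exact]]

lemma Y_complex: "mod_complex R Y e"
proof -
  have fg: "fg_module R (Y i)" for i
    using cpx(1) dualizable_fg[OF dualizable_zero_obj[OF ring]] by (simp add: Y_def)
  have e: "e i \<in> mod_hom R (Y i) (Y (i - 1))" for i
  proof (cases "i \<le> 0")
    case True then show ?thesis using cpx(3)[of i] by (simp add: e_def Y_def)
  next
    case False then show ?thesis using zero_in_mod_hom[OF fg_moduleD[OF fg], of "i - 1" "Y i"] by (simp add: e_def)
  qed
  have z: "e i \<zero>\<^bsub>Y i\<^esub> = \<zero>\<^bsub>Y (i - 1)\<^esub>" for i
    by (rule mod_hom_zero[OF fg_moduleD[OF fg] fg_moduleD[OF fg] e])
  have "e (i - 1) (e i x) = \<zero>\<^bsub>Y (i - 2)\<^esub>" if x: "x \<in> carrier (Y i)" for i x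
  proof (cases "i \<le> 0")
    case True then show ?thesis using cpx(4)[of x i] x by (simp add: e_def Y_def)
  next
    case False then show ?thesis using z[of "i - 1"] by (simp add: e_def[of i])
  qed
  then show ?thesis unfolding mod_complex_def fg_mod_iff using fg e by blast
qed

lemma Y_injective: "inj_obj R (Y i)"
proof (cases "- int n \<le> i \<and> i \<le> 0")
  case True then show ?thesis using inj by (simp add: Y_def)
next
  case False
  then have "zero_mod (Y i)" using zero[of i] by (auto simp: Y_def)
  then show ?thesis using inj_obj_zero mod_complexD(1)[OF Y_complex] by blast
qed

abbreviation ext_zero :: "nat \<Rightarrow> ('a, 'b) module \<Rightarrow> bool" where
  "ext_zero k M \<equiv> hom_acyclic R Y e (- int k) M"

lemma ext_zero_large:
  assumes M: "left_module R M" and k: "n < k"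
  shows "ext_zero k M"
  unfolding hom_acyclic_def
proof (intro ballI impI)
  note Y' = mod_complexD(2)[OF Y_complex] and e = mod_complexD(3)[OF Y_complex]
  fix f assume f: "f \<in> mod_hom R M (Y (- int k))"
  have "zero_mod (Y (- int k))" using zero[of "- int k"] k by (simp add: Y_def)
  then have "f x = \<zero>\<^bsub>Y (- int k)\<^esub>" if "x \<in> carrier M" for x
    using mod_hom_closed[OF f that] by (simp add: zero_mod_def)
  then show "\<exists>g\<in>mod_hom R M (Y (- int k + 1)). \<forall>x\<in>carrier M. e (- int k + 1) (g x) = f x"
    using zero_in_mod_hom[OF Y', of _ M] mod_hom_zero[OF Y' Y' e, of "- int k + 1"]
    by (intro bexI[of _ "\<lambda>_. \<zero>\<^bsub>Y (- int k + 1)\<^esub>"]) auto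
qed

lemma ext_zero_projective:
  assumes P: "dualizable R P" and k: "1 \<le> k"
  shows "ext_zero k P"
  unfolding hom_acyclic_def
proof (intro ballI impI)
  let ?a = "- int k"
  have a: "?a \<le> 0" "?a + 1 \<le> 0" using k by auto
  fix f assume f: "f \<in> mod_hom R P (Y ?a)" "\<forall>x\<in>carrier P. e ?a (f x) = \<zero>\<^bsub>Y (?a - 1)\<^esub>"
  have fX: "f \<in> mod_hom R P (X ?a)" using f(1) a by (simp add: Y_def)
  have "f ` carrier P \<subseteq> a_kernel (X ?a) (X (?a - 1)) (d ?a)"
    using mod_hom_closed[OF fX] f(2) a by (auto simp: a_kernel_def' e_def Y_def)
  then have f': "f \<in> mod_hom R P (cycles X d ?a)" unfolding cycles_def by (rule mod_hom_sub_target[OF fX])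
  have s: "ses R (cycles X d (?a + 1)) (\<lambda>x. x) (X (?a + 1)) (d (?a + 1)) (cycles X d ?a)"
    using ses_cycles[OF exact, of "?a + 1"] by simp
  show "\<exists>g\<in>mod_hom R P (Y (?a + 1)). \<forall>x\<in>carrier P. e (?a + 1) (g x) = f x"
    using dualizable_lift[OF P sesD(2,3,6,7)[OF s] f'] a by (simp add: Y_def e_def)
qed

lemma ext_zero_quotient:
  assumes s: "ses R L i M p N" "fg_module R L" "fg_module R M"
    and "ext_zero k L" "ext_zero (Suc k) M"
  shows "ext_zero (Suc k) N"
  using hom_acyclic_quotient[OF Y_complex Y_injective s, of "- int (Suc k)"] assms(4,5) by simp

lemma ext_zero_sub:
  assumes s: "ses R L i M p N" "fg_module R L" "fg_module R M"
    and "ext_zero k M" "ext_zero (Suc k) N"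
  shows "ext_zero k L"
proof -
  have "- int (Suc k) = - int k - 1" by simp
  then show ?thesis using hom_acyclic_sub[OF Y_complex Y_injective s, of "- int k"] assms(4,5) by (simp only:)
qed

lemma reg_iso:
  obtains u v where "u \<in> mod_hom R (reg_mod R) (X 1)" "v \<in> mod_hom R (X 1) (reg_mod R)"
    "\<And>x. x \<in> carrier R \<Longrightarrow> v (u x) = x" "\<And>y. y \<in> carrier (X 1) \<Longrightarrow> u (v y) = y"
  using mod_isoE[OF reg_mod_left_module[OF ring] reg] by (metis reg_mod_simps(1))

lemma d1: "d 1 \<in> mod_hom R (X 1) (X 0)" "inj_on (d 1) (carrier (X 1))"
  "\<And>x. x \<in> carrier (X 0) \<Longrightarrow> d 0 x = \<zero>\<^bsub>X (- 1)\<^esub> \<Longrightarrow> x \<in> d 1 ` carrier (X 1)"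
  "\<And>x. x \<in> carrier (X 1) \<Longrightarrow> d 0 (d 1 x) = \<zero>\<^bsub>X (- 1)\<^esub>"
proof -
  show 1: "d 1 \<in> mod_hom R (X 1) (X 0)" using cpx(3)[of 1] by simp
  show "inj_on (d 1) (carrier (X 1))"
  proof (rule inj_mod_homI[OF cpx(2) cpx(2) 1])
    fix x assume "x \<in> carrier (X 1)" "d 1 x = \<zero>\<^bsub>X 0\<^esub>"
    then obtain y where y: "y \<in> carrier (X 2)" "d 2 y = x" using exact_complexD(2)[OF exact, of x 1] by auto
    then have "y = \<zero>\<^bsub>X 2\<^esub>" using zero[of 2] by (simp add: zero_mod_def)
    then show "x = \<zero>\<^bsub>X 1\<^esub>" using mod_hom_zero[OF cpx(2) cpx(2) cpx(3), of 2] y by simp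
  qed
  show "x \<in> d 1 ` carrier (X 1)" if "x \<in> carrier (X 0)" "d 0 x = \<zero>\<^bsub>X (- 1)\<^esub>" for x
    using exact_complexD(2)[OF exact, of x 0] that by auto
  show "d 0 (d 1 x) = \<zero>\<^bsub>X (- 1)\<^esub>" if "x \<in> carrier (X 1)" for x using cpx(4)[of x 1] that by simp
qed

lemma Y_e_small: "Y 0 = X 0" "Y (- 1) = X (- 1)" "Y (- 2) = X (- 2)" "e 0 = d 0" "e (- 1) = d (- 1)"
  by (auto simp: Y_def e_def)

text \<open>The obstruction to an extension of \<open>\<phi>\<close> is its image under the connecting homomorphism from \<open>Hom(L, R)\<close> to
  \<open>Ext(N, R)\<close> in degree one.\<close>

lemma ext_zero_extend:
  assumes s: "ses R L i M p N" and L: "fg_module R L" and M: "fg_module R M" and N: "ext_zero 1 N"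
    and \<phi>: "\<phi> \<in> mod_hom R L (reg_mod R)"
  shows "\<exists>\<psi>\<in>mod_hom R M (reg_mod R). \<forall>y\<in>carrier L. \<psi> (i y) = \<phi> y"
proof -
  note s' = sesD[OF s]
  obtain u v where uv: "u \<in> mod_hom R (reg_mod R) (X 1)" "v \<in> mod_hom R (X 1) (reg_mod R)"
    "\<And>x. x \<in> carrier R \<Longrightarrow> v (u x) = x" "\<And>y. y \<in> carrier (X 1) \<Longrightarrow> u (v y) = y" by (rule reg_iso) blast
  have u\<phi>: "(\<lambda>y. u (\<phi> y)) \<in> mod_hom R L (X 1)" by (rule mod_hom_compose[OF \<phi> uv(1)])
  note u\<phi>c = mod_hom_closed[OF u\<phi>]
  have d0: "d 0 \<in> mod_hom R (X 0) (X (- 1))" using cpx(3)[of 0] by simp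
  obtain g where g: "g \<in> mod_hom R M (X 0)" "\<forall>y\<in>carrier L. g (i y) = d 1 (u (\<phi> y))"
    using inj_obj_extend[OF inj[of 0] L M s'(4,5) mod_hom_compose[OF u\<phi> d1(1)]] by auto
  have "d 0 (g (i y)) = \<zero>\<^bsub>X (- 1)\<^esub>" if "y \<in> carrier L" for y using that g(2) d1(4) u\<phi>c by simp
  then obtain c where c: "c \<in> mod_hom R N (X (- 1))" "\<forall>x\<in>carrier M. c (p x) = d 0 (g x)"
    using ses_factor[OF s cpx(2) mod_hom_compose[OF g(1) d0]] by blast
  have "d (- 1) (c z) = \<zero>\<^bsub>X (- 2)\<^esub>" if z: "z \<in> carrier N" for z
  proof -
    obtain x where x: "x \<in> carrier M" "z = p x" using s'(13)[OF z] by blast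
    then show ?thesis using c(2) cpx(4)[of "g x" 0] mod_hom_closed[OF g(1) x(1)] by simp
  qed
  then obtain h where h: "h \<in> mod_hom R N (X 0)" "\<And>z. z \<in> carrier N \<Longrightarrow> d 0 (h z) = c z"
    using hom_acyclicD[OF N, of c] c(1) by (auto simp: Y_e_small)
  let ?g = "\<lambda>x. g x \<ominus>\<^bsub>X 0\<^esub> h (p x)"
  have g': "?g \<in> mod_hom R M (X 0)" by (rule mod_hom_diff[OF cpx(2) g(1) mod_hom_compose[OF s'(6) h(1)]])
  have "d 0 (?g x) = \<zero>\<^bsub>X (- 1)\<^esub>" if x: "x \<in> carrier M" for x
    using mod_hom_minus[OF cpx(2) cpx(2) d0 mod_hom_closed[OF g(1) x] mod_hom_closed[OF h(1) s'(12)[OF x]]]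
      h(2)[OF s'(12)[OF x]] c(2) x left_module_minus(3)[OF cpx(2)] mod_hom_closed[OF c(1) s'(12)[OF x]] by simp
  then have "?g ` carrier M \<subseteq> d 1 ` carrier (X 1)" using d1(3) mod_hom_closed[OF g'] by blast
  then obtain m where m: "m \<in> mod_hom R M (X 1)" "\<forall>x\<in>carrier M. d 1 (m x) = ?g x"
    using mod_hom_corestrict[OF cpx(2) cpx(2) d1(1,2) g' _ s'(2)] by blast
  have "v (m (i y)) = \<phi> y" if y: "y \<in> carrier L" for y
  proof -
    have "?g (i y) = d 1 (u (\<phi> y))"
      using g(2) y s'(9)[OF y] mod_hom_zero[OF s'(3) cpx(2) h(1)]
        left_module_minus(5)[OF cpx(2) mod_hom_closed[OF d1(1) u\<phi>c[OF y]] left_module_basics(3)[OF cpx(2)]] by simp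
    then have "d 1 (m (i y)) = d 1 (u (\<phi> y))" using m(2) s'(10)[OF y] by simp
    then have "m (i y) = u (\<phi> y)"
      using inj_onD[OF d1(2)] mod_hom_closed[OF m(1) s'(10)[OF y]] u\<phi>c[OF y] by blast
    then show ?thesis using uv(3) mod_hom_closed[OF \<phi> y] by simp
  qed
  then show ?thesis using mod_hom_compose[OF m(1) uv(2)] by (intro bexI[of _ "\<lambda>x. v (m x)"]) auto
qed

text \<open>The same connecting homomorphism is surjective, because \<open>Ext(M, R)\<close> vanishes in degree one; it is zero
  because functionals extend.\<close>

lemma ext_zero_of_extend:
  assumes s: "ses R L i M p N" and M: "ext_zero 1 M"
    and ext: "\<And>\<phi>. \<phi> \<in> mod_hom R L (reg_mod R) \<Longrightarrow>
      \<exists>\<psi>\<in>mod_hom R M (reg_mod R). \<forall>y\<in>carrier L. \<psi> (i y) = \<phi> y"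
  shows "ext_zero 1 N"
  unfolding hom_acyclic_def
proof (intro ballI impI)
  note s' = sesD[OF s]
  obtain u v where uv: "u \<in> mod_hom R (reg_mod R) (X 1)" "v \<in> mod_hom R (X 1) (reg_mod R)"
    "\<And>x. x \<in> carrier R \<Longrightarrow> v (u x) = x" "\<And>y. y \<in> carrier (X 1) \<Longrightarrow> u (v y) = y" by (rule reg_iso) blast
  have d0: "d 0 \<in> mod_hom R (X 0) (X (- 1))" using cpx(3)[of 0] by simp
  fix f assume "f \<in> mod_hom R N (Y (- int 1))" "\<forall>x\<in>carrier N. e (- int 1) (f x) = \<zero>\<^bsub>Y (- int 1 - 1)\<^esub>"
  then have f: "f \<in> mod_hom R N (X (- 1))" "\<forall>x\<in>carrier N. d (- 1) (f x) = \<zero>\<^bsub>X (- 2)\<^esub>"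
    by (simp_all add: Y_e_small)
  obtain g where g: "g \<in> mod_hom R M (X 0)" "\<And>x. x \<in> carrier M \<Longrightarrow> d 0 (g x) = f (p x)"
    using hom_acyclicD[OF M, of "\<lambda>x. f (p x)"] mod_hom_compose[OF s'(6) f(1)] f(2) s'(12)
    by (auto simp: Y_e_small)
  have gi: "(\<lambda>y. g (i y)) \<in> mod_hom R L (X 0)" by (rule mod_hom_compose[OF s'(4) g(1)])
  have "d 0 (g (i y)) = \<zero>\<^bsub>X (- 1)\<^esub>" if "y \<in> carrier L" for y
    using g(2)[OF s'(10)[OF that]] s'(9)[OF that] mod_hom_zero[OF s'(3) cpx(2) f(1)] by simp
  then have "(\<lambda>y. g (i y)) ` carrier L \<subseteq> d 1 ` carrier (X 1)" using d1(3) mod_hom_closed[OF gi] by blast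
  then obtain l where l: "l \<in> mod_hom R L (X 1)" "\<forall>y\<in>carrier L. d 1 (l y) = g (i y)"
    using mod_hom_corestrict[OF cpx(2) cpx(2) d1(1,2) gi _ s'(1)] by blast
  obtain \<psi> where \<psi>: "\<psi> \<in> mod_hom R M (reg_mod R)" "\<forall>y\<in>carrier L. \<psi> (i y) = v (l y)"
    using ext[OF mod_hom_compose[OF l(1) uv(2)]] by blast
  have m: "(\<lambda>x. d 1 (u (\<psi> x))) \<in> mod_hom R M (X 0)"
    by (rule mod_hom_compose[OF mod_hom_compose[OF \<psi>(1) uv(1)] d1(1)])
  let ?g = "\<lambda>x. g x \<ominus>\<^bsub>X 0\<^esub> d 1 (u (\<psi> x))"
  have g': "?g \<in> mod_hom R M (X 0)" by (rule mod_hom_diff[OF cpx(2) g(1) m])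
  have "?g (i y) = \<zero>\<^bsub>X 0\<^esub>" if y: "y \<in> carrier L" for y
    using \<psi>(2) l(2) y uv(4)[OF mod_hom_closed[OF l(1) y]] left_module_minus(3)[OF cpx(2)]
      mod_hom_closed[OF gi y] by simp
  then obtain h where h: "h \<in> mod_hom R N (X 0)" "\<forall>x\<in>carrier M. h (p x) = ?g x"
    using ses_factor[OF s cpx(2) g'] by blast
  have "d 0 (h z) = f z" if z: "z \<in> carrier N" for z
  proof -
    obtain x where x: "x \<in> carrier M" "z = p x" using s'(13)[OF z] by blast
    have "d 0 (d 1 (u (\<psi> x))) = \<zero>\<^bsub>X (- 1)\<^esub>"
      using d1(4)[OF mod_hom_closed[OF uv(1) mod_hom_closed[OF \<psi>(1) x(1)]]] .
    then have "d 0 (?g x) = f (p x)"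
      using mod_hom_minus[OF cpx(2) cpx(2) d0 mod_hom_closed[OF g(1) x(1)] mod_hom_closed[OF m x(1)]]
        g(2)[OF x(1)] left_module_minus(5)[OF cpx(2) mod_hom_closed[OF f(1) s'(12)[OF x(1)]] left_module_basics(3)[OF cpx(2)]]
      by simp
    then show ?thesis using h(2) x by simp
  qed
  then show "\<exists>g\<in>mod_hom R N (Y (- int 1 + 1)). \<forall>x\<in>carrier N. e (- int 1 + 1) (g x) = f x"
    using h(1) by (intro bexI[of _ h]) (auto simp: Y_e_small)
qed

text \<open>The identity of the last injective is a cocycle, and a lift of it splits the last map of the
  coresolution. The kernel of this map is then a direct summand of an injective module and can take the
  last place.\<close>

lemma shorten:
  assumes n: "n = Suc m" and split: "ext_zero n (X (- int n))" and noeth: "left_noetherian R"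
  shows "\<exists>X' d'. injective_coresolution R X' d' m"
proof -
  define a where "a = - int m"
  have a: "- int n = a - 1" "a \<le> 0" using n by (auto simp: a_def)
  have zn: "zero_mod (X (a - 2))" using zero[of "a - 2"] a by simp
  note da = cpx(3)[of a]
  have "d (a - 1) x = \<zero>\<^bsub>X (a - 2)\<^esub>" if "x \<in> carrier (X (a - 1))" for x
    using cpx(5)[OF that] zn by (simp add: zero_mod_def)
  then obtain w where w: "w \<in> mod_hom R (X (a - 1)) (X a)" "\<And>x. x \<in> carrier (X (a - 1)) \<Longrightarrow> d a (w x) = x"
    using hom_acyclicD[OF split, of "\<lambda>x. x"] id_in_mod_hom[of R "X (a - 1)"] a by (auto simp: Y_def e_def)
  let ?r = "\<lambda>x. x \<ominus>\<^bsub>X a\<^esub> w (d a x)"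
  have r: "?r \<in> mod_hom R (X a) (X a)"
    by (rule mod_hom_diff[OF cpx(2) id_in_mod_hom mod_hom_compose[OF da w(1)]])
  have "d a (?r x) = \<zero>\<^bsub>X (a - 1)\<^esub>" if x: "x \<in> carrier (X a)" for x
    using mod_hom_minus[OF cpx(2) cpx(2) da x mod_hom_closed[OF w(1) cpx(5)[OF x]]] w(2)[OF cpx(5)[OF x]]
      left_module_minus(3)[OF cpx(2) cpx(5)[OF x] cpx(5)[OF x]] by simp
  then have r': "?r \<in> mod_hom R (X a) (cycles X d a)"
    unfolding cycles_def using mod_hom_closed[OF r] by (intro mod_hom_sub_target[OF r]) (auto simp: a_kernel_def')
  have Za: "submodule (a_kernel (X a) (X (a - 1)) (d a)) R (X a)" by (rule kernel_submodule[OF cpx(2) cpx(2) da])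
  have fgZ: "fg_module R (cycles X d a)"
    unfolding cycles_def by (rule noetherian_submodule_fg[OF noeth cpx(1) Za])
  have injZ: "inj_obj R (cycles X d a)"
  proof (rule inj_obj_retract[OF _ fgZ _ r'])
    show "inj_obj R (X a)" using a by (intro inj) auto
    show "(\<lambda>x. x) \<in> mod_hom R (cycles X d a) (X a)"
      unfolding cycles_def by (rule mod_hom_sub_source[OF id_in_mod_hom submoduleD(1)[OF Za]])
    show "?r x = x" if "x \<in> carrier (cycles X d a)" for x
      using that mod_hom_zero[OF cpx(2) cpx(2) w(1)] left_module_minus(5)[OF cpx(2)[of a], of x "\<zero>\<^bsub>X a\<^esub>"]
        left_module_basics(3)[OF cpx(2)[of a]] by (simp add: a_kernel_def')
  qed
  define X' where "X' i = (if a < i then X i else if i = a then cycles X d a else zero_obj)" for i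
  define d' where "d' i = (if a < i then d i else (\<lambda>_. \<zero>\<^bsub>X' (i - 1)\<^esub>))" for i
  have fg': "fg_module R (X' i)" for i
    using cpx(1) fgZ dualizable_fg[OF dualizable_zero_obj[OF ring]] by (simp add: X'_def)
  note lm' = fg_moduleD[OF fg']
  have ca: "carrier (cycles X d a) = d (a + 1) ` carrier (X (a + 1))"
    using exact by (simp add: exact_complex_def)
  have hom': "d' i \<in> mod_hom R (X' i) (X' (i - 1))" for i
  proof -
    consider "i \<le> a" | "i = a + 1" | "a + 1 < i" by linarith
    then show ?thesis
    proof cases
      case 1 then show ?thesis using zero_in_mod_hom[OF lm'] by (simp add: d'_def)
    next
      case 2
      have "d (a + 1) \<in> mod_hom R (X (a + 1)) (X a)" using cpx(3)[of "a + 1"] by simp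
      then have "d (a + 1) \<in> mod_hom R (X (a + 1)) (cycles X d a)"
        using ca unfolding cycles_def by (intro mod_hom_sub_target) auto
      then show ?thesis using 2 by (simp add: d'_def X'_def)
    next
      case 3 then show ?thesis using cpx(3)[of i] by (simp add: d'_def X'_def)
    qed
  qed
  have ex: "d (i + 1) ` carrier (X (i + 1)) = a_kernel (X i) (X (i - 1)) (d i)" for i
    using exact by (simp add: exact_complex_def)
  have z': "d' i \<zero>\<^bsub>X' i\<^esub> = \<zero>\<^bsub>X' (i - 1)\<^esub>" for i by (rule mod_hom_zero[OF lm' lm' hom'])
  have ex': "d' (i + 1) ` carrier (X' (i + 1)) = a_kernel (X' i) (X' (i - 1)) (d' i)" for i
  proof -
    consider "i < a" | "i = a" | "i = a + 1" | "a + 1 < i" by linarith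
    then show ?thesis
    proof cases
      case 1
      have ne: "carrier (X' (i + 1)) \<noteq> {}" using left_module_basics(3)[OF lm'] by blast
      have "d' (i + 1) ` carrier (X' (i + 1)) = {\<zero>\<^bsub>X' i\<^esub>}" using 1 ne by (auto simp: d'_def)
      also have "\<dots> = a_kernel (X' i) (X' (i - 1)) (d' i)" using 1 by (auto simp: d'_def X'_def a_kernel_def')
      finally show ?thesis .
    next
      case 2 then show ?thesis using ca by (auto simp: X'_def d'_def a_kernel_def')
    next
      case 3
      then show ?thesis using ex[of i] by (simp add: X'_def d'_def a_kernel_def')
    next
      case 4
      then show ?thesis using ex[of i] by (simp add: X'_def d'_def a_kernel_def')
    qed
  qed
  have "d' (i - 1) (d' i x) = \<zero>\<^bsub>X' (i - 2)\<^esub>" if x: "x \<in> carrier (X' i)" for i x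
  proof -
    have "d' (i - 1 + 1) x \<in> d' (i - 1 + 1) ` carrier (X' (i - 1 + 1))" using x by simp
    then have "d' i x \<in> a_kernel (X' (i - 1)) (X' (i - 1 - 1)) (d' (i - 1))" unfolding ex' by simp
    then show ?thesis by (simp add: a_kernel_def')
  qed
  then have "exact_complex R X' d'"
    unfolding exact_complex_def mod_complex_def fg_mod_iff using fg' hom' ex' by blast
  moreover have "X' 1 = X 1" using a by (simp add: X'_def)
  moreover have "inj_obj R (X' i)" if "- int m \<le> i" "i \<le> 0" for i
    using that injZ inj[of i] n by (auto simp: X'_def a_def)
  moreover have "zero_mod (X' i)" if "i < - int m \<or> 1 < i" for i
    using that zero[of i] a(2) by (auto simp: X'_def a_def)
  ultimately have "injective_coresolution R X' d' m"
    unfolding injective_coresolution_def using ring reg by simp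
  then show ?thesis by blast
qed

end

section \<open>Gorenstein projective modules over a Gorenstein ring\<close>

lemma syzygy_exists:
  assumes R: "left_noetherian R" and M: "fg_module R M"
  shows "\<exists>(K :: 'a fgm) j (P :: 'a fgm) p. dualizable R P \<and> fg_module R K \<and> ses R K j P p (M :: 'a fgm)"
proof -
  obtain P :: "'a fgm" and p where P: "dualizable R P" "p \<in> mod_hom R P M" "p ` carrier P = carrier M"
    using projective_surjection_exists[OF M] by blast
  note P' = dualizableD[OF P(1)] and M' = fg_moduleD[OF M]
  have "fg_module R (P\<lparr>carrier := a_kernel P M p\<rparr>)"
    by (rule noetherian_submodule_fg[OF R dualizable_fg[OF P(1)] kernel_submodule[OF P' M' P(2)]])
  with ses_kernel[OF P' M' P(2,3)] P(1) show ?thesis by blast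
qed

lemma ses_fg:
  assumes "left_noetherian R" "ses R L i M p N" "fg_module R M"
  shows "fg_module R L" "fg_module R N"
  using noetherian_inj_fg[OF assms(1,3) sesD(1,4,5)[OF assms(2)]]
    fg_module_surj[OF assms(3) sesD(3,6,7)[OF assms(2)]] by auto

text \<open>Dependent choice, used to iterate the passage to a syzygy or a cosyzygy.\<close>

lemma iterate_step:
  assumes step: "\<And>M. \<Phi> M \<Longrightarrow> \<exists>L i P p. \<Phi> L \<and> \<Psi> L i P p M" and M: "\<Phi> M"
  obtains K i P p where "K 0 = M" "\<And>t. \<Phi> (K t)" "\<And>t::nat. \<Psi> (K (Suc t)) (i t) (P t) (p t) (K t)"
proof -
  define S where "S M = (SOME q. case q of (L, i, P, p) \<Rightarrow> \<Phi> L \<and> \<Psi> L i P p M)" for M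
  have S: "case S M of (L, i, P, p) \<Rightarrow> \<Phi> L \<and> \<Psi> L i P p M" if \<Phi>M: "\<Phi> M" for M
  proof -
    obtain L i P p where "\<Phi> L \<and> \<Psi> L i P p M" using step[OF \<Phi>M] by blast
    then have "case (L, i, P, p) of (L, i, P, p) \<Rightarrow> \<Phi> L \<and> \<Psi> L i P p M" by simp
    then show ?thesis unfolding S_def by (rule someI)
  qed
  define K where "K t = ((\<lambda>M. fst (S M)) ^^ t) M" for t
  have K: "K 0 = M" "K (Suc t) = fst (S (K t))" for t by (simp_all add: K_def)
  have \<Phi>: "\<Phi> (K t)" for t
  proof (induction t)
    case 0 then show ?case using M by (simp add: K)
  next
    case (Suc t) then show ?case using S[OF Suc] by (simp add: K case_prod_unfold)
  qed
  show ?thesis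
  proof (rule that[of K "\<lambda>t. fst (snd (S (K t)))" "\<lambda>t. fst (snd (snd (S (K t))))" "\<lambda>t. snd (snd (snd (S (K t))))"])
    show "\<Psi> (K (Suc t)) (fst (snd (S (K t)))) (fst (snd (snd (S (K t))))) (snd (snd (snd (S (K t))))) (K t)" for t
      using S[OF \<Phi>, of t] by (simp add: K case_prod_unfold)
  qed (use K \<Phi> in auto)
qed

context injective_coresolution
begin

definition perp :: "('a, 'b) module \<Rightarrow> bool" where
  "perp M \<longleftrightarrow> fg_module R M \<and> (\<forall>k\<ge>1. ext_zero k M)"

lemma perpD: "perp M \<Longrightarrow> fg_module R M" "perp M \<Longrightarrow> 1 \<le> k \<Longrightarrow> ext_zero k M"
  by (auto simp: perp_def)

lemma perp_projective: "dualizable R P \<Longrightarrow> perp P"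
  using ext_zero_projective dualizable_fg by (auto simp: perp_def)

lemma perp_retract:
  assumes N: "perp N" and M: "left_module R M" and i: "i \<in> mod_hom R M N" and p: "p \<in> mod_hom R N M"
    and pi: "\<And>x. x \<in> carrier M \<Longrightarrow> p (i x) = x"
  shows "perp M"
proof -
  have "p ` carrier N = carrier M"
  proof
    show "p ` carrier N \<subseteq> carrier M" using mod_hom_closed[OF p] by blast
    show "carrier M \<subseteq> p ` carrier N"
    proof
      fix x assume "x \<in> carrier M"
      then show "x \<in> p ` carrier N" using pi mod_hom_closed[OF i] by (intro image_eqI[of x p "i x"]) simp_all
    qed
  qed
  moreover have "fg_module R N" using N by (simp add: perp_def)
  ultimately have "fg_module R M" using fg_module_surj[OF _ M p] by blast
  then show ?thesis using N hom_acyclic_retract[OF _ i p pi] unfolding perp_def by blast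
qed

lemma ext_zero_syzygy:
  assumes s: "ses R L i P p N" and P: "dualizable R P" and L: "fg_module R L"
    and N: "\<And>k. k \<ge> m \<Longrightarrow> k \<ge> 1 \<Longrightarrow> ext_zero k N" and k: "Suc k \<ge> m" "k \<ge> 1"
  shows "ext_zero k L"
  using ext_zero_sub[OF s L dualizable_fg[OF P] ext_zero_projective[OF P k(2)] N[of "Suc k"]] k by simp

lemma perp_syzygy:
  assumes s: "ses R L i P p N" and P: "dualizable R P" and L: "fg_module R L" and N: "perp N"
  shows "perp L"
  using ext_zero_syzygy[OF s P L, of 1] N L by (simp add: perp_def)

lemma perp_cosyzygy:
  assumes s: "ses R L i P p N" and P: "dualizable R P" and L: "perp L"
    and ext: "\<And>\<phi>. \<phi> \<in> mod_hom R L (reg_mod R) \<Longrightarrow>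
      \<exists>\<psi>\<in>mod_hom R P (reg_mod R). \<forall>y\<in>carrier L. \<psi> (i y) = \<phi> y"
  shows "perp N"
  unfolding perp_def
proof (intro conjI allI impI)
  note fgP = dualizable_fg[OF P]
  show "fg_module R N" by (rule fg_module_surj[OF fgP sesD(3,6,7)[OF s]])
  fix k :: nat assume k: "1 \<le> k"
  show "ext_zero k N"
  proof (cases "k = 1")
    case True then show ?thesis using ext_zero_of_extend[OF s ext_zero_projective[OF P] ext] by simp
  next
    case False
    then obtain l where l: "k = Suc l" "1 \<le> l" using k by (cases k) auto
    then show ?thesis
      using ext_zero_quotient[OF s _ fgP, of l] L ext_zero_projective[OF P k] by (simp add: perp_def)
  qed
qed

text \<open>The exactness of \<open>Hom(-, P)\<close> on a totally acyclic complex says that functionals on its cycles extend to its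
  terms, which is the vanishing of \<open>Ext\<close> in degree one. The higher degrees follow by dimension shifting
  along the complex.\<close>

lemma Gproj_perp:
  assumes G: "Gproj R G"
  shows "perp G"
proof -
  obtain T :: "int \<Rightarrow> 'a fgm" and t where T: "exact_complex R T t" and proj: "\<forall>i. dualizable R (T i)"
    and hom': "\<forall>Q :: 'a fgm. dualizable R Q \<longrightarrow>
        (\<forall>i. \<forall>f\<in>mod_hom R (T i) Q.
          (\<forall>x\<in>carrier (T (i + 1)). f (t (i + 1) x) = \<zero>\<^bsub>Q\<^esub>) \<longleftrightarrow>
          (\<exists>g\<in>mod_hom R (T (i - 1)) Q. \<forall>x\<in>carrier (T i). f x = g (t i x)))"
    and iso: "mod_iso R G ((T (- 1))\<lparr>carrier := t 0 ` carrier (T 0)\<rparr>)"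
    using G unfolding Gproj_def proj_obj_iff by (elim conjE exE) (rule that)
  note T = T proj[rule_format]
  have hom: "\<exists>g\<in>mod_hom R (T (i - 1)) Q. \<forall>x\<in>carrier (T i). f x = g (t i x)"
    if "dualizable R Q" "f \<in> mod_hom R (T i) Q" "\<forall>x\<in>carrier (T (i + 1)). f (t (i + 1) x) = \<zero>\<^bsub>Q\<^esub>" for Q :: "'a fgm" and i f
    using hom'[rule_format, OF that(1,2)] that(3) by (rule iffD1)
  note C = mod_complexD[OF exact_complexD(1)[OF T(1)]]
  note s = ses_cycles[OF T(1)]
  have fgZ: "fg_module R (cycles T t i)" for i
  proof -
    have "t (i + 1) \<in> mod_hom R (T (i + 1)) (T i)" using C(3)[of "i + 1"] by simp
    from fg_module_image[OF C(1) C(2) this] show ?thesis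
      using T(1) by (simp add: exact_complex_def cycles_def)
  qed
  obtain A0 :: "'a fgm" and u v where A0: "dualizable R A0" "u \<in> mod_hom R (reg_mod R) A0"
    "v \<in> mod_hom R A0 (reg_mod R)" "\<And>x. x \<in> carrier (reg_mod R) \<Longrightarrow> v (u x) = x"
    using dualizable_representative[OF dualizable_reg_mod[OF ring]] by metis
  have ext: "\<exists>\<psi>\<in>mod_hom R (T i) (reg_mod R). \<forall>y\<in>carrier (cycles T t i). \<psi> y = \<phi> y"
    if \<phi>: "\<phi> \<in> mod_hom R (cycles T t i) (reg_mod R)" for i \<phi>
  proof -
    have ti: "t (i + 1) \<in> mod_hom R (T (i + 1)) (cycles T t i)"
      using sesD(6)[OF s, of "i + 1"] by simp
    have f: "(\<lambda>x. u (\<phi> (t (i + 1) x))) \<in> mod_hom R (T (i + 1)) A0"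
      by (rule mod_hom_compose[OF mod_hom_compose[OF ti \<phi>] A0(2)])
    have "u (\<phi> (t (i + 1) (t (i + 1 + 1) x))) = \<zero>\<^bsub>A0\<^esub>" if x: "x \<in> carrier (T (i + 1 + 1))" for x
    proof -
      have "i + 1 + 1 - 1 = i + 1" "i + 1 + 1 - 2 = i" by simp_all
      then have "t (i + 1) (t (i + 1 + 1) x) = \<zero>\<^bsub>cycles T t i\<^esub>"
        using C(4)[OF x] by (simp only: cycles_simps)
      then show ?thesis using mod_hom_zero[OF cycles_left_module[OF exact_complexD(1)[OF T(1)]] reg_mod_left_module[OF ring] \<phi>]
          mod_hom_zero[OF reg_mod_left_module[OF ring] dualizableD[OF A0(1)] A0(2)] by simp
    qed
    then obtain g where g: "g \<in> mod_hom R (T i) A0" "\<forall>x\<in>carrier (T (i + 1)). u (\<phi> (t (i + 1) x)) = g (t (i + 1) x)"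
      using hom[OF A0(1) f] by auto
    have "v (g y) = \<phi> y" if y: "y \<in> carrier (cycles T t i)" for y
    proof -
      obtain x where x: "x \<in> carrier (T (i + 1))" "t (i + 1) x = y"
        using exact_complexD(2)[OF T(1), of y i] y by (auto simp: a_kernel_def')
      then have "g y = u (\<phi> y)" using g(2) by auto
      then show ?thesis using A0(4) mod_hom_closed[OF \<phi> y] by simp
    qed
    then show ?thesis using mod_hom_compose[OF g(1) A0(3)] by (intro bexI[of _ "\<lambda>x. v (g x)"]) auto
  qed
  have "ext_zero k (cycles T t i)" if "k \<ge> 1" for k i
    using that
  proof (induction k arbitrary: i rule: nat_induct_at_least)
    case base
    have s1: "ses R (cycles T t (i + 1)) (\<lambda>x. x) (T (i + 1)) (t (i + 1)) (cycles T t i)" using s[of "i + 1"] by simp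
    show ?case by (rule ext_zero_of_extend[OF s1 ext_zero_projective[OF T(2)] ext]) simp
  next
    case (Suc k)
    have s1: "ses R (cycles T t (i + 1)) (\<lambda>x. x) (T (i + 1)) (t (i + 1)) (cycles T t i)" using s[of "i + 1"] by simp
    show ?case by (rule ext_zero_quotient[OF s1 fgZ C(1) Suc.IH ext_zero_projective[OF T(2)]]) simp
  qed
  then have Z: "perp (cycles T t (- 1))" using fgZ by (simp add: perp_def)
  have "t 0 ` carrier (T 0) = a_kernel (T (- 1)) (T (- 1 - 1)) (t (- 1))"
    using T(1) unfolding exact_complex_def by (metis add.left_inverse)
  then have iso': "mod_iso R G (cycles T t (- 1))" using iso by (simp add: cycles_def)
  have G': "left_module R G" using G by (simp add: Gproj_def fg_mod_def)
  obtain f g where "f \<in> mod_hom R G (cycles T t (- 1))" "g \<in> mod_hom R (cycles T t (- 1)) G"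
    "\<And>x. x \<in> carrier G \<Longrightarrow> g (f x) = x" using mod_isoE[OF G' iso'] by metis
  then show ?thesis by (rule perp_retract[OF Z G'])
qed

end

locale gorenstein_ring = injective_coresolution R X d n + op: injective_coresolution "op_ring R" X' d' n'
  for R :: "('a, 'r) ring_scheme" and X d n X' d' n' +
  assumes noeth: "left_noetherian R" and op_noeth: "left_noetherian (op_ring R)"
begin

lemma perp_resolution:
  assumes K: "perp (K0 :: 'a fgm)"
  obtains K :: "nat \<Rightarrow> 'a fgm" and j P p where "K 0 = K0" "\<And>t. perp (K t)" "\<And>t. dualizable R (P t)"
    "\<And>t. ses R (K (Suc t)) (j t) (P t :: 'a fgm) (p t) (K t)"
proof -
  have "\<exists>(L :: 'a fgm) i (P :: 'a fgm) p. perp L \<and> (dualizable R P \<and> ses R L i P p M)" if M: "perp (M :: 'a fgm)" for M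
  proof -
    have "fg_module R M" using M by (simp add: perp_def)
    from syzygy_exists[OF noeth this] obtain L :: "'a fgm" and i and P :: "'a fgm" and p
      where *: "dualizable R P" "fg_module R L" "ses R L i P p M" by blast
    then show ?thesis using perp_syzygy[OF *(3,1,2) M] by blast
  qed
  then obtain K :: "nat \<Rightarrow> 'a fgm" and j and P :: "nat \<Rightarrow> 'a fgm" and p where
    *: "K 0 = K0" "\<And>t. perp (K t)" "\<And>t. dualizable R (P t) \<and> ses R (K (Suc t)) (j t) (P t) (p t) (K t)"
    by (rule iterate_step[of perp "\<lambda>L i P p M. dualizable R P \<and> ses R L i P p M", OF _ K]) blast+
  then show ?thesis by (intro that[of K P j p]) simp_all
qed

text \<open>The dual of a projective resolution \<open>P\<close> of \<open>K0\<close> is a complex of right modules \<open>D\<close> that is exact in positive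
  degrees, because all the syzygies of \<open>K0\<close> are perpendicular. The images \<open>W\<close> in it are syzygies of
  arbitrarily high order, as \<open>D\<close> continues to the right, so that they have no \<open>Ext\<close> to the right regular
  module, whose injective dimension is finite. Now let \<open>x = p x0\<close> be killed by all
  functionals. The evaluation at \<open>x0\<close> vanishes on the functionals of \<open>K0\<close>, so that it factors through the
  first image \<open>W\<close>; it extends to the dual of \<open>P 1\<close> and is there, by reflexivity, the evaluation at
  some \<open>z\<close>. This means that \<open>z\<close> is mapped to \<open>x0\<close>, and so \<open>x = 0\<close>.\<close>

lemma perp_torsionless:
  assumes K: "perp (K0 :: 'a fgm)" and x: "x \<in> carrier K0"
    and kills: "\<And>\<phi>. \<phi> \<in> mod_hom R K0 (reg_mod R) \<Longrightarrow> \<phi> x = \<zero>\<^bsub>R\<^esub>"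
  shows "x = \<zero>\<^bsub>K0\<^esub>"
proof -
  obtain K :: "nat \<Rightarrow> 'a fgm" and j and P :: "nat \<Rightarrow> 'a fgm" and p where res: "K 0 = K0" "\<And>t. perp (K t)"
    "\<And>t. dualizable R (P t)" "\<And>t. ses R (K (Suc t)) (j t) (P t) (p t) (K t)"
    by (rule perp_resolution[OF K]) (rule that)
  note s = sesD[OF res(4)]
  note lmP = dualizableD[OF res(3)]
  have fgK: "fg_module R (K t)" for t using res(2) by (simp add: perp_def)
  note fgP = dualizable_fg[OF res(3)]
  note reg = reg_mod_left_module[OF ring]
  define D where "D t = dual_mod R (P t)" for t
  define \<delta> where "\<delta> t \<phi> = (\<lambda>x\<in>carrier (P (Suc t)). \<phi> (j t (p (Suc t) x)))" for t and \<phi> :: "_ \<Rightarrow> 'a"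
  have D: "dualizable (op_ring R) (D t)" for t unfolding D_def by (rule dual_mod_dualizable[OF res(3)])
  note lmD = dualizableD[OF D] and fgD = dualizable_fg[OF D]
  have dd: "(\<lambda>x. j t (p (Suc t) x)) \<in> mod_hom R (P (Suc t)) (P t)" for t by (rule mod_hom_compose[OF s(6) s(4)])
  have \<delta>: "\<delta> t \<in> mod_hom (op_ring R) (D t) (D (Suc t))" for t
    unfolding D_def \<delta>_def[abs_def] by (rule dual_mod_map[OF lmP lmP dd])
  have jz: "j t \<zero>\<^bsub>K (Suc t)\<^esub> = \<zero>\<^bsub>P t\<^esub>" for t by (rule mod_hom_zero[OF s(1,2,4)])
  have homD: "\<phi> \<in> mod_hom R (P t) (reg_mod R)" if "\<phi> \<in> carrier (D t)" for \<phi> t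
    using dual_modD[of \<phi> R "P t"] that by (simp add: D_def)
  define W where "W t = (D (Suc t))\<lparr>carrier := \<delta> t ` carrier (D t)\<rparr>" for t
  have W: "fg_module (op_ring R) (W t)" for t unfolding W_def by (rule fg_module_image[OF fgD lmD \<delta>])
  have zeroD: "\<zero>\<^bsub>D t\<^esub> = (\<lambda>x\<in>carrier (P t). \<zero>\<^bsub>R\<^esub>)" for t by (simp add: D_def dual_mod_simps)
  have kernel: "a_kernel (D (Suc t)) (W (Suc t)) (\<delta> (Suc t)) = \<delta> t ` carrier (D t)" for t
  proof (intro equalityI subsetI)
    fix \<phi> assume "\<phi> \<in> \<delta> t ` carrier (D t)"
    then obtain \<psi> where \<psi>: "\<psi> \<in> carrier (D t)" "\<phi> = \<delta> t \<psi>" by blast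
    have "\<delta> t \<psi> (j (Suc t) (p (Suc (Suc t)) x)) = \<zero>\<^bsub>R\<^esub>" if x: "x \<in> carrier (P (Suc (Suc t)))" for x
    proof -
      have y: "p (Suc (Suc t)) x \<in> carrier (K (Suc (Suc t)))" by (rule s(12)[OF x])
      have "\<delta> t \<psi> (j (Suc t) (p (Suc (Suc t)) x)) = \<psi> \<zero>\<^bsub>P t\<^esub>"
        using s(9)[OF y] s(10)[OF y] jz by (simp add: \<delta>_def)
      then show ?thesis using mod_hom_zero[OF lmP reg homD[OF \<psi>(1)]] by simp
    qed
    then have "\<delta> (Suc t) (\<delta> t \<psi>) = \<zero>\<^bsub>D (Suc (Suc t))\<^esub>"
      unfolding zeroD \<delta>_def[of "Suc t"] by (intro restrict_ext) simp
    then show "\<phi> \<in> a_kernel (D (Suc t)) (W (Suc t)) (\<delta> (Suc t))"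
      using mod_hom_closed[OF \<delta> \<psi>(1)] \<psi>(2) by (simp add: a_kernel_def' W_def)
  next
    fix \<phi> assume "\<phi> \<in> a_kernel (D (Suc t)) (W (Suc t)) (\<delta> (Suc t))"
    then have \<phi>: "\<phi> \<in> carrier (D (Suc t))" "\<delta> (Suc t) \<phi> = \<zero>\<^bsub>D (Suc (Suc t))\<^esub>" by (simp_all add: a_kernel_def' W_def)
    have "\<phi> (j (Suc t) y) = \<zero>\<^bsub>reg_mod R\<^esub>" if y: "y \<in> carrier (K (Suc (Suc t)))" for y
    proof -
      obtain x where x: "x \<in> carrier (P (Suc (Suc t)))" "y = p (Suc (Suc t)) x" using s(13)[OF y] by blast
      have "\<delta> (Suc t) \<phi> x = \<zero>\<^bsub>R\<^esub>" using x(1) by (simp add: \<phi>(2) zeroD)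
      then show ?thesis using x by (simp add: \<delta>_def)
    qed
    from ses_factor[OF res(4) reg homD[OF \<phi>(1)] this]
    obtain \<phi>' where \<phi>': "\<phi>' \<in> mod_hom R (K (Suc t)) (reg_mod R)" "\<forall>x\<in>carrier (P (Suc t)). \<phi>' (p (Suc t) x) = \<phi> x"
      by blast
    have "ext_zero 1 (K t)" by (rule perpD(2)[OF res(2)]) simp
    from ext_zero_extend[OF res(4) fgK fgP this \<phi>'(1)]
    obtain \<psi> where \<psi>: "\<psi> \<in> mod_hom R (P t) (reg_mod R)" "\<forall>y\<in>carrier (K (Suc t)). \<psi> (j t y) = \<phi>' y" by blast
    have "\<phi> = \<delta> t (restrict \<psi> (carrier (P t)))"
    proof (rule dual_mod_eqI[of _ "P (Suc t)"])
      show "\<phi> \<in> extensional (carrier (P (Suc t)))" using \<phi>(1) by (simp add: D_def dual_mod_simps)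
      show "\<delta> t (restrict \<psi> (carrier (P t))) \<in> extensional (carrier (P (Suc t)))" by (simp add: \<delta>_def)
      show "\<phi> x = \<delta> t (restrict \<psi> (carrier (P t))) x" if x: "x \<in> carrier (P (Suc t))" for x
        using x \<phi>'(2) \<psi>(2) s(12)[OF x] s(10)[OF s(12)[OF x]] by (simp add: \<delta>_def)
    qed
    moreover have "restrict \<psi> (carrier (P t)) \<in> carrier (D t)" unfolding D_def by (rule dual_modI[OF lmP \<psi>(1)])
    ultimately show "\<phi> \<in> \<delta> t ` carrier (D t)" by blast
  qed
  have sW: "ses (op_ring R) (W t) (\<lambda>x. x) (D (Suc t)) (\<delta> (Suc t)) (W (Suc t))" for t
  proof -
    have "\<delta> (Suc t) \<in> mod_hom (op_ring R) (D (Suc t)) (W (Suc t))"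
      unfolding W_def by (rule mod_hom_sub_target[OF \<delta>]) simp
    from ses_kernel[OF lmD fg_moduleD[OF W] this] show ?thesis
      unfolding kernel by (simp add: W_def)
  qed
  have extW: "op.ext_zero k (W t)" if "k \<ge> 1" for k t
  proof (cases "k \<le> n'")
    case True
    then show ?thesis using that
    proof (induction k arbitrary: t rule: inc_induct)
      case base
      show ?case
        by (rule op.ext_zero_sub[OF sW W fgD op.ext_zero_projective[OF D base] op.ext_zero_large[OF fg_moduleD[OF W]]]) simp
    next
      case (step k)
      show ?case
        by (rule op.ext_zero_sub[OF sW W fgD op.ext_zero_projective[OF D step.prems] step.IH]) simp
    qed
  next
    case False then show ?thesis using op.ext_zero_large[OF fg_moduleD[OF W]] by simp
  qed
  obtain x0 where x0: "x0 \<in> carrier (P 0)" "x = p 0 x0" using s(13)[of x 0] x res(1) by auto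
  have \<delta>0: "\<delta> 0 \<in> mod_hom (op_ring R) (D 0) (W 0)" unfolding W_def by (rule mod_hom_sub_target[OF \<delta>]) simp
  have opreg: "left_module (op_ring R) (reg_mod (op_ring R))" by (rule reg_mod_left_module[OF op.ring])
  have ev: "(\<lambda>\<psi>. \<psi> x0) \<in> mod_hom (op_ring R) (D 0) (reg_mod (op_ring R))" unfolding D_def by (rule dual_mod_eval[OF x0(1)])
  have "\<exists>g\<in>mod_hom (op_ring R) (W 0) (reg_mod (op_ring R)). \<forall>\<psi>\<in>carrier (D 0). g (\<delta> 0 \<psi>) = \<psi> x0"
  proof (rule mod_hom_factor[OF lmD fg_moduleD[OF W] opreg \<delta>0 _ ev])
    show "\<delta> 0 ` carrier (D 0) = carrier (W 0)" by (simp add: W_def)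
    fix \<psi> assume \<psi>: "\<psi> \<in> carrier (D 0)" "\<delta> 0 \<psi> = \<zero>\<^bsub>W 0\<^esub>"
    have "\<psi> (j 0 y) = \<zero>\<^bsub>reg_mod R\<^esub>" if y: "y \<in> carrier (K (Suc 0))" for y
    proof -
      obtain z where z: "z \<in> carrier (P (Suc 0))" "y = p (Suc 0) z" using s(13)[OF y] by blast
      have "\<delta> 0 \<psi> z = \<zero>\<^bsub>R\<^esub>" using z(1) by (simp add: \<psi>(2) zeroD W_def)
      then show ?thesis using z by (simp add: \<delta>_def)
    qed
    from ses_factor[OF res(4) reg homD[OF \<psi>(1)] this]
    obtain \<phi> where \<phi>: "\<phi> \<in> mod_hom R (K 0) (reg_mod R)" "\<forall>x\<in>carrier (P 0). \<phi> (p 0 x) = \<psi> x" by blast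
    then show "\<psi> x0 = \<zero>\<^bsub>reg_mod (op_ring R)\<^esub>" using kills[of \<phi>] x0 res(1) by auto
  qed
  then obtain g where g: "g \<in> mod_hom (op_ring R) (W 0) (reg_mod (op_ring R))" "\<forall>\<psi>\<in>carrier (D 0). g (\<delta> 0 \<psi>) = \<psi> x0"
    by blast
  obtain G where G: "G \<in> mod_hom (op_ring R) (D 1) (reg_mod (op_ring R))" "\<forall>w\<in>carrier (W 0). G w = g w"
    using op.ext_zero_extend[OF sW W fgD extW g(1)] by auto
  obtain z where z: "z \<in> carrier (P 1)" "\<forall>\<phi>\<in>carrier (D 1). G \<phi> = \<phi> z"
    using dual_mod_reflexive[OF res(3) G(1)[unfolded D_def]] unfolding D_def by blast
  let ?z = "j 0 (p 1 z)"
  have zc: "p 1 z \<in> carrier (K 1)" "?z \<in> carrier (P 0)" using s(12)[OF z(1)] s(10)[of "p 1 z" 0] by simp_all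
  have "x0 \<ominus>\<^bsub>P 0\<^esub> ?z = \<zero>\<^bsub>P 0\<^esub>"
  proof (rule dualizable_separates[OF res(3) left_module_minus(1)[OF lmP x0(1) zc(2)]])
    fix \<psi> assume \<psi>: "\<psi> \<in> mod_hom R (P 0) (reg_mod R)"
    let ?\<psi> = "restrict \<psi> (carrier (P 0))"
    have \<psi>': "?\<psi> \<in> carrier (D 0)" unfolding D_def by (rule dual_modI[OF lmP \<psi>])
    have d0: "\<delta> 0 ?\<psi> \<in> carrier (D 1)" using mod_hom_closed[OF \<delta> \<psi>'] by simp
    have "\<psi> x0 = g (\<delta> 0 ?\<psi>)" using g(2) \<psi>' x0(1) by simp
    also have "\<dots> = G (\<delta> 0 ?\<psi>)" using G(2) \<psi>' by (simp add: W_def)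
    also have "\<dots> = \<delta> 0 ?\<psi> z" using z(2) d0 by blast
    also have "\<dots> = \<psi> ?z" using z(1) zc by (simp add: \<delta>_def)
    finally show "\<psi> (x0 \<ominus>\<^bsub>P 0\<^esub> ?z) = \<zero>\<^bsub>R\<^esub>"
      using mod_hom_minus[OF lmP reg \<psi> x0(1) zc(2)] left_module_minus(3)[OF reg, of "\<psi> ?z" "\<psi> ?z"]
        mod_hom_closed[OF \<psi> zc(2)] by simp
  qed
  then have "x0 = ?z" using left_module_minus(3)[OF lmP x0(1) zc(2)] by simp
  then have "x = \<zero>\<^bsub>K 0\<^esub>" using x0(2) s(9)[of "p 1 z" 0] zc(1) by simp
  then show ?thesis using res(1) by simp
qed

text \<open>The components of \<open>i\<close> generate the right module of functionals on \<open>K0\<close>, which is finitely generated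
  because the opposite ring is Noetherian. Hence every functional factors through \<open>i\<close>. This makes \<open>i\<close>
  injective, as \<open>K0\<close> is torsionless, and it makes the cokernel perpendicular.\<close>

lemma perp_approximation:
  assumes K: "perp (K0 :: 'a fgm)"
  shows "\<exists>i (F :: 'a fgm) p (N :: 'a fgm). dualizable R F \<and> perp N \<and> ses R K0 i F p N"
proof -
  note fgK = perpD(1)[OF K] and K' = fg_moduleD[OF perpD(1)[OF K]]
  note reg = reg_mod_left_module[OF ring]
  obtain P :: "'a fgm" and p where P: "dualizable R P" "p \<in> mod_hom R P K0" "p ` carrier P = carrier K0"
    using projective_surjection_exists[OF fgK] by blast
  note P' = dualizableD[OF P(1)]
  let ?r = "\<lambda>\<phi>. \<lambda>x\<in>carrier P. \<phi> (p x)"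
  have "inj_on ?r (carrier (dual_mod R K0))"
  proof
    fix \<phi> \<psi> assume *: "\<phi> \<in> carrier (dual_mod R K0)" "\<psi> \<in> carrier (dual_mod R K0)" "?r \<phi> = ?r \<psi>"
    show "\<phi> = \<psi>"
    proof (rule dual_mod_eqI[of _ K0])
      fix y assume "y \<in> carrier K0"
      then obtain x where x: "x \<in> carrier P" "y = p x" using P(3) by auto
      have "?r \<phi> x = ?r \<psi> x" using *(3) by simp
      then show "\<phi> y = \<psi> y" using x by simp
    qed (use * in \<open>simp_all add: dual_mod_simps\<close>)
  qed
  then have fgD: "fg_module (op_ring R) (dual_mod R K0)"
    by (rule noetherian_inj_fg[OF op_noeth dualizable_fg[OF dual_mod_dualizable[OF P(1)]]
      dual_mod_left_module[OF K'] dual_mod_map[OF P' K' P(2)]])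
  note D' = fg_moduleD[OF fgD]
  obtain S where S: "finite S" "S \<subseteq> carrier (dual_mod R K0)"
    and gen: "\<And>H. submodule H (op_ring R) (dual_mod R K0) \<Longrightarrow> S \<subseteq> H \<Longrightarrow> H = carrier (dual_mod R K0)"
    using fgD unfolding fg_module_def fin_gen_def by blast
  have "\<exists>(F :: 'a fgm) i. dualizable R F \<and> i \<in> mod_hom R K0 F \<and>
    (\<forall>\<phi>\<in>S. \<exists>\<psi>\<in>mod_hom R F (reg_mod R). \<forall>x\<in>carrier K0. \<psi> (i x) = \<phi> x)"
    using S
  proof (induction rule: finite_induct)
    case empty
    show ?case using dualizable_zero_obj[OF ring] zero_in_mod_hom[OF zero_obj_left_module[OF ring]] by blast
  next
    case (insert \<phi> S)
    then obtain F :: "'a fgm" and i where F: "dualizable R F" "i \<in> mod_hom R K0 F"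
      "\<forall>\<phi>\<in>S. \<exists>\<psi>\<in>mod_hom R F (reg_mod R). \<forall>x\<in>carrier K0. \<psi> (i x) = \<phi> x" by blast
    have \<phi>: "\<phi> \<in> mod_hom R K0 (reg_mod R)" using insert.prems by (intro dual_modD) simp
    let ?F = "prod_mod F (reg_mod R)"
    obtain Q :: "'a fgm" and u v where Q: "dualizable R Q" "u \<in> mod_hom R ?F Q" "v \<in> mod_hom R Q ?F"
      "\<And>x. x \<in> carrier ?F \<Longrightarrow> v (u x) = x"
      by (rule dualizable_representative[OF dualizable_prod_mod[OF F(1) dualizable_reg_mod[OF ring]]]) blast
    have fs: "fst \<in> mod_hom R ?F F" "snd \<in> mod_hom R ?F (reg_mod R)" by (auto intro!: mod_homI)
    have i': "(\<lambda>x. (i x, \<phi> x)) \<in> mod_hom R K0 ?F"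
      using mod_hom_closed[OF F(2)] mod_hom_closed[OF \<phi>] mod_hom_add[OF F(2)] mod_hom_add[OF \<phi>]
        mod_hom_smult[OF F(2)] mod_hom_smult[OF \<phi>] by (simp add: mod_hom_def hom_def Pi_def)
    have vu: "v (u (i x, \<phi> x)) = (i x, \<phi> x)" if "x \<in> carrier K0" for x
      using Q(4)[OF mod_hom_closed[OF i' that]] .
    have "\<exists>\<psi>\<in>mod_hom R Q (reg_mod R). \<forall>x\<in>carrier K0. \<psi> (u (i x, \<phi> x)) = \<chi> x" if \<chi>: "\<chi> \<in> insert \<phi> S" for \<chi>
    proof (cases "\<chi> = \<phi>")
      case True
      show ?thesis using vu True
        by (rule_tac bexI[OF _ mod_hom_compose[OF Q(3) fs(2)]]) simp
    next
      case False
      then obtain \<psi> where \<psi>: "\<psi> \<in> mod_hom R F (reg_mod R)" "\<forall>x\<in>carrier K0. \<psi> (i x) = \<chi> x" using F(3) \<chi> by blast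
      show ?thesis using vu \<psi>(2)
        by (rule_tac bexI[OF _ mod_hom_compose[OF mod_hom_compose[OF Q(3) fs(1)] \<psi>(1)]]) simp
    qed
    then show ?case using Q(1) mod_hom_compose[OF i' Q(2)]
      by (intro exI[of _ Q] exI[of _ "\<lambda>x. u (i x, \<phi> x)"]) blast
  qed
  then obtain F :: "'a fgm" and i where F: "dualizable R F" "i \<in> mod_hom R K0 F"
    "\<forall>\<phi>\<in>S. \<exists>\<psi>\<in>mod_hom R F (reg_mod R). \<forall>x\<in>carrier K0. \<psi> (i x) = \<phi> x" by blast
  note F' = dualizableD[OF F(1)]
  let ?H = "{\<phi> \<in> carrier (dual_mod R K0). \<exists>\<psi>\<in>mod_hom R F (reg_mod R). \<forall>x\<in>carrier K0. \<psi> (i x) = \<phi> x}"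
  have "submodule ?H (op_ring R) (dual_mod R K0)"
  proof (rule submoduleI'[OF D'])
    show "\<zero>\<^bsub>dual_mod R K0\<^esub> \<in> ?H"
      using left_module_basics(3)[OF D'] zero_in_mod_hom[OF reg, of F]
      by (auto simp: dual_mod_simps(2) intro: bexI[of _ "\<lambda>_. \<zero>\<^bsub>R\<^esub>"])
    show "\<phi> \<oplus>\<^bsub>dual_mod R K0\<^esub> \<chi> \<in> ?H" if *: "\<phi> \<in> ?H" "\<chi> \<in> ?H" for \<phi> \<chi>
    proof -
      obtain \<psi> where \<psi>: "\<psi> \<in> mod_hom R F (reg_mod R)" "\<forall>x\<in>carrier K0. \<psi> (i x) = \<phi> x" using *(1) by blast
      obtain \<psi>' where \<psi>': "\<psi>' \<in> mod_hom R F (reg_mod R)" "\<forall>x\<in>carrier K0. \<psi>' (i x) = \<chi> x" using *(2) by blast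
      have "\<exists>\<psi>\<in>mod_hom R F (reg_mod R). \<forall>x\<in>carrier K0. \<psi> (i x) = (\<phi> \<oplus>\<^bsub>dual_mod R K0\<^esub> \<chi>) x"
        using \<psi>(2) \<psi>'(2) by (rule_tac bexI[OF _ mod_hom_sum[OF reg \<psi>(1) \<psi>'(1)]]) (simp add: dual_mod_simps(3))
      then show ?thesis using left_module_basics(4)[OF D'] * by simp
    qed
    show "a \<odot>\<^bsub>dual_mod R K0\<^esub> \<phi> \<in> ?H" if *: "a \<in> carrier (op_ring R)" "\<phi> \<in> ?H" for a \<phi>
    proof -
      obtain \<psi> where \<psi>: "\<psi> \<in> mod_hom R F (reg_mod R)" "\<forall>x\<in>carrier K0. \<psi> (i x) = \<phi> x" using *(2) by blast
      have m: "(\<lambda>b. b \<odot>\<^bsub>reg_mod R\<^esub> a) \<in> mod_hom R (reg_mod R) (reg_mod R)"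
        using *(1) by (intro smult_elem_mod_hom[OF reg]) simp
      have "\<exists>\<psi>\<in>mod_hom R F (reg_mod R). \<forall>x\<in>carrier K0. \<psi> (i x) = (a \<odot>\<^bsub>dual_mod R K0\<^esub> \<phi>) x"
        using \<psi>(2) by (rule_tac bexI[OF _ mod_hom_compose[OF \<psi>(1) m]]) (simp add: dual_mod_simps(4))
      then show ?thesis using left_module_basics(5)[OF D' *(1)] * by simp
    qed
  qed auto
  moreover have "S \<subseteq> ?H" using S(2) F(3) by blast
  ultimately have H: "?H = carrier (dual_mod R K0)" by (rule gen)
  have ext: "\<exists>\<psi>\<in>mod_hom R F (reg_mod R). \<forall>x\<in>carrier K0. \<psi> (i x) = \<phi> x"
    if \<phi>: "\<phi> \<in> mod_hom R K0 (reg_mod R)" for \<phi>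
  proof -
    have "restrict \<phi> (carrier K0) \<in> ?H" unfolding H by (rule dual_modI[OF K' \<phi>])
    then show ?thesis by auto
  qed
  have "inj_on i (carrier K0)"
  proof (rule inj_mod_homI[OF K' F' F(2)])
    fix x assume x: "x \<in> carrier K0" "i x = \<zero>\<^bsub>F\<^esub>"
    show "x = \<zero>\<^bsub>K0\<^esub>"
    proof (rule perp_torsionless[OF K x(1)])
      fix \<phi> assume "\<phi> \<in> mod_hom R K0 (reg_mod R)"
      then obtain \<psi> where "\<psi> \<in> mod_hom R F (reg_mod R)" "\<forall>x\<in>carrier K0. \<psi> (i x) = \<phi> x" using ext by blast
      then show "\<phi> x = \<zero>\<^bsub>R\<^esub>" using x mod_hom_zero[OF F' reg, of \<psi>] by auto
    qed
  qed
  then obtain N :: "'a fgm" and q where N: "ses R K0 i F q N"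
    using ses_cokernel[OF K' dualizable_fg[OF F(1)] F(2)] by blast
  have "perp N" by (rule perp_cosyzygy[OF N F(1) K ext])
  then show ?thesis using N F(1) by blast
qed

text \<open>A projective resolution of \<open>K0\<close> is spliced with a coresolution by the approximations. The result is totally
  acyclic because all the cycles are perpendicular.\<close>

lemma perp_Gproj:
  assumes K0: "perp (K0 :: 'a fgm)"
  shows "Gproj R K0"
proof -
  obtain Kp :: "nat \<Rightarrow> 'a fgm" and jp and Pp :: "nat \<Rightarrow> 'a fgm" and pp where res: "Kp 0 = K0" "\<And>t. perp (Kp t)"
    "\<And>t. dualizable R (Pp t)" "\<And>t. ses R (Kp (Suc t)) (jp t) (Pp t) (pp t) (Kp t)"
    by (rule perp_resolution[OF K0]) (rule that)
  have "\<exists>(N :: 'a fgm) i (F :: 'a fgm) p. perp N \<and> (dualizable R F \<and> ses R M i F p N)"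
    if M: "perp (M :: 'a fgm)" for M
    using perp_approximation[OF M] by blast
  then obtain Kn :: "nat \<Rightarrow> 'a fgm" and jn and Pn :: "nat \<Rightarrow> 'a fgm" and pn where
    cores: "Kn 0 = K0" "\<And>t. perp (Kn t)" "\<And>t. dualizable R (Pn t) \<and> ses R (Kn t) (jn t) (Pn t) (pn t) (Kn (Suc t))"
    by (rule iterate_step[of perp "\<lambda>N i F p M. dualizable R F \<and> ses R M i F p N", OF _ K0]) blast+
  define K where "K k = (if k \<ge> 0 then Kp (nat k) else Kn (nat (- k)))" for k :: int
  define T where "T k = (if k \<ge> 0 then Pp (nat k) else Pn (nat (- k - 1)))" for k :: int
  define j where "j k = (if k \<ge> 0 then jp (nat k) else jn (nat (- k - 1)))" for k :: int
  define p where "p k = (if k \<ge> 0 then pp (nat k) else pn (nat (- k - 1)))" for k :: int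
  have s: "ses R (K (k + 1)) (j k) (T k) (p k) (K k)" for k
  proof (cases "k \<ge> 0")
    case True
    then have "nat (k + 1) = Suc (nat k)" by simp
    then show ?thesis using res(4)[of "nat k"] True by (simp add: K_def T_def j_def p_def)
  next
    case False
    define t where "t = nat (- k - 1)"
    have t: "k = - int t - 1" using False by (simp add: t_def)
    have "K (k + 1) = Kn t" using res(1) cores(1) by (auto simp: K_def t)
    moreover have "K k = Kn (Suc t)" by (simp add: K_def t nat_add_distrib)
    moreover have "T k = Pn t" "j k = jn t" "p k = pn t" using False by (simp_all add: T_def j_def p_def t)
    ultimately show ?thesis using cores(3)[of t] by simp
  qed
  have proj: "dualizable R (T k)" for k using res(3) cores(3) by (simp add: T_def)
  have pK: "perp (K k)" for k using res(2) cores(2) by (simp add: K_def)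
  let ?d = "\<lambda>k x. j (k - 1) (p k x)"
  have ex: "exact_complex R T ?d" by (rule exact_complex_splice[of R K j T p, OF s dualizable_fg[OF proj]])
  have s': "ses R (K k) (j (k - 1)) (T (k - 1)) (p (k - 1)) (K (k - 1))" for k using s[of "k - 1"] by simp
  have hom: "(\<forall>x\<in>carrier (T (k + 1)). f (?d (k + 1) x) = \<zero>\<^bsub>Q\<^esub>) \<longleftrightarrow>
    (\<exists>g\<in>mod_hom R (T (k - 1)) Q. \<forall>x\<in>carrier (T k). f x = g (?d k x))"
    if Q: "dualizable R Q" and f: "f \<in> mod_hom R (T k) Q" for Q :: "'a fgm" and k f
  proof
    note Q' = dualizableD[OF Q]
    assume *: "\<forall>x\<in>carrier (T (k + 1)). f (?d (k + 1) x) = \<zero>\<^bsub>Q\<^esub>"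
    have "f (j k y) = \<zero>\<^bsub>Q\<^esub>" if y: "y \<in> carrier (K (k + 1))" for y
    proof -
      obtain x where "x \<in> carrier (T (k + 1))" "y = p (k + 1) x" using sesD(13)[OF s y] by blast
      then show ?thesis using * by simp
    qed
    from ses_factor[OF s Q' f this] obtain f' where f': "f' \<in> mod_hom R (K k) Q" "\<forall>x\<in>carrier (T k). f' (p k x) = f x"
      by blast
    have "ext_zero 1 (K (k - 1))" by (rule perpD(2)[OF pK]) simp
    from dualizable_extend[OF Q sesD(2)[OF s'] ext_zero_extend[OF s' perpD(1)[OF pK] dualizable_fg[OF proj] this] f'(1)]
    obtain g where g: "g \<in> mod_hom R (T (k - 1)) Q" "\<forall>y\<in>carrier (K k). g (j (k - 1) y) = f' y" by blast
    then show "\<exists>g\<in>mod_hom R (T (k - 1)) Q. \<forall>x\<in>carrier (T k). f x = g (?d k x)"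
      using f'(2) sesD(12)[OF s] by (rule_tac bexI[of _ g]) auto
  next
    assume "\<exists>g\<in>mod_hom R (T (k - 1)) Q. \<forall>x\<in>carrier (T k). f x = g (?d k x)"
    then obtain g where g: "g \<in> mod_hom R (T (k - 1)) Q" "\<forall>x\<in>carrier (T k). f x = g (?d k x)" by blast
    note C = mod_complexD[OF exact_complexD(1)[OF ex]]
    show "\<forall>x\<in>carrier (T (k + 1)). f (?d (k + 1) x) = \<zero>\<^bsub>Q\<^esub>"
    proof
      fix x assume x: "x \<in> carrier (T (k + 1))"
      have "?d (k + 1) x \<in> carrier (T k)" using C(5)[OF x] by simp
      moreover have "?d k (?d (k + 1) x) = \<zero>\<^bsub>T (k - 1)\<^esub>" using C(4)[OF x] by simp
      ultimately show "f (?d (k + 1) x) = \<zero>\<^bsub>Q\<^esub>"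
        using g(2) mod_hom_zero[OF C(2) dualizableD[OF Q] g(1)] by simp
    qed
  qed
  have iso: "mod_iso R K0 ((T (- 1))\<lparr>carrier := ?d 0 ` carrier (T 0)\<rparr>)"
  proof -
    have K0': "K 0 = K0" using res(1) by (simp add: K_def)
    have s0: "ses R K0 (j (- 1)) (T (- 1)) (p (- 1)) (K (- 1))" using s'[of 0] K0' by simp
    have "?d 0 ` carrier (T 0) = j (- 1) ` (p 0 ` carrier (T 0))" by (simp add: image_image)
    also have "\<dots> = j (- 1) ` carrier K0" using sesD(7)[OF s, of 0] K0' by simp
    finally have im: "?d 0 ` carrier (T 0) = j (- 1) ` carrier K0" .
    have "j (- 1) \<in> mod_hom R K0 ((T (- 1))\<lparr>carrier := ?d 0 ` carrier (T 0)\<rparr>)"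
      using im by (intro mod_hom_sub_target[OF sesD(4)[OF s0]]) simp
    moreover have "bij_betw (j (- 1)) (carrier K0) (carrier ((T (- 1))\<lparr>carrier := ?d 0 ` carrier (T 0)\<rparr>))"
      using sesD(5)[OF s0] im by (simp add: bij_betw_def)
    ultimately show ?thesis unfolding mod_iso_def by blast
  qed
  have "K0 \<in> fg_mod R" using perpD(1)[OF K0] by (simp add: fg_mod_iff)
  with ex proj hom iso show ?thesis
    unfolding Gproj_def proj_obj_iff by (intro conjI exI[of _ T] exI[of _ ?d]) simp_all
qed

lemma Gproj_iff: "Gproj R G \<longleftrightarrow> perp G"
  using Gproj_perp perp_Gproj by blast

end

section \<open>Gorenstein projective dimension\<close>

lemma ses_zero_left: "left_module R M \<Longrightarrow> ses R zero_obj (\<lambda>_. \<zero>\<^bsub>M\<^esub>) M (\<lambda>x. x) M"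
  using zero_obj_left_module[OF left_module_basics(1)] left_module_basics(3)[of R M] zero_in_mod_hom[of R M zero_obj]
  unfolding ses_def by (auto simp: id_in_mod_hom a_kernel_def')

lemma ses_zero_right: "left_module R M \<Longrightarrow> ses R M (\<lambda>x. x) M (\<lambda>_. {}) zero_obj"
  using zero_obj_left_module[OF left_module_basics(1), of R M] left_module_basics(3)[of R M]
    zero_in_mod_hom[of R zero_obj M]
  unfolding ses_def by (auto simp: id_in_mod_hom a_kernel_def')

lemma zero_modI: "left_module R M \<Longrightarrow> (\<And>x. x \<in> carrier M \<Longrightarrow> x = \<zero>\<^bsub>M\<^esub>) \<Longrightarrow> zero_mod M"
  unfolding zero_mod_def using left_module_basics(3) by (intro equalityI subsetI) auto

lemma Inf_real_nat_less:
  assumes "Inf {ereal (real n) | n. Q n} < ereal (real m)"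
  obtains l where "Q l" "l < m"
  using assms unfolding Inf_less_iff by auto

context injective_coresolution
begin

text \<open>Dimension shifting along an exact sequence that starts with a zero module; \<open>L t\<close> is then a module of
  projective dimension less than \<open>t\<close>, relative to modules without higher \<open>Ext\<close>.\<close>

lemma ext_zero_chain:
  assumes s: "\<And>t. t < m \<Longrightarrow> ses R (L t) (i t) (P t) (p t) (L (Suc t))"
    and fg: "\<And>t. t < m \<Longrightarrow> fg_module R (L t)" "\<And>t. t < m \<Longrightarrow> fg_module R (P t)"
    and P: "\<And>t k. t < m \<Longrightarrow> 1 \<le> k \<Longrightarrow> ext_zero k (P t)"
    and L0: "left_module R (L 0)" "zero_mod (L 0)" and t: "t \<le> m"
  shows "t \<le> k \<Longrightarrow> ext_zero k (L t)"
  using t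
proof (induction t arbitrary: k)
  case 0
  show ?case by (rule hom_acyclic_zero[OF L0 Y_complex])
next
  case (Suc t)
  from Suc.prems obtain l where l: "k = Suc l" "t \<le> l" by (cases k) auto
  have t: "t < m" using Suc.prems by simp
  have P': "ext_zero (Suc l) (P t)" by (rule P[OF t]) simp
  show ?case unfolding l(1)
    using ext_zero_quotient[OF s[OF t] fg(1)[OF t] fg(2)[OF t] Suc.IH[OF l(2)] P'] t by simp
qed

lemma cycles_fg:
  assumes "exact_complex R T t" shows "fg_module R (cycles T t k)"
proof -
  note C = mod_complexD[OF exact_complexD(1)[OF assms]]
  have "t (k + 1) \<in> mod_hom R (T (k + 1)) (T k)" using C(3)[of "k + 1"] by simp
  from fg_module_image[OF C(1) C(2) this] show ?thesis
    using assms by (simp add: exact_complex_def cycles_def)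
qed

lemma Gpd_ext_zero:
  assumes Gpd: "Gpd R M < ereal (real m)"
  shows "ext_zero m M"
proof -
  from Inf_real_nat_less[OF Gpd[unfolded Gpd_def]] obtain l where
    "\<exists>T t. exact_complex R T t \<and> T (- 1) = M \<and> (\<forall>i. 0 \<le> i \<and> i \<le> int l \<longrightarrow> Gproj R (T i)) \<and>
      (\<forall>i. i < - 1 \<or> int l < i \<longrightarrow> zero_mod (T i))" and l: "l < m" by blast
  then obtain T t where T: "exact_complex R T t" "T (- 1) = M"
    "\<And>i. 0 \<le> i \<Longrightarrow> i \<le> int l \<Longrightarrow> Gproj R (T i)" "\<And>i. i < - 1 \<or> int l < i \<Longrightarrow> zero_mod (T i)"
    by blast
  note C = mod_complexD[OF exact_complexD(1)[OF T(1)]]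
  let ?L = "\<lambda>u. cycles T t (int l - int u)"
  have "ext_zero m (?L (Suc l))"
  proof (rule ext_zero_chain[where L = ?L and m = "Suc l" and P = "\<lambda>u. T (int l - int u)"
        and i = "\<lambda>_ x. x" and p = "\<lambda>u. t (int l - int u)"])
    show "ses R (?L u) (\<lambda>x. x) (T (int l - int u)) (t (int l - int u)) (?L (Suc u))" for u
      using ses_cycles[OF T(1), of "int l - int u"] by (simp add: algebra_simps)
    show "ext_zero k (T (int l - int u))" if "u < Suc l" "1 \<le> k" for u k
    proof -
      have "Gproj R (T (int l - int u))" using that(1) by (intro T(3)) auto
      then show ?thesis by (intro perpD(2) Gproj_perp that)
    qed
    have "x = \<zero>\<^bsub>T (int l)\<^esub>" if x: "x \<in> carrier (cycles T t (int l))" for x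
    proof -
      obtain y where y: "y \<in> carrier (T (int l + 1))" "t (int l + 1) y = x"
        using exact_complexD(2)[OF T(1), of x "int l"] x by (auto simp: a_kernel_def')
      have "y = \<zero>\<^bsub>T (int l + 1)\<^esub>" using y(1) T(4)[of "int l + 1"] by (simp add: zero_mod_def)
      then show ?thesis using y(2) mod_hom_zero[OF C(2) C(2) C(3), of "int l + 1"] by simp
    qed
    then show "zero_mod (?L 0)"
      by (intro zero_modI[OF cycles_left_module[OF exact_complexD(1)[OF T(1)]]]) simp_all
    show "left_module R (?L 0)" by (rule cycles_left_module[OF exact_complexD(1)[OF T(1)]])
  qed (use l C(1) cycles_fg[OF T(1)] in auto)
  then have Z: "ext_zero m (cycles T t (- 1))" by simp
  have car: "carrier (cycles T t (- 1)) = carrier M"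
  proof -
    have "carrier (T (- 2)) = {\<zero>\<^bsub>T (- 2)\<^esub>}" using T(4)[of "- 2"] by (simp add: zero_mod_def)
    then have "t (- 1) x = \<zero>\<^bsub>T (- 2)\<^esub>" if "x \<in> carrier M" for x using C(5)[of x "- 1"] that T(2) by simp
    then show ?thesis using T(2) by (auto simp: a_kernel_def')
  qed
  have "(\<lambda>x. x) \<in> mod_hom R M (cycles T t (- 1))" "(\<lambda>x. x) \<in> mod_hom R (cycles T t (- 1)) M"
    using car T(2) id_in_mod_hom[of R M] unfolding cycles_def
    by (simp_all add: mod_hom_sub_target mod_hom_sub_source)
  then show ?thesis by (rule hom_acyclic_retract[OF Z]) simp
qed

end

lemma Gpd_nonneg: "0 \<le> Gpd R M"
  unfolding Gpd_def by (rule Inf_greatest) auto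

context gorenstein_ring
begin

lemma resolution:
  assumes M: "fg_module R (M :: 'a fgm)"
  obtains K :: "nat \<Rightarrow> 'a fgm" and j P p where "K 0 = M" "\<And>t. fg_module R (K t)" "\<And>t. dualizable R (P t)"
    "\<And>t. ses R (K (Suc t)) (j t) (P t :: 'a fgm) (p t) (K t)" "\<And>t. n \<le> t \<Longrightarrow> perp (K t)"
proof -
  have "\<exists>(L :: 'a fgm) i (P :: 'a fgm) p. fg_module R L \<and> (dualizable R P \<and> ses R L i P p N)"
    if "fg_module R N" for N :: "'a fgm"
    using syzygy_exists[OF noeth that] by blast
  then obtain K :: "nat \<Rightarrow> 'a fgm" and j and P :: "nat \<Rightarrow> 'a fgm" and p where
    K: "K 0 = M" "\<And>t. fg_module R (K t)" "\<And>t. dualizable R (P t) \<and> ses R (K (Suc t)) (j t) (P t) (p t) (K t)"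
    by (rule iterate_step[of "fg_module R" "\<lambda>L i P p N. dualizable R P \<and> ses R L i P p N", OF _ M]) blast+
  have "ext_zero k (K t)" if "n < k + t" "1 \<le> k" for k t
    using that
  proof (induction t arbitrary: k)
    case 0 then show ?case using ext_zero_large[OF fg_moduleD[OF M]] K(1) by simp
  next
    case (Suc t)
    have IH: "ext_zero l (K t)" if "Suc (n - t) \<le> l" "1 \<le> l" for l using that by (intro Suc.IH) auto
    have s: "ses R (K (Suc t)) (j t) (P t) (p t) (K t)" and d: "dualizable R (P t)" using K(3) by simp_all
    show ?case using Suc.prems by (intro ext_zero_syzygy[OF s d K(2) IH]) auto
  qed
  then have "perp (K t)" if "n \<le> t" for t using that K(2) by (simp add: perp_def)
  then show ?thesis using K by (intro that[of K P j p]) simp_all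
qed

lemma Gpd_le:
  assumes M: "fg_module R (M :: 'a fgm)"
  shows "Gpd R M \<le> ereal (real n)"
proof -
  obtain K :: "nat \<Rightarrow> 'a fgm" and jj and P :: "nat \<Rightarrow> 'a fgm" and pp where res: "K 0 = M" "\<And>t. fg_module R (K t)"
    "\<And>t. dualizable R (P t)" "\<And>t. ses R (K (Suc t)) (jj t) (P t) (pp t) (K t)" "\<And>t. n \<le> t \<Longrightarrow> perp (K t)"
    by (rule resolution[OF M]) (rule that)
  define C where "C k = (if 0 \<le> k \<and> k \<le> int n then K (nat k) else zero_obj)" for k :: int
  define T where "T k = (if k = - 1 then M else if 0 \<le> k \<and> k < int n then P (nat k)
    else if k = int n then K n else zero_obj)" for k :: int
  define j where "j k = (if k = - 1 then (\<lambda>x. x) else if 0 \<le> k \<and> k < int n then jj (nat k)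
    else (\<lambda>_. \<zero>\<^bsub>T k\<^esub>))" for k :: int
  define p where "p k = (if 0 \<le> k \<and> k < int n then pp (nat k)
    else if k = int n then (\<lambda>x. x) else (\<lambda>_. {}))" for k :: int
  note z = zero_obj_left_module[OF ring] and lmK = fg_moduleD[OF res(2)]
  have zz: "ses R zero_obj (\<lambda>_. {}) zero_obj (\<lambda>_. {}) zero_obj"
    using zero_in_mod_hom[OF z, of zero_obj] z unfolding ses_def by (auto simp: a_kernel_def')
  have s: "ses R (C (k + 1)) (j k) (T k) (p k) (C k)" for k
  proof -
    consider "k < - 1" | "k = - 1" | "0 \<le> k" "k < int n" | "k = int n" | "int n < k" by linarith
    then show ?thesis
    proof cases
      case 1 then show ?thesis using zz by (simp add: C_def T_def j_def p_def)
    next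
      case 2 then show ?thesis using ses_zero_right[OF fg_moduleD[OF M]] res(1) by (simp add: C_def T_def j_def p_def)
    next
      case 3
      then have "nat (k + 1) = Suc (nat k)" by simp
      then show ?thesis using res(4)[of "nat k"] 3 by (simp add: C_def T_def j_def p_def)
    next
      case 4 then show ?thesis using ses_zero_left[OF lmK, of n] by (simp add: C_def T_def j_def p_def)
    next
      case 5 then show ?thesis using zz by (simp add: C_def T_def j_def p_def)
    qed
  qed
  have fgT: "fg_module R (T k)" for k
    using res(2) M dualizable_fg[OF res(3)] dualizable_fg[OF dualizable_zero_obj[OF ring]] by (simp add: T_def)
  have ex: "exact_complex R T (\<lambda>k x. j (k - 1) (p k x))"
    by (rule exact_complex_splice[of R C j T p, OF s fgT])
  have "Gproj R (T i)" if "0 \<le> i" "i \<le> int n" for i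
    using that res(5)[of n] perp_projective[OF res(3)] by (auto simp: T_def Gproj_iff)
  moreover have "zero_mod (T i)" if "i < - 1 \<or> int n < i" for i using that by (auto simp: T_def)
  moreover have "T (- 1) = M" by (simp add: T_def)
  ultimately have "\<exists>X d. exact_complex R X d \<and> X (- 1) = M \<and> (\<forall>i. 0 \<le> i \<and> i \<le> int n \<longrightarrow> Gproj R (X i)) \<and>
      (\<forall>i. i < - 1 \<or> int n < i \<longrightarrow> zero_mod (X i))"
    using ex by (intro exI[of _ T] exI[of _ "\<lambda>k x. j (k - 1) (p k x)"]) blast
  then show ?thesis unfolding Gpd_def by (intro Inf_lower) blast
qed

end


section \<open>A lower bound for the quasi-projective dimension\<close>

text \<open>This turns the suprema in the definition of the quasi-projective dimension into integers.\<close>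

lemma SUP_int_attained:
  assumes ne: "I \<noteq> {}" and fin: "(SUP i\<in>I. ereal (of_int i)) < \<infinity>"
  shows "\<exists>m\<in>I. (\<forall>i\<in>I. i \<le> m) \<and> (SUP i\<in>I. ereal (of_int i)) = ereal (of_int m)"
proof -
  obtain i0 where i0: "i0 \<in> I" using ne by blast
  have up: "ereal (of_int i) \<le> (SUP i\<in>I. ereal (of_int i))" if "i \<in> I" for i using that by (rule SUP_upper)
  obtain r where r: "(SUP i\<in>I. ereal (of_int i)) = ereal r"
    using fin up[OF i0] by (cases "SUP i\<in>I. ereal (of_int i)") auto
  have bound: "i \<le> \<lfloor>r\<rfloor>" if "i \<in> I" for i using up[OF that] r by (simp add: le_floor_iff)
  have fin: "finite (I \<inter> {i0..})" by (rule finite_subset[of _ "{i0..\<lfloor>r\<rfloor>}"]) (use bound in auto)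
  define m where "m = Max (I \<inter> {i0..})"
  have m: "m \<in> I \<inter> {i0..}" unfolding m_def using fin i0 by (intro Max_in) auto
  have le: "i \<le> m" if "i \<in> I" for i
  proof (cases "i0 \<le> i")
    case True then show ?thesis unfolding m_def using fin that by (intro Max_ge) auto
  next
    case False then show ?thesis using m by auto
  qed
  have "(SUP i\<in>I. ereal (of_int i)) = ereal (of_int m)"
    using m le by (intro antisym SUP_least SUP_upper) auto
  then show ?thesis using m le by blast
qed

lemma mod_power_simps:
  "carrier (mod_power M n) = {..<n} \<rightarrow>\<^sub>E carrier M"
  "\<zero>\<^bsub>mod_power M n\<^esub> = (\<lambda>i\<in>{..<n}. \<zero>\<^bsub>M\<^esub>)"
  "x \<oplus>\<^bsub>mod_power M n\<^esub> y = (\<lambda>i\<in>{..<n}. x i \<oplus>\<^bsub>M\<^esub> y i)"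
  "a \<odot>\<^bsub>mod_power M n\<^esub> x = (\<lambda>i\<in>{..<n}. a \<odot>\<^bsub>M\<^esub> x i)"
  by (simp_all add: mod_power_def)

lemma mod_power_retract:
  assumes M: "left_module R M" and N: "left_module R N" and a: "a \<noteq> 0" and iso: "mod_iso R N (mod_power M a)"
  shows "\<exists>i p. i \<in> mod_hom R M N \<and> p \<in> mod_hom R N M \<and> (\<forall>x\<in>carrier M. p (i x) = x)"
proof -
  note b = left_module_basics[OF M]
  have i: "(\<lambda>x. \<lambda>k\<in>{..<a}. if k = 0 then x else \<zero>\<^bsub>M\<^esub>) \<in> mod_hom R M (mod_power M a)"
    by (rule mod_homI) (auto simp: mod_power_simps b(3,6,8) intro!: restrict_ext)
  have p: "(\<lambda>v. v 0) \<in> mod_hom R (mod_power M a) M"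
    using a by (intro mod_homI) (auto simp: mod_power_simps)
  obtain f g where fg: "f \<in> mod_hom R N (mod_power M a)" "g \<in> mod_hom R (mod_power M a) N"
    "\<And>y. y \<in> carrier (mod_power M a) \<Longrightarrow> f (g y) = y"
    using mod_isoE[OF N iso] by metis
  show ?thesis
  proof (intro exI conjI ballI)
    show "(\<lambda>x. g (\<lambda>k\<in>{..<a}. if k = 0 then x else \<zero>\<^bsub>M\<^esub>)) \<in> mod_hom R M N" by (rule mod_hom_compose[OF i fg(2)])
    show "(\<lambda>y. f y 0) \<in> mod_hom R N M" by (rule mod_hom_compose[OF fg(1) p])
    show "f (g (\<lambda>k\<in>{..<a}. if k = 0 then x else \<zero>\<^bsub>M\<^esub>)) 0 = x" if "x \<in> carrier M" for x
      using fg(3)[OF mod_hom_closed[OF i that]] a by simp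
  qed
qed

lemma zero_mod_retract:
  assumes M: "left_module R M" and N: "left_module R N" and z: "zero_mod N"
    and i: "i \<in> mod_hom R M N" and p: "p \<in> mod_hom R N M" and pi: "\<forall>x\<in>carrier M. p (i x) = x"
  shows "zero_mod M"
proof -
  have "x = \<zero>\<^bsub>M\<^esub>" if x: "x \<in> carrier M" for x
  proof -
    have "i x = \<zero>\<^bsub>N\<^esub>" using mod_hom_closed[OF i x] z by (simp add: zero_mod_def)
    then show ?thesis using bspec[OF pi x] mod_hom_zero[OF N M p] by simp
  qed
  then show ?thesis by (rule zero_modI[OF M])
qed

definition boundaries :: "(int \<Rightarrow> 'a fgm) \<Rightarrow> (int \<Rightarrow> 'a fgmap) \<Rightarrow> int \<Rightarrow> 'a fgm" where
  "boundaries X d k = (X k)\<lparr>carrier := d (k + 1) ` carrier (X (k + 1))\<rparr>"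

lemma homology_eq: "homology X d k = quot_mod (cycles X d k) (carrier (boundaries X d k))"
  by (simp add: homology_def cycles_def boundaries_def)

context
  fixes R :: "('a, 'r) ring_scheme" and X :: "int \<Rightarrow> 'a fgm" and d
  assumes X: "mod_complex R X d"
begin

lemma boundaries_hom: "d (k + 1) \<in> mod_hom R (X (k + 1)) (X k)"
  using mod_complexD(3)[OF X, of "k + 1"] by simp

lemma boundaries_fg: "fg_module R (boundaries X d k)"
  unfolding boundaries_def by (rule fg_module_image[OF mod_complexD(1,2)[OF X] boundaries_hom])

lemma boundaries_submodule: "submodule (carrier (boundaries X d k)) R (cycles X d k)"
proof -
  note C = mod_complexD[OF X]
  have 1: "d k y = \<zero>\<^bsub>X (k - 1)\<^esub>" if "y \<in> d (k + 1) ` carrier (X (k + 1))" for y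
    using that C(4)[of _ "k + 1"] by auto
  have "d (k + 1) \<in> mod_hom R (X (k + 1)) (cycles X d k)"
    unfolding cycles_def using 1 mod_hom_closed[OF boundaries_hom[of k]]
    by (intro mod_hom_sub_target[OF boundaries_hom]) (auto simp: a_kernel_def')
  from image_submodule[OF C(2) cycles_left_module[OF X] this carrier_submodule[OF C(2)]]
  show ?thesis by (simp add: boundaries_def)
qed

lemma homology_left_module: "left_module R (homology X d k)"
  unfolding homology_eq by (rule quot_mod_projection(1)[OF cycles_left_module[OF X] boundaries_submodule])

lemma ses_homology:
  "ses R (boundaries X d k) (\<lambda>x. x) (cycles X d k) (\<lambda>x. carrier (boundaries X d k) +>\<^bsub>cycles X d k\<^esub> x) (homology X d k)"
proof -
  note Z = cycles_left_module[OF X]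
  note Q = quot_mod_projection[OF Z boundaries_submodule[of k]]
  note s = ses_kernel[OF Z Q(1-3)]
  have sub: "carrier (boundaries X d k) \<subseteq> carrier (cycles X d k)" by (rule submoduleD(1)[OF boundaries_submodule])
  have "a_kernel (cycles X d k) (quot_mod (cycles X d k) (carrier (boundaries X d k)))
    (\<lambda>x. carrier (boundaries X d k) +>\<^bsub>cycles X d k\<^esub> x) = carrier (boundaries X d k)"
    unfolding a_kernel_def' using Q(4) sub by auto
  then have "(cycles X d k)\<lparr>carrier := a_kernel (cycles X d k) (quot_mod (cycles X d k) (carrier (boundaries X d k)))
    (\<lambda>x. carrier (boundaries X d k) +>\<^bsub>cycles X d k\<^esub> x)\<rparr> = boundaries X d k"
    by (simp add: boundaries_def cycles_def)
  then show ?thesis using s unfolding homology_eq by simp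
qed

lemma homology_zero: "zero_mod (homology X d k) \<Longrightarrow> cycles X d k = boundaries X d k"
proof -
  assume z: "zero_mod (homology X d k)"
  have "a_kernel (X k) (X (k - 1)) (d k) = d (k + 1) ` carrier (X (k + 1))"
  proof
    show "d (k + 1) ` carrier (X (k + 1)) \<subseteq> a_kernel (X k) (X (k - 1)) (d k)"
      using submoduleD(1)[OF boundaries_submodule[of k]] by (simp add: boundaries_def)
    show "a_kernel (X k) (X (k - 1)) (d k) \<subseteq> d (k + 1) ` carrier (X (k + 1))"
    proof
      fix x assume "x \<in> a_kernel (X k) (X (k - 1)) (d k)"
      then have x: "x \<in> carrier (cycles X d k)" by simp
      note s = sesD[OF ses_homology[of k]]
      have "carrier (boundaries X d k) +>\<^bsub>cycles X d k\<^esub> x = \<zero>\<^bsub>homology X d k\<^esub>"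
        using s(12)[OF x] z by (simp add: zero_mod_def)
      from s(11)[OF x this] show "x \<in> d (k + 1) ` carrier (X (k + 1))" by (simp add: boundaries_def)
    qed
  qed
  then show ?thesis by (simp add: cycles_def boundaries_def)
qed

lemma ses_boundaries: "ses R (cycles X d k) (\<lambda>x. x) (X k) (d k) (boundaries X d (k - 1))"
proof -
  note C = mod_complexD[OF X]
  have d: "d k \<in> mod_hom R (X k) (boundaries X d (k - 1))"
    unfolding boundaries_def by (rule mod_hom_sub_target[OF C(3)]) simp
  have "a_kernel (X k) (boundaries X d (k - 1)) (d k) = a_kernel (X k) (X (k - 1)) (d k)"
    by (simp add: a_kernel_def' boundaries_def)
  moreover have "ses R ((X k)\<lparr>carrier := a_kernel (X k) (boundaries X d (k - 1)) (d k)\<rparr>) (\<lambda>x. x) (X k) (d k) (boundaries X d (k - 1))"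
    by (rule ses_kernel[OF C(2) fg_moduleD[OF boundaries_fg] d]) (simp add: boundaries_def)
  ultimately show ?thesis by (simp add: cycles_def)
qed

lemma zero_mod_homology:
  assumes z: "zero_mod (X k)" shows "zero_mod (homology X d k)"
proof -
  note s = sesD[OF ses_homology[of k]]
  have "y = \<zero>\<^bsub>homology X d k\<^esub>" if y: "y \<in> carrier (homology X d k)" for y
  proof -
    obtain x where x: "x \<in> carrier (cycles X d k)" "y = carrier (boundaries X d k) +>\<^bsub>cycles X d k\<^esub> x"
      using s(13)[OF y] by blast
    then have "x = \<zero>\<^bsub>cycles X d k\<^esub>" using z by (simp add: a_kernel_def' zero_mod_def)
    then show ?thesis using x(2) mod_hom_zero[OF s(2,3,6)] by simp
  qed
  then show ?thesis by (rule zero_modI[OF s(3)])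
qed

end

lemma sup_minus_hsup:
  assumes X: "mod_complex R X d" and h: "\<not> zero_mod (homology X d i0)" and fin: "sup_cpx X < \<infinity>"
  obtains s h where "sup_cpx X = ereal (of_int s)" "hsup_cpx X d = ereal (of_int h)" "h \<le> s"
    "\<And>i. s < i \<Longrightarrow> zero_mod (X i)" "\<And>i. h < i \<Longrightarrow> zero_mod (homology X d i)" "\<not> zero_mod (homology X d h)"
proof -
  let ?I = "{i. \<not> zero_mod (X i)}" and ?H = "{i. \<not> zero_mod (homology X d i)}"
  have sub: "?H \<subseteq> ?I" using zero_mod_homology[OF X] by blast
  have ne: "?H \<noteq> {}" "?I \<noteq> {}" using h sub by blast+
  obtain s where s: "s \<in> ?I" "\<forall>i\<in>?I. i \<le> s" "sup_cpx X = ereal (of_int s)"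
    using SUP_int_attained[OF ne(2)] fin unfolding sup_cpx_def by blast
  have "hsup_cpx X d \<le> sup_cpx X" unfolding hsup_cpx_def sup_cpx_def by (rule SUP_subset_mono[OF sub]) simp
  then have "hsup_cpx X d < \<infinity>" using fin by (rule le_less_trans)
  then obtain h where h: "h \<in> ?H" "\<forall>i\<in>?H. i \<le> h" "hsup_cpx X d = ereal (of_int h)"
    using SUP_int_attained[OF ne(1)] unfolding hsup_cpx_def by blast
  show ?thesis
  proof (rule that[OF s(3) h(3)])
    show "h \<le> s" using s(2) h(1) sub by blast
    show "zero_mod (X i)" if "s < i" for i using s(2) that by force
    show "zero_mod (homology X d i)" if "h < i" for i using h(2) that by force
    show "\<not> zero_mod (homology X d h)" using h(1) by simp
  qed
qed

text \<open>Let \<open>s\<close> be the supremum and \<open>h\<close> the homological supremum of a quasi-projective resolution with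
  \<open>s - h < n\<close>. As the complex is exact above \<open>h\<close>, the boundaries in degree \<open>h\<close> have a projective resolution of length at most
  \<open>s - h - 1\<close>, and no \<open>Ext\<close> in degree \<open>n - 1\<close>. The cycles in degree \<open>h\<close> have no \<open>Ext\<close> in degree \<open>n\<close>, because
  the boundaries in degree \<open>h - 1\<close> have none in degree \<open>n + 1\<close>. So the homology in degree \<open>h\<close> has no \<open>Ext\<close>
  in degree \<open>n\<close>, and \<open>M\<close> is a direct summand of it.\<close>

lemma (in gorenstein_ring) qpd_ext_zero:
  assumes M: "fg_module R (M :: 'a fgm)" and n: "n = Suc m" and qpd: "qpd R M < ereal (real n)"
  shows "ext_zero n M"
proof (cases "zero_mod M")
  case True then show ?thesis by (intro hom_acyclic_zero[OF fg_moduleD[OF M] _ Y_complex])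
next
  case False
  note M' = fg_moduleD[OF M]
  have "Inf {sup_cpx X - hsup_cpx X d | X d. quasi_proj_resolution R M X d \<and> sup_cpx X < \<infinity>} < ereal (real n)"
    using qpd False by (simp add: qpd_def)
  then obtain C c where C: "quasi_proj_resolution R M C c" "sup_cpx C < \<infinity>" "sup_cpx C - hsup_cpx C c < ereal (real n)"
    unfolding Inf_less_iff by blast
  have cpx: "mod_complex R C c" and proj: "\<And>i. dualizable R (C i)"
    using C(1) by (simp_all add: quasi_proj_resolution_def proj_obj_iff)
  obtain a :: "int \<Rightarrow> nat" where a: "\<exists>i. inf_cpx C \<le> ereal (of_int i) \<and> a i \<noteq> 0"
    "\<And>i. inf_cpx C \<le> ereal (of_int i) \<Longrightarrow> mod_iso R (homology C c i) (mod_power M (a i))"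
    using C(1) unfolding quasi_proj_resolution_def by blast
  note lmH = homology_left_module[OF cpx]
  obtain i0 where i0: "inf_cpx C \<le> ereal (of_int i0)" "a i0 \<noteq> 0" using a(1) by blast
  have "\<not> zero_mod (homology C c i0)"
    using mod_power_retract[OF M' lmH i0(2) a(2)[OF i0(1)]] zero_mod_retract[OF M' lmH] False by blast
  then obtain s h where sh: "sup_cpx C = ereal (of_int s)" "hsup_cpx C c = ereal (of_int h)" "h \<le> s"
    "\<And>i. s < i \<Longrightarrow> zero_mod (C i)" "\<And>i. h < i \<Longrightarrow> zero_mod (homology C c i)" "\<not> zero_mod (homology C c h)"
    using sup_minus_hsup[OF cpx _ C(2)] by metis
  define u where "u = nat (s - h)"
  have u: "s - h = int u" "u \<le> m" using sh(3) C(3) n by (simp_all add: u_def sh(1,2))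
  note fgB = boundaries_fg[OF cpx] and fgC = mod_complexD(1)[OF cpx]
  let ?L = "\<lambda>t. boundaries C c (s - int t)"
  have "ext_zero m (?L u)"
  proof (rule ext_zero_chain[where L = ?L and m = u and P = "\<lambda>t. C (s - int t)"
        and i = "\<lambda>_ x. x" and p = "\<lambda>t. c (s - int t)"])
    show "ses R (?L t) (\<lambda>x. x) (C (s - int t)) (c (s - int t)) (?L (Suc t))" if "t < u" for t
    proof -
      have "h < s - int t" using that u(1) by linarith
      then have "cycles C c (s - int t) = ?L t" by (intro homology_zero[OF cpx] sh(5))
      then show ?thesis using ses_boundaries[OF cpx, of "s - int t"] by (simp add: algebra_simps)
    qed
    show "zero_mod (?L 0)"
      using sh(4)[of "s + 1"] mod_hom_zero[OF mod_complexD(2,2)[OF cpx] boundaries_hom[OF cpx], of s]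
      by (simp add: boundaries_def zero_mod_def)
  qed (use u fgB fgC fg_moduleD[OF fgB] ext_zero_projective[OF proj] in auto)
  moreover have "s - int u = h" using u(1) by simp
  ultimately have B: "ext_zero m (boundaries C c h)" by simp
  have fgZ: "fg_module R (cycles C c h)" by (rule ses_fg(1)[OF noeth ses_boundaries[OF cpx] fgC])
  have "ext_zero (Suc n) (boundaries C c (h - 1))" by (rule ext_zero_large[OF fg_moduleD[OF fgB]]) simp
  moreover have "ext_zero n (C h)" using n by (intro ext_zero_projective[OF proj]) simp
  ultimately have Z: "ext_zero n (cycles C c h)" by (intro ext_zero_sub[OF ses_boundaries[OF cpx] fgZ fgC])
  have H: "ext_zero n (homology C c h)"
    using ext_zero_quotient[OF ses_homology[OF cpx] fgB fgZ B] Z n by simp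
  have "\<not> zero_mod (C h)" using zero_mod_homology[OF cpx, of h] sh(6) by blast
  then have "inf_cpx C \<le> ereal (of_int h)" unfolding inf_cpx_def by (intro INF_lower) simp
  note iso = a(2)[OF this]
  have "a h \<noteq> 0"
  proof
    assume "a h = 0"
    then have "carrier (mod_power M (a h)) = {\<lambda>_. undefined}" by (simp add: mod_power_simps)
    moreover obtain f where "bij_betw f (carrier (homology C c h)) (carrier (mod_power M (a h)))"
      using iso unfolding mod_iso_def by blast
    ultimately have "card (carrier (homology C c h)) = 1" using bij_betw_same_card by fastforce
    then obtain y where y: "carrier (homology C c h) = {y}" by (rule card_1_singletonE)
    then show False using sh(6) left_module_basics(3)[OF lmH, of h] unfolding zero_mod_def by auto
  qed
  from mod_power_retract[OF M' lmH this iso] obtain i p where "i \<in> mod_hom R M (homology C c h)"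
    "p \<in> mod_hom R (homology C c h) M" "\<forall>x\<in>carrier M. p (i x) = x" by blast
  then show ?thesis by (intro hom_acyclic_retract[OF H, of i M p]) simp_all
qed

section \<open>The cone of an eventually periodic resolution\<close>

lemma mod_iso_power_zero: "zero_mod N \<Longrightarrow> mod_iso R N (mod_power M 0)"
  unfolding mod_iso_def
  by (rule bexI[of _ "\<lambda>_ _. undefined"])
    (auto simp: zero_mod_def mod_power_simps bij_betw_def intro!: mod_homI)

lemma mod_iso_power_one: "mod_iso R M (mod_power M 1)"
  unfolding mod_iso_def
proof (rule bexI)
  let ?f = "\<lambda>x. \<lambda>i\<in>{..<1::nat}. x"
  show "?f \<in> mod_hom R M (mod_power M 1)"
    by (rule mod_homI) (auto simp: mod_power_simps intro!: restrict_ext)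
  have "inj_on ?f (carrier M)"
  proof
    fix x y assume "?f x = ?f y"
    then have "?f x 0 = ?f y 0" by (rule fun_cong)
    then show "x = y" by simp
  qed
  moreover have "?f ` carrier M = carrier (mod_power M 1)"
  proof
    show "?f ` carrier M \<subseteq> carrier (mod_power M 1)" by (auto simp: mod_power_simps split: if_splits)
    show "carrier (mod_power M 1) \<subseteq> ?f ` carrier M"
    proof
      fix v assume v: "v \<in> carrier (mod_power M 1)"
      then have "v = ?f (v 0)" by (intro PiE_ext[where k = "{..<1}" and s = "\<lambda>_. carrier M"]) (auto simp: mod_power_simps)
      moreover have "v 0 \<in> carrier M" using v by (auto simp: mod_power_simps)
      ultimately show "v \<in> ?f ` carrier M" by (rule image_eqI)
    qed
  qed
  ultimately show "bij_betw ?f (carrier M) (carrier (mod_power M 1))" by (simp add: bij_betw_def)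
qed

lemma homology_vanishesI:
  assumes C: "mod_complex R C c"
    and ex: "\<And>z. z \<in> carrier (C i) \<Longrightarrow> c i z = \<zero>\<^bsub>C (i - 1)\<^esub> \<Longrightarrow> \<exists>w\<in>carrier (C (i + 1)). c (i + 1) w = z"
  shows "zero_mod (homology C c i)"
proof (rule zero_modI[OF homology_left_module[OF C]])
  note s = sesD[OF ses_homology[OF C, of i]]
  fix y assume "y \<in> carrier (homology C c i)"
  from s(13)[OF this] obtain x where x: "x \<in> carrier (cycles C c i)"
    "y = carrier (boundaries C c i) +>\<^bsub>cycles C c i\<^esub> x" by blast
  then obtain w where "w \<in> carrier (C (i + 1))" "c (i + 1) w = x" using ex by (auto simp: a_kernel_def')
  then have "x \<in> carrier (boundaries C c i)" by (auto simp: boundaries_def)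
  from s(9)[OF this] show "y = \<zero>\<^bsub>homology C c i\<^esub>" using x(2) by simp
qed

lemma homology_isoI:
  assumes C: "mod_complex R C c" and M: "left_module R M"
    and F: "F \<in> mod_hom R (cycles C c i) M" "F ` carrier (cycles C c i) = carrier M"
    and ker: "\<And>z. z \<in> carrier (cycles C c i) \<Longrightarrow> F z = \<zero>\<^bsub>M\<^esub> \<Longrightarrow> \<exists>w\<in>carrier (C (i + 1)). c (i + 1) w = z"
    and bd: "\<And>w. w \<in> carrier (C (i + 1)) \<Longrightarrow> F (c (i + 1) w) = \<zero>\<^bsub>M\<^esub>"
  shows "mod_iso R (homology C c i) (mod_power M 1)"
proof -
  have "a_kernel (cycles C c i) M F = carrier (boundaries C c i)"
  proof (intro equalityI subsetI)
    fix z assume "z \<in> a_kernel (cycles C c i) M F"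
    then have "z \<in> carrier (cycles C c i)" "F z = \<zero>\<^bsub>M\<^esub>" unfolding a_kernel_def' by auto
    from ker[OF this] show "z \<in> carrier (boundaries C c i)" by (auto simp: boundaries_def)
  next
    fix z assume z: "z \<in> carrier (boundaries C c i)"
    then obtain w where "w \<in> carrier (C (i + 1))" "z = c (i + 1) w" by (auto simp: boundaries_def)
    then have "F z = \<zero>\<^bsub>M\<^esub>" using bd by simp
    moreover have "z \<in> carrier (cycles C c i)" using submoduleD(1)[OF boundaries_submodule[OF C]] z by blast
    ultimately show "z \<in> a_kernel (cycles C c i) M F" unfolding a_kernel_def' by blast
  qed
  from quot_mod_iso[OF cycles_left_module[OF C] M F this] show ?thesis
    unfolding homology_eq by (rule mod_iso_trans[OF _ mod_iso_power_one])
qed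

text \<open>The differential of the cone maps \<open>(x, y)\<close> to \<open>(u x, f x - v y)\<close>. The direct sums exist as objects only up to
  isomorphism, so that their elements are described by the two projections \<open>a\<close> and \<open>b\<close>.\<close>

lemma mapping_cone:
  assumes U: "mod_complex R U u" and V: "mod_complex R V v"
    and f: "\<And>i. f i \<in> mod_hom R (U i) (V (i - 1))"
    and comm: "\<And>i x. x \<in> carrier (U i) \<Longrightarrow> v (i - 1) (f i x) = f (i - 1) (u i x)"
  obtains C :: "int \<Rightarrow> 'a fgm" and c a b where "mod_complex R C c"
    "\<And>i. a i \<in> mod_hom R (C i) (U i)" "\<And>i. b i \<in> mod_hom R (C i) (V i)"
    "\<And>i x y. x \<in> carrier (U i) \<Longrightarrow> y \<in> carrier (V i) \<Longrightarrow> \<exists>z\<in>carrier (C i). a i z = x \<and> b i z = y"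
    "\<And>i z z'. z \<in> carrier (C i) \<Longrightarrow> z' \<in> carrier (C i) \<Longrightarrow> a i z = a i z' \<Longrightarrow> b i z = b i z' \<Longrightarrow> z = z'"
    "\<And>i z. z \<in> carrier (C i) \<Longrightarrow> a (i - 1) (c i z) = u i (a i z)"
    "\<And>i z. z \<in> carrier (C i) \<Longrightarrow> b (i - 1) (c i z) = f i (a i z) \<ominus>\<^bsub>V (i - 1)\<^esub> v i (b i z)"
    "\<And>i. dualizable R (U i) \<Longrightarrow> dualizable R (V i) \<Longrightarrow> dualizable R (C i)"
proof -
  note CU = mod_complexD[OF U] and CV = mod_complexD[OF V]
  have "\<exists>q :: 'a fgm \<times> _ \<times> _. fg_module R (fst q) \<and> fst (snd q) \<in> mod_hom R (prod_mod (U i) (V i)) (fst q) \<and>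
    snd (snd q) \<in> mod_hom R (fst q) (prod_mod (U i) (V i)) \<and>
    (\<forall>x\<in>carrier (prod_mod (U i) (V i)). snd (snd q) (fst (snd q) x) = x) \<and>
    (\<forall>y\<in>carrier (fst q). fst (snd q) (snd (snd q) y) = y)" for i
  proof -
    obtain S :: "'a fgm" and g h where "fg_module R S" "g \<in> mod_hom R (prod_mod (U i) (V i)) S"
      "h \<in> mod_hom R S (prod_mod (U i) (V i))" "\<And>x. x \<in> carrier (prod_mod (U i) (V i)) \<Longrightarrow> h (g x) = x"
      "\<And>y. y \<in> carrier S \<Longrightarrow> g (h y) = y"
      by (rule fg_module_representative[OF prod_mod_fg[OF CU(1) CV(1)]]) blast
    then show ?thesis by (intro exI[of _ "(S, g, h)"]) simp
  qed
  then have "\<forall>i. \<exists>q :: 'a fgm \<times> _ \<times> _. fg_module R (fst q) \<and>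
    fst (snd q) \<in> mod_hom R (prod_mod (U i) (V i)) (fst q) \<and>
    snd (snd q) \<in> mod_hom R (fst q) (prod_mod (U i) (V i)) \<and>
    (\<forall>x\<in>carrier (prod_mod (U i) (V i)). snd (snd q) (fst (snd q) x) = x) \<and>
    (\<forall>y\<in>carrier (fst q). fst (snd q) (snd (snd q) y) = y)" by (rule allI)
  from choice[OF this] obtain q :: "int \<Rightarrow> 'a fgm \<times> _ \<times> _" where q': "\<forall>i. fg_module R (fst (q i)) \<and>
    fst (snd (q i)) \<in> mod_hom R (prod_mod (U i) (V i)) (fst (q i)) \<and>
    snd (snd (q i)) \<in> mod_hom R (fst (q i)) (prod_mod (U i) (V i)) \<and>
    (\<forall>x\<in>carrier (prod_mod (U i) (V i)). snd (snd (q i)) (fst (snd (q i)) x) = x) \<and>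
    (\<forall>y\<in>carrier (fst (q i)). fst (snd (q i)) (snd (snd (q i)) y) = y)" by (rule exE)
  define C :: "int \<Rightarrow> 'a fgm" where "C i = fst (q i)" for i
  define g where "g i = fst (snd (q i))" for i
  define h where "h i = snd (snd (q i))" for i
  have C: "fg_module R (C i)" and g: "g i \<in> mod_hom R (prod_mod (U i) (V i)) (C i)"
    and h: "h i \<in> mod_hom R (C i) (prod_mod (U i) (V i))"
    and hg: "x \<in> carrier (prod_mod (U i) (V i)) \<Longrightarrow> h i (g i x) = x"
    and gh: "z \<in> carrier (C i) \<Longrightarrow> g i (h i z) = z" for i x z
    using q'[THEN spec, of i] by (simp_all add: C_def g_def h_def del: prod_mod_simps)
  note lmC = fg_moduleD[OF C]
  note hc = mod_hom_closed[OF h]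
  have fs: "fst \<in> mod_hom R (prod_mod (U i) (V i)) (U i)" "snd \<in> mod_hom R (prod_mod (U i) (V i)) (V i)" for i
    by (auto intro!: mod_homI)
  define a where "a i z = fst (h i z)" for i z
  define b where "b i z = snd (h i z)" for i z
  have a: "a i \<in> mod_hom R (C i) (U i)" for i unfolding a_def[abs_def] by (rule mod_hom_compose[OF h fs(1)])
  have b: "b i \<in> mod_hom R (C i) (V i)" for i unfolding b_def[abs_def] by (rule mod_hom_compose[OF h fs(2)])
  note ac = mod_hom_closed[OF a] and bc = mod_hom_closed[OF b]
  define c where "c i z = g (i - 1) (u i (a i z), f i (a i z) \<ominus>\<^bsub>V (i - 1)\<^esub> v i (b i z))" for i z
  have ua: "(\<lambda>z. u i (a i z)) \<in> mod_hom R (C i) (U (i - 1))" for i by (rule mod_hom_compose[OF a CU(3)])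
  have fv: "(\<lambda>z. f i (a i z) \<ominus>\<^bsub>V (i - 1)\<^esub> v i (b i z)) \<in> mod_hom R (C i) (V (i - 1))" for i
    by (rule mod_hom_diff[OF CV(2) mod_hom_compose[OF a f] mod_hom_compose[OF b CV(3)]])
  have pair: "(\<lambda>z. (u i (a i z), f i (a i z) \<ominus>\<^bsub>V (i - 1)\<^esub> v i (b i z))) \<in> mod_hom R (C i) (prod_mod (U (i - 1)) (V (i - 1)))" for i
    using mod_hom_closed[OF ua] mod_hom_closed[OF fv] mod_hom_add[OF ua] mod_hom_add[OF fv]
      mod_hom_smult[OF ua] mod_hom_smult[OF fv] by (simp add: mod_hom_def hom_def Pi_def)
  have c: "c i \<in> mod_hom R (C i) (C (i - 1))" for i
    unfolding c_def[abs_def] by (rule mod_hom_compose[OF pair g])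
  have hcz: "h (i - 1) (c i z) = (u i (a i z), f i (a i z) \<ominus>\<^bsub>V (i - 1)\<^esub> v i (b i z))" if "z \<in> carrier (C i)" for i z
    unfolding c_def by (rule hg[OF mod_hom_closed[OF pair that]])
  have acz: "a (i - 1) (c i z) = u i (a i z)" if "z \<in> carrier (C i)" for i z
    using hcz[OF that] by (simp add: a_def)
  have bcz: "b (i - 1) (c i z) = f i (a i z) \<ominus>\<^bsub>V (i - 1)\<^esub> v i (b i z)" if "z \<in> carrier (C i)" for i z
    using hcz[OF that] by (simp add: b_def)
  have surj: "\<exists>z\<in>carrier (C i). a i z = x \<and> b i z = y" if "x \<in> carrier (U i)" "y \<in> carrier (V i)" for i x y
  proof -
    have "(x, y) \<in> carrier (prod_mod (U i) (V i))" using that by simp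
    then show ?thesis using hg mod_hom_closed[OF g] by (rule_tac bexI[of _ "g i (x, y)"]) (simp_all add: a_def b_def)
  qed
  have inj: "z = z'" if "z \<in> carrier (C i)" "z' \<in> carrier (C i)" "a i z = a i z'" "b i z = b i z'" for i z z'
  proof -
    have "h i z = h i z'" using that(3,4) by (simp add: a_def b_def prod_eq_iff)
    then have "g i (h i z) = g i (h i z')" by simp
    then show ?thesis using gh that(1,2) by simp
  qed
  have cc: "c (i - 1) (c i z) = \<zero>\<^bsub>C (i - 2)\<^esub>" if z: "z \<in> carrier (C i)" for i z
  proof (rule inj)
    have i2: "i - 1 - 1 = i - 2" by simp
    have cz: "c i z \<in> carrier (C (i - 1))" by (rule mod_hom_closed[OF c z])
    show "c (i - 1) (c i z) \<in> carrier (C (i - 2))" using mod_hom_closed[OF c cz] by (simp only: i2)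
    show "\<zero>\<^bsub>C (i - 2)\<^esub> \<in> carrier (C (i - 2))" by (rule left_module_basics(3)[OF lmC])
    show "a (i - 2) (c (i - 1) (c i z)) = a (i - 2) \<zero>\<^bsub>C (i - 2)\<^esub>"
      using acz[OF cz] acz[OF z] CU(4)[OF ac[OF z]] mod_hom_zero[OF lmC CU(2) a, of "i - 2"] by (simp only: i2)
    have vi: "v (i - 1) \<in> mod_hom R (V (i - 1)) (V (i - 2))" using CV(3)[of "i - 1"] by (simp only: i2)
    have fc: "f i (a i z) \<in> carrier (V (i - 1))" "v i (b i z) \<in> carrier (V (i - 1))"
      using mod_hom_closed[OF f ac[OF z]] CV(5)[OF bc[OF z]] by blast+
    have "b (i - 2) (c (i - 1) (c i z)) =
      f (i - 1) (a (i - 1) (c i z)) \<ominus>\<^bsub>V (i - 2)\<^esub> v (i - 1) (b (i - 1) (c i z))"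
      using bcz[OF cz] by (simp only: i2)
    also have "\<dots> = v (i - 1) (f i (a i z)) \<ominus>\<^bsub>V (i - 2)\<^esub> v (i - 1) (f i (a i z) \<ominus>\<^bsub>V (i - 1)\<^esub> v i (b i z))"
      using acz[OF z] bcz[OF z] comm[OF ac[OF z]] by simp
    also have "v (i - 1) (f i (a i z) \<ominus>\<^bsub>V (i - 1)\<^esub> v i (b i z)) = v (i - 1) (f i (a i z))"
      using mod_hom_minus[OF CV(2) CV(2) vi fc] CV(4)[OF bc[OF z]] left_module_minus(5)[OF CV(2)[of "i - 2"], OF mod_hom_closed[OF vi fc(1)] left_module_basics(3)[OF CV(2)]]
      by simp
    finally show "b (i - 2) (c (i - 1) (c i z)) = b (i - 2) \<zero>\<^bsub>C (i - 2)\<^esub>"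
      using left_module_minus(3)[OF CV(2) mod_hom_closed[OF vi fc(1)] mod_hom_closed[OF vi fc(1)]]
        mod_hom_zero[OF lmC CV(2) b, of "i - 2"] by simp
  qed
  have cpx: "mod_complex R C c" unfolding mod_complex_def fg_mod_iff using C c cc by blast
  have du: "dualizable R (C i)" if "dualizable R (U i)" "dualizable R (V i)" for i
    by (rule dualizable_retract[OF dualizable_prod_mod[OF that] lmC h g gh])
  show ?thesis by (rule that[OF cpx a b surj inj acz bcz du])
qed

text \<open>The resolution is given by its syzygies \<open>K\<close>. The condition \<open>2 \<le> r\<close> keeps apart the two degrees in which
  the cone of \<open>\<eta>\<close> has homology.\<close>

locale periodic_resolution =
  fixes R :: "('a, 'r) ring_scheme" and K X :: "nat \<Rightarrow> 'a fgm" and j p \<eta> :: "nat \<Rightarrow> 'a fgmap" and r n :: nat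
  assumes ses: "\<And>t. ses R (K (Suc t)) (j t) (X t) (p t) (K t)"
    and proj: "\<And>t. dualizable R (X t)"
    and r: "2 \<le> r"
    and eta: "\<And>t. \<eta> t \<in> mod_hom R (X (t + r)) (X t)"
    and eta_comm: "\<And>t x. x \<in> carrier (X (Suc t + r)) \<Longrightarrow>
      j t (p (Suc t) (\<eta> (Suc t) x)) = \<eta> t (j (t + r) (p (Suc t + r) x))"
    and periodic: "\<And>t. n \<le> t \<Longrightarrow> X (t + r) = X t" "\<And>t. n \<le> t \<Longrightarrow> K (t + r) = K t"
      "\<And>t. n \<le> t \<Longrightarrow> p (t + r) = p t" "\<And>t. n \<le> t \<Longrightarrow> \<eta> t = (\<lambda>x. x)"
begin

definition D :: "nat \<Rightarrow> 'a fgmap" where "D t x = j t (p (Suc t) x)"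

lemmas s = sesD[OF ses]
lemmas lmX = dualizableD[OF proj]

lemma D_hom: "D t \<in> mod_hom R (X (Suc t)) (X t)"
  unfolding D_def[abs_def] by (rule mod_hom_compose[OF s(6) s(4)])

lemma j_zero: "j t \<zero>\<^bsub>K (Suc t)\<^esub> = \<zero>\<^bsub>X t\<^esub>" by (rule mod_hom_zero[OF s(1,2,4)])

lemma D_zero_iff:
  assumes "x \<in> carrier (X (Suc t))" shows "D t x = \<zero>\<^bsub>X t\<^esub> \<longleftrightarrow> p (Suc t) x = \<zero>\<^bsub>K (Suc t)\<^esub>"
  using inj_onD[OF s(5), of t "p (Suc t) x" "\<zero>\<^bsub>K (Suc t)\<^esub>"] j_zero[of t] s(12)[OF assms] left_module_basics(3)[OF s(1)]
  by (auto simp: D_def)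

lemma p_D: "x \<in> carrier (X (Suc t)) \<Longrightarrow> p t (D t x) = \<zero>\<^bsub>K t\<^esub>"
  using s(9)[OF s(12)] by (simp add: D_def)

lemma p_exact: "x \<in> carrier (X t) \<Longrightarrow> p t x = \<zero>\<^bsub>K t\<^esub> \<Longrightarrow> \<exists>y\<in>carrier (X (Suc t)). D t y = x"
  using s(11)[of x t] s(13)[of _ "Suc t"] by (metis D_def)

lemma D_D: "x \<in> carrier (X (Suc (Suc t))) \<Longrightarrow> D t (D (Suc t) x) = \<zero>\<^bsub>X t\<^esub>"
  using p_D[of x "Suc t"] j_zero by (simp add: D_def)

lemma D_exact: "x \<in> carrier (X (Suc t)) \<Longrightarrow> D t x = \<zero>\<^bsub>X t\<^esub> \<Longrightarrow> \<exists>y\<in>carrier (X (Suc (Suc t))). D (Suc t) y = x"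
  using D_zero_iff p_exact by blast

lemma eta_D: "x \<in> carrier (X (Suc (t + r))) \<Longrightarrow> D t (\<eta> (Suc t) x) = \<eta> t (D (t + r) x)"
  using eta_comm[of x t] by (simp add: D_def)

text \<open>In the cone of \<open>\<eta>\<close> the summands \<open>X (t + r)\<close> and \<open>X t\<close> for \<open>t \<ge> n\<close> form a contractible complex. What is left
  is the cone of the map that \<open>\<eta>\<close> induces between the truncations \<open>U\<close> and \<open>V\<close> of the resolution, where \<open>V\<close> is
  shifted such that \<open>U i\<close> is mapped to \<open>V (i - 1)\<close>.\<close>

definition N :: nat where "N = n + r - 1"

definition U :: "int \<Rightarrow> 'a fgm" where
  "U i = (if 0 \<le> i \<and> i \<le> int N then X (nat i) else zero_obj)"
definition V :: "int \<Rightarrow> 'a fgm" where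
  "V i = (if int r - 1 \<le> i \<and> i \<le> int N - 1 then X (nat (i + 1 - int r)) else zero_obj)"
definition u :: "int \<Rightarrow> 'a fgmap" where
  "u i = (if 1 \<le> i \<and> i \<le> int N then D (nat (i - 1)) else (\<lambda>_. \<zero>\<^bsub>U (i - 1)\<^esub>))"
definition v :: "int \<Rightarrow> 'a fgmap" where
  "v i = (if int r \<le> i \<and> i \<le> int N - 1 then D (nat (i - int r)) else (\<lambda>_. \<zero>\<^bsub>V (i - 1)\<^esub>))"
definition f :: "int \<Rightarrow> 'a fgmap" where
  "f i = (if int r \<le> i \<and> i \<le> int N then \<eta> (nat (i - int r)) else (\<lambda>_. \<zero>\<^bsub>V (i - 1)\<^esub>))"

lemma N: "int N = int n + int r - 1" "r - 1 \<le> N" using r by (auto simp: N_def)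

lemma UV_proj: "dualizable R (U i)" "dualizable R (V i)"
  using proj dualizable_zero_obj[OF left_module_basics(1)[OF lmX]] by (simp_all add: U_def V_def)

lemmas UV_lm = UV_proj[THEN dualizableD]

lemma U_nat: "k \<le> N \<Longrightarrow> U (int k) = X k" by (simp add: U_def)
lemma V_nat: "l < n \<Longrightarrow> V (int (l + r) - 1) = X l" using N r by (simp add: V_def)
lemma u_nat: "Suc k \<le> N \<Longrightarrow> u (int (Suc k)) = D k" by (simp add: u_def)
lemma v_nat: "Suc l < n \<Longrightarrow> v (int (l + r)) = D l" using N r by (simp add: v_def)
lemma f_nat: "l < n \<Longrightarrow> f (int (l + r)) = \<eta> l" using N r by (simp add: f_def)
lemma V_out: "i < int r - 1 \<or> int N - 1 < i \<Longrightarrow> V i = zero_obj" by (auto simp: V_def)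
lemma U_out: "i < 0 \<or> int N < i \<Longrightarrow> U i = zero_obj" by (auto simp: U_def)

lemma u_hom: "u i \<in> mod_hom R (U i) (U (i - 1))"
proof (cases "1 \<le> i \<and> i \<le> int N")
  case True
  define k where "k = nat (i - 1)"
  have k: "i = int (Suc k)" "Suc k \<le> N" using True by (auto simp: k_def)
  then show ?thesis using D_hom[of k] u_nat[OF k(2)] U_nat[OF k(2)] U_nat[of k] by simp
next
  case False
  then have "u i = (\<lambda>_. \<zero>\<^bsub>U (i - 1)\<^esub>)" by (simp only: u_def if_False)
  then show ?thesis by (simp only: zero_in_mod_hom[OF UV_lm(1)])
qed

lemma v_hom: "v i \<in> mod_hom R (V i) (V (i - 1))"
proof (cases "int r \<le> i \<and> i \<le> int N - 1")
  case True
  define l where "l = nat (i - int r)"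
  have l1: "i = int (l + r)" using True by (simp add: l_def)
  then have l: "i = int (l + r)" "Suc l < n" using True N by simp_all
  have "V i = X (Suc l)" using V_nat[OF l(2)] l(1) by simp
  moreover have "V (i - 1) = X l" using V_nat[of l] l by simp
  ultimately show ?thesis using D_hom[of l] v_nat[OF l(2)] l(1) by simp
next
  case False
  then have "v i = (\<lambda>_. \<zero>\<^bsub>V (i - 1)\<^esub>)" by (simp only: v_def if_False)
  then show ?thesis by (simp only: zero_in_mod_hom[OF UV_lm(2)])
qed

lemma f_hom: "f i \<in> mod_hom R (U i) (V (i - 1))"
proof (cases "int r \<le> i \<and> i \<le> int N")
  case True
  define l where "l = nat (i - int r)"
  have l1: "i = int (l + r)" using True by (simp add: l_def)
  then have l: "i = int (l + r)" "l < n" using True N by simp_all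
  have "l + r \<le> N" using True l by simp
  then have "U i = X (l + r)" using U_nat[of "l + r"] l(1) by simp
  moreover have "V (i - 1) = X l" using V_nat[OF l(2)] l(1) by simp
  ultimately show ?thesis using eta[of l] f_nat[OF l(2)] l(1) by simp
next
  case False
  then have "f i = (\<lambda>_. \<zero>\<^bsub>V (i - 1)\<^esub>)" by (simp only: f_def if_False)
  then show ?thesis by (simp only: zero_in_mod_hom[OF UV_lm(2)])
qed

lemma U_complex: "mod_complex R U u"
proof -
  have "u (i - 1) (u i x) = \<zero>\<^bsub>U (i - 2)\<^esub>" if x: "x \<in> carrier (U i)" for i x
  proof -
    have i2: "i - 1 - 1 = i - 2" by simp
    consider "i < 2" | "int N < i" | "2 \<le> i" "i \<le> int N" by linarith
    then show ?thesis
    proof cases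
      case 1 then show ?thesis by (simp add: u_def[of "i - 1"])
    next
      case 2 then show ?thesis using mod_hom_zero[OF UV_lm(1) UV_lm(1) u_hom[of "i - 1"]] by (simp add: u_def[of i])
    next
      case 3
      define k where "k = nat (i - 2)"
      have k: "i = int (Suc (Suc k))" "Suc (Suc k) \<le> N" using 3 by (simp_all add: k_def nat_le_iff)
      have "x \<in> carrier (X (Suc (Suc k)))" using x U_nat[OF k(2)] k(1) by simp
      moreover have "u i = D (Suc k)" using u_nat[OF k(2)] k(1) by simp
      moreover have "u (i - 1) = D k" using u_nat[of k] k by simp
      moreover have "U (i - 2) = X k" using U_nat[of k] k by simp
      ultimately show ?thesis using D_D by simp
    qed
  qed
  then show ?thesis unfolding mod_complex_def fg_mod_iff using dualizable_fg[OF UV_proj(1)] u_hom by blast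
qed

lemma V_complex: "mod_complex R V v"
proof -
  have "v (i - 1) (v i x) = \<zero>\<^bsub>V (i - 2)\<^esub>" if x: "x \<in> carrier (V i)" for i x
  proof -
    consider "i < int r + 1" | "int N - 1 < i" | "int r + 1 \<le> i" "i \<le> int N - 1" by linarith
    then show ?thesis
    proof cases
      case 1 then show ?thesis by (simp add: v_def[of "i - 1"])
    next
      case 2 then show ?thesis using mod_hom_zero[OF UV_lm(2) UV_lm(2) v_hom[of "i - 1"]] by (simp add: v_def[of i])
    next
      case 3
      define l where "l = nat (i - int r - 1)"
      have l1: "i = int (Suc l + r)" using 3 by (simp add: l_def)
      then have l: "i = int (Suc l + r)" "Suc (Suc l) < n" using 3 N by simp_all
      have "x \<in> carrier (X (Suc (Suc l)))" using x V_nat[OF l(2)] l(1) by simp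
      moreover have "v i = D (Suc l)" using v_nat[OF l(2)] l(1) by simp
      moreover have "v (i - 1) = D l" using v_nat[of l] l by simp
      moreover have "V (i - 2) = X l" using V_nat[of l] l by simp
      ultimately show ?thesis using D_D by simp
    qed
  qed
  then show ?thesis unfolding mod_complex_def fg_mod_iff using dualizable_fg[OF UV_proj(2)] v_hom by blast
qed

lemma f_comm: "x \<in> carrier (U i) \<Longrightarrow> v (i - 1) (f i x) = f (i - 1) (u i x)"
proof -
  assume x: "x \<in> carrier (U i)"
  consider "i < int r + 1" | "int N < i" | "int r + 1 \<le> i" "i \<le> int N" by linarith
  then show ?thesis
  proof cases
    case 1 then show ?thesis by (simp add: v_def f_def[of "i - 1"])
  next
    case 2 then show ?thesis
      using mod_hom_zero[OF UV_lm(2) UV_lm(2) v_hom[of "i - 1"]]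
        mod_hom_zero[OF UV_lm(1) UV_lm(2) f_hom[of "i - 1"]] by (simp add: f_def[of i] u_def[of i])
  next
    case 3
    define l where "l = nat (i - int r - 1)"
    have l1: "i = int (Suc l + r)" using 3 by (simp add: l_def)
    then have l: "i = int (Suc l + r)" "Suc l < n" using 3 N by simp_all
    have lN: "Suc (l + r) \<le> N" using 3 l(1) by simp
    have "x \<in> carrier (X (Suc (l + r)))" using x U_nat[OF lN] l(1) by simp
    moreover have "f i = \<eta> (Suc l)" using f_nat[OF l(2)] l(1) by simp
    moreover have "f (i - 1) = \<eta> l" using f_nat[of l] l by simp
    moreover have "v (i - 1) = D l" using v_nat[OF l(2)] l by simp
    moreover have "u i = D (l + r)" using u_nat[OF lN] l by simp
    ultimately show ?thesis using eta_D by simp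
  qed
qed

end

lemma left_module_minus_minus:
  assumes M: "left_module R M" and x: "x \<in> carrier M" "y \<in> carrier M"
  shows "x \<ominus>\<^bsub>M\<^esub> (x \<ominus>\<^bsub>M\<^esub> y) = y"
proof -
  note m = left_module_minus[OF M]
  have "y \<oplus>\<^bsub>M\<^esub> (x \<ominus>\<^bsub>M\<^esub> y) = x"
    using m(2)[OF x] left_module_basics(9)[OF M x(2) m(1)[OF x]] by (simp only:)
  then show ?thesis using m(4)[OF x(2) m(1)[OF x]] by (simp only:)
qed

locale periodic_cone = periodic_resolution R K X j p \<eta> r n
  for R :: "('a, 'r) ring_scheme" and K X :: "nat \<Rightarrow> 'a fgm" and j p \<eta> r n +
  fixes C :: "int \<Rightarrow> 'a fgm" and c a b :: "int \<Rightarrow> 'a fgmap"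
  assumes cone: "mod_complex R C c"
    and a: "\<And>i. a i \<in> mod_hom R (C i) (U i)" and b: "\<And>i. b i \<in> mod_hom R (C i) (V i)"
    and pair: "\<And>i x y. x \<in> carrier (U i) \<Longrightarrow> y \<in> carrier (V i) \<Longrightarrow> \<exists>z\<in>carrier (C i). a i z = x \<and> b i z = y"
    and pair_eqI: "\<And>i z z'. z \<in> carrier (C i) \<Longrightarrow> z' \<in> carrier (C i) \<Longrightarrow> a i z = a i z' \<Longrightarrow> b i z = b i z' \<Longrightarrow> z = z'"
    and a_c: "\<And>i z. z \<in> carrier (C i) \<Longrightarrow> a (i - 1) (c i z) = u i (a i z)"
    and b_c: "\<And>i z. z \<in> carrier (C i) \<Longrightarrow> b (i - 1) (c i z) = f i (a i z) \<ominus>\<^bsub>V (i - 1)\<^esub> v i (b i z)"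
    and C_proj: "\<And>i. dualizable R (U i) \<Longrightarrow> dualizable R (V i) \<Longrightarrow> dualizable R (C i)"
begin

lemmas CC = mod_complexD[OF cone]
lemmas ac = mod_hom_closed[OF a]
lemmas bc = mod_hom_closed[OF b]
lemmas Xc = left_module_basics(3)[OF lmX]

lemma a_zero: "a i \<zero>\<^bsub>C i\<^esub> = \<zero>\<^bsub>U i\<^esub>" by (rule mod_hom_zero[OF CC(2) UV_lm(1) a])
lemma b_zero: "b i \<zero>\<^bsub>C i\<^esub> = \<zero>\<^bsub>V i\<^esub>" by (rule mod_hom_zero[OF CC(2) UV_lm(2) b])

lemma cycle_a: "z \<in> carrier (C i) \<Longrightarrow> c i z = \<zero>\<^bsub>C (i - 1)\<^esub> \<Longrightarrow> u i (a i z) = \<zero>\<^bsub>U (i - 1)\<^esub>"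
  using a_c[of z i] a_zero[of "i - 1"] by simp

lemma cycle_b: "z \<in> carrier (C i) \<Longrightarrow> c i z = \<zero>\<^bsub>C (i - 1)\<^esub> \<Longrightarrow> f i (a i z) = v i (b i z)"
proof -
  assume z: "z \<in> carrier (C i)" "c i z = \<zero>\<^bsub>C (i - 1)\<^esub>"
  then have "f i (a i z) \<ominus>\<^bsub>V (i - 1)\<^esub> v i (b i z) = \<zero>\<^bsub>V (i - 1)\<^esub>" using b_c[of z i] b_zero[of "i - 1"] by simp
  then show ?thesis
    using left_module_minus(3)[OF UV_lm(2) mod_hom_closed[OF f_hom ac[OF z(1)]] mod_hom_closed[OF v_hom bc[OF z(1)]]] by simp
qed

lemma cone_zero_mod: "U i = zero_obj \<Longrightarrow> V i = zero_obj \<Longrightarrow> zero_mod (C i)"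
  using ac[of _ i] bc[of _ i] a_zero[of i] b_zero[of i]
  by (rule_tac zero_modI[OF CC(2)], rule_tac pair_eqI[of _ i]) (simp_all add: left_module_basics(3)[OF CC(2)])

text \<open>If \<open>Suc l = n\<close>, then \<open>y\<close> lies in the summand \<open>X n\<close> that was truncated, and it is replaced by the same element
  of \<open>X (n + r)\<close>, on which \<open>\<eta>\<close> is the identity.\<close>

lemma cone_boundary:
  assumes l: "l < n" "l + r = Suc q" and z: "z \<in> carrier (C (int q))" and x: "x \<in> carrier (X (Suc q))" "a (int q) z = D q x"
    and y: "y \<in> carrier (X (Suc l))" "D l y = \<eta> l x \<ominus>\<^bsub>X l\<^esub> b (int q) z"
  shows "\<exists>w\<in>carrier (C (int q + 1)). c (int q + 1) w = z"
proof -
  have idx: "int q + 1 = int (l + r)" "int q = int (l + r) - 1" unfolding l(2) by simp_all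
  have lN: "Suc q \<le> N" using l r by (simp add: N_def)
  have Uq: "U (int q + 1) = X (Suc q)" using U_nat[OF lN] by (simp add: add.commute)
  have uq: "u (int q + 1) = D q" using u_nat[OF lN] by (simp add: add.commute)
  have fq: "f (int q + 1) = \<eta> l" using f_nat[OF l(1)] idx by simp
  have Vq: "V (int q) = X l" using V_nat[OF l(1)] idx(2) by simp
  have bz: "b (int q) z \<in> carrier (X l)" using bc[OF z] Vq by simp
  have eta': "\<eta> l \<in> mod_hom R (X (Suc q)) (X l)" using eta[of l] l(2) by simp
  note ex = mod_hom_closed[OF eta' x(1)]
  show ?thesis
  proof (cases "Suc l < n")
    case True
    have Vq1: "V (int q + 1) = X (Suc l)" using V_nat[OF True] idx(1) by simp
    have vq1: "v (int q + 1) = D l" using v_nat[OF True] idx(1) by simp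
    obtain w where w: "w \<in> carrier (C (int q + 1))" "a (int q + 1) w = x" "b (int q + 1) w = y"
      using pair[of x "int q + 1" y] x y Uq Vq1 by auto
    have "c (int q + 1) w = z"
    proof (rule pair_eqI[of _ "int q"])
      show "c (int q + 1) w \<in> carrier (C (int q))" using CC(5)[OF w(1)] by simp
      show "a (int q) (c (int q + 1) w) = a (int q) z" using a_c[OF w(1)] w(2) uq x(2) by simp
      show "b (int q) (c (int q + 1) w) = b (int q) z"
        using b_c[OF w(1)] w(2,3) fq vq1 y(2) Vq left_module_minus_minus[OF lmX ex bz] by simp
    qed (rule z)
    then show ?thesis using w(1) by blast
  next
    case False
    then have n: "Suc l = n" using l by simp
    have y': "y \<in> carrier (X (Suc (Suc q)))" using y(1) periodic(1)[of n] n l(2) by (metis add_Suc order_refl)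
    have Vq1: "V (int q + 1) = zero_obj" using n l(2) N by (intro V_out) auto
    have vq1: "v (int q + 1) = (\<lambda>_. \<zero>\<^bsub>X l\<^esub>)" using n l(2) N Vq by (simp add: v_def)
    let ?x = "x \<ominus>\<^bsub>X (Suc q)\<^esub> D (Suc q) y"
    have Dy: "D (Suc q) y \<in> carrier (X (Suc q))" by (rule mod_hom_closed[OF D_hom y'])
    have xc: "?x \<in> carrier (X (Suc q))" by (rule left_module_minus(1)[OF lmX x(1) Dy])
    obtain w where w: "w \<in> carrier (C (int q + 1))" "a (int q + 1) w = ?x"
      using pair[of ?x "int q + 1" "{}"] xc Uq Vq1 by auto
    have "D q ?x = D q x"
      using mod_hom_minus[OF lmX lmX D_hom x(1) Dy] D_D[OF y'] left_module_minus(5)[OF lmX mod_hom_closed[OF D_hom x(1)] Xc] by simp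
    moreover have "\<eta> l ?x = b (int q) z"
    proof -
      have "\<eta> l (D (Suc q) y) = D l (\<eta> (Suc l) y)" using eta_D[of y l] y' l(2) by simp
      also have "\<dots> = \<eta> l x \<ominus>\<^bsub>X l\<^esub> b (int q) z" using periodic(4)[of n] n y(2) by simp
      finally show ?thesis
        using mod_hom_minus[OF lmX lmX eta' x(1) Dy] left_module_minus_minus[OF lmX ex bz] by simp
    qed
    moreover have "c (int q + 1) w \<in> carrier (C (int q))" using CC(5)[OF w(1)] by simp
    ultimately have "c (int q + 1) w = z"
      using a_c[OF w(1)] b_c[OF w(1)] w(2) uq fq vq1 x(2) Vq left_module_minus(5)[OF lmX bz Xc]
      by (rule_tac pair_eqI[of _ "int q", OF _ z]) simp_all
    then show ?thesis using w(1) by blast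
  qed
qed

lemma homology_low:
  assumes k: "Suc (Suc k) < r"
  shows "zero_mod (homology C c (int (Suc k)))"
proof (rule homology_vanishesI[OF cone])
  fix z assume z: "z \<in> carrier (C (int (Suc k)))" "c (int (Suc k)) z = \<zero>\<^bsub>C (int (Suc k) - 1)\<^esub>"
  have kN: "Suc (Suc k) \<le> N" using k N(2) by simp
  have Uk: "U (int (Suc k)) = X (Suc k)" "U (int k) = X k" "u (int (Suc k)) = D k"
    "U (int (Suc k) + 1) = X (Suc (Suc k))" "u (int (Suc k) + 1) = D (Suc k)"
    using U_nat[of "Suc k"] U_nat[of k] u_nat[of k] U_nat[OF kN] u_nat[OF kN] kN by (simp_all add: add.commute)
  have Vk: "V (int (Suc k)) = zero_obj" using k by (intro V_out) auto
  have az: "a (int (Suc k)) z \<in> carrier (X (Suc k))" using ac[OF z(1)] Uk by simp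
  have "D k (a (int (Suc k)) z) = \<zero>\<^bsub>X k\<^esub>" using cycle_a[OF z] Uk by simp
  from D_exact[OF az this] obtain y where y: "y \<in> carrier (X (Suc (Suc k)))" "D (Suc k) y = a (int (Suc k)) z" by blast
  obtain w where w: "w \<in> carrier (C (int (Suc k) + 1))" "a (int (Suc k) + 1) w = y"
    using pair[of y "int (Suc k) + 1" "\<zero>\<^bsub>V (int (Suc k) + 1)\<^esub>"] y(1) Uk left_module_basics(3)[OF UV_lm(2)] by auto
  have cw: "c (int (Suc k) + 1) w \<in> carrier (C (int (Suc k)))" using CC(5)[OF w(1)] by simp
  have "c (int (Suc k) + 1) w = z"
  proof (rule pair_eqI[OF cw z(1)])
    show "a (int (Suc k)) (c (int (Suc k) + 1) w) = a (int (Suc k)) z" using a_c[OF w(1)] w(2) Uk y(2) by simp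
    show "b (int (Suc k)) (c (int (Suc k) + 1) w) = b (int (Suc k)) z" using bc[OF cw] bc[OF z(1)] Vk by simp
  qed
  then show "\<exists>w\<in>carrier (C (int (Suc k) + 1)). c (int (Suc k) + 1) w = z" using w(1) by blast
qed

text \<open>The top degree is the case \<open>Suc m = n\<close>. There a cycle is the image of an element of \<open>X (n + r) = X n\<close> whose
  differential in the first period vanishes, and by periodicity the cycle is zero.\<close>

lemma homology_middle:
  assumes m: "m < n"
  shows "zero_mod (homology C c (int (m + r)))"
proof (rule homology_vanishesI[OF cone])
  fix z assume z: "z \<in> carrier (C (int (m + r)))" "c (int (m + r)) z = \<zero>\<^bsub>C (int (m + r) - 1)\<^esub>"
  obtain q where q: "m + r = Suc q" using r by (cases "m + r") auto
  have mN: "m + r \<le> N" using m r by (simp add: N_def)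
  have Um: "U (int (m + r)) = X (m + r)" "u (int (m + r)) = D q" "U (int (m + r) - 1) = X q"
    using U_nat[OF mN] u_nat[of q] U_nat[of q] q mN by simp_all
  have fm: "f (int (m + r)) = \<eta> m" by (rule f_nat[OF m])
  have Vm: "V (int (m + r) - 1) = X m" by (rule V_nat[OF m])
  let ?az = "a (int (m + r)) z" and ?bz = "b (int (m + r)) z"
  have az: "?az \<in> carrier (X (Suc q))" using ac[OF z(1)] Um q by simp
  have "D q ?az = \<zero>\<^bsub>X q\<^esub>" using cycle_a[OF z] Um by simp
  from D_exact[OF az this] obtain x where x: "x \<in> carrier (X (Suc (m + r)))" "D (m + r) x = ?az" using q by auto
  have eD: "D m (\<eta> (Suc m) x) = \<eta> m ?az" using eta_D[OF x(1)] x(2) by simp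
  have cb: "\<eta> m ?az = v (int (m + r)) ?bz" using cycle_b[OF z] fm by simp
  show "\<exists>w\<in>carrier (C (int (m + r) + 1)). c (int (m + r) + 1) w = z"
  proof (cases "Suc m < n")
    case True
    have Vm1: "V (int (m + r)) = X (Suc m)" using V_nat[OF True] by simp
    have bz: "?bz \<in> carrier (X (Suc m))" using bc[OF z(1)] Vm1 by simp
    have e1: "\<eta> (Suc m) \<in> mod_hom R (X (Suc (m + r))) (X (Suc m))" using eta[of "Suc m"] by simp
    note ex = mod_hom_closed[OF e1 x(1)]
    have "D m (\<eta> (Suc m) x \<ominus>\<^bsub>X (Suc m)\<^esub> ?bz) = \<zero>\<^bsub>X m\<^esub>"
      using mod_hom_minus[OF lmX lmX D_hom ex bz] eD cb v_nat[OF True]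
        left_module_minus(3)[OF lmX mod_hom_closed[OF D_hom bz] mod_hom_closed[OF D_hom bz]] by simp
    from D_exact[OF left_module_minus(1)[OF lmX ex bz] this] obtain y
      where y: "y \<in> carrier (X (Suc (Suc m)))" "D (Suc m) y = \<eta> (Suc m) x \<ominus>\<^bsub>X (Suc m)\<^esub> ?bz" by blast
    show ?thesis by (rule cone_boundary[OF True _ z(1) x(1) x(2)[symmetric] y]) simp
  next
    case False
    then have n: "Suc m = n" using m by simp
    have "v (int (m + r)) ?bz = \<zero>\<^bsub>X m\<^esub>" using n N Vm by (simp add: v_def)
    then have "D m x = \<zero>\<^bsub>X m\<^esub>" using eD cb periodic(4)[of n] n by simp
    moreover have Xn: "X (Suc m + r) = X (Suc m)" "K (Suc m + r) = K (Suc m)" "p (Suc m + r) = p (Suc m)"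
      using periodic(1-3)[of n] n by simp_all
    ultimately have "p (Suc (m + r)) x = \<zero>\<^bsub>K (Suc (m + r))\<^esub>"
      using x(1) D_zero_iff[of x m] by simp
    then have "?az = \<zero>\<^bsub>X (m + r)\<^esub>" using D_zero_iff[OF x(1)] x(2) by simp
    moreover have "V (int (m + r)) = zero_obj" using n N by (intro V_out) auto
    ultimately have "z = \<zero>\<^bsub>C (int (m + r))\<^esub>"
      using a_zero[of "int (m + r)"] b_zero[of "int (m + r)"] bc[OF z(1)] Um
      by (rule_tac pair_eqI[OF z(1) left_module_basics(3)[OF CC(2)]]) simp_all
    then have "c (int (m + r) + 1) \<zero>\<^bsub>C (int (m + r) + 1)\<^esub> = z"
      using mod_hom_zero[OF CC(2) CC(2) CC(3), of "int (m + r) + 1"] by simp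
    then show ?thesis using left_module_basics(3)[OF CC(2)] by blast
  qed
qed

lemma homology_bottom: "mod_iso R (homology C c 0) (mod_power (K 0) 1)"
proof (rule homology_isoI[OF cone s(3)])
  have N1: "Suc 0 \<le> N" using N(2) r by simp
  have U0: "U 0 = X 0" "U 1 = X (Suc 0)" "u 1 = D 0" "V 0 = zero_obj"
    using U_nat[of 0] U_nat[OF N1] u_nat[OF N1] V_out[of 0] r by simp_all
  let ?F = "\<lambda>z. p 0 (a 0 z)"
  have a0: "a 0 \<in> mod_hom R (C 0) (X 0)" using a[of 0] U0 by simp
  have F: "?F \<in> mod_hom R (C 0) (K 0)" by (rule mod_hom_compose[OF a0 s(6)])
  have cyc: "carrier (cycles C c 0) = carrier (C 0)"
  proof -
    have "zero_mod (C (0 - 1))" using U_out[of "- 1"] V_out[of "- 1"] r by (intro cone_zero_mod) simp_all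
    then have "c 0 z = \<zero>\<^bsub>C (0 - 1)\<^esub>" if "z \<in> carrier (C 0)" for z
      using CC(5)[OF that] by (simp add: zero_mod_def)
    then show ?thesis by (auto simp: a_kernel_def')
  qed
  show "?F \<in> mod_hom R (cycles C c 0) (K 0)"
    unfolding cycles_def by (rule mod_hom_sub_source[OF F]) (auto simp: a_kernel_def')
  show "?F ` carrier (cycles C c 0) = carrier (K 0)"
  proof (unfold cyc, intro equalityI subsetI)
    fix m assume "m \<in> carrier (K 0)"
    then obtain x where x: "x \<in> carrier (X 0)" "m = p 0 x" using s(13) by blast
    then obtain z where "z \<in> carrier (C 0)" "a 0 z = x" using pair[of x 0 "{}"] U0 by auto
    then show "m \<in> ?F ` carrier (C 0)" using x(2) by blast
  qed (use mod_hom_closed[OF F] in blast)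
  show "\<exists>w\<in>carrier (C (0 + 1)). c (0 + 1) w = z" if z: "z \<in> carrier (cycles C c 0)" "?F z = \<zero>\<^bsub>K 0\<^esub>" for z
  proof -
    have zC: "z \<in> carrier (C 0)" using z(1) cyc by blast
    obtain y where y: "y \<in> carrier (X (Suc 0))" "D 0 y = a 0 z" using p_exact[OF mod_hom_closed[OF a0 zC] z(2)] by blast
    obtain w where w: "w \<in> carrier (C 1)" "a 1 w = y"
      using pair[of y 1 "\<zero>\<^bsub>V 1\<^esub>"] y(1) U0 left_module_basics(3)[OF UV_lm(2)] by auto
    have cw: "c 1 w \<in> carrier (C 0)" using CC(5)[OF w(1)] by simp
    have "c 1 w = z"
      using a_c[OF w(1)] w(2) U0 y(2) bc[OF cw] bc[OF zC] by (rule_tac pair_eqI[OF cw zC]) simp_all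
    then show ?thesis using w(1) by auto
  qed
  show "?F (c (0 + 1) w) = \<zero>\<^bsub>K 0\<^esub>" if "w \<in> carrier (C (0 + 1))" for w
    using that a_c[of w 1] U0 ac[of w 1] p_D[of "a 1 w" 0] by simp
qed

text \<open>The cycles in this degree are the pairs of an element of the syzygy \<open>K r\<close> and an element of \<open>X 0\<close>. If \<open>\<theta>\<close> is
  the map from \<open>K r\<close> to \<open>K 0\<close> that \<open>\<eta>\<close> induces, then \<open>(x, y) \<mapsto> \<theta> x - p 0 y\<close> is surjective, and its kernel
  consists of the boundaries. For \<open>n = 0\<close> the second component is absent, but then \<open>\<theta>\<close> is the identity.\<close>

lemma homology_upper:
  assumes rq: "r = Suc q"
  shows "mod_iso R (homology C c (int q)) (mod_power (K 0) 1)"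
proof -
  obtain q' where q': "q = Suc q'" using r rq by (cases q) auto
  have qN: "q \<le> N" using N(2) rq by simp
  have Uq: "U (int q) = X q" "u (int q) = D q'" "U (int q - 1) = X q'"
    using U_nat[OF qN] u_nat[of q'] U_nat[of q'] q' qN by simp_all
  have Vq: "V (int q) = X 0" if "0 < n" using V_nat[OF that] rq by simp
  have Vq0: "V (int q) = zero_obj" if "n = 0" using that N(1) rq by (intro V_out) auto
  have Vq1: "V (int q - 1) = zero_obj" using rq by (intro V_out) auto
  note Z = cycles_left_module[OF cone, of "int q"]
  have Zc: "z \<in> carrier (C (int q))" "c (int q) z = \<zero>\<^bsub>C (int q - 1)\<^esub>" if "z \<in> carrier (cycles C c (int q))" for z
    using that by (auto simp: a_kernel_def')
  have Zsub: "carrier (cycles C c (int q)) \<subseteq> carrier (C (int q))" using Zc(1) by blast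
  have subZ: "g \<in> mod_hom R (cycles C c (int q)) Q" if "g \<in> mod_hom R (C (int q)) Q" for g and Q :: "'a fgm"
    using mod_hom_sub_source[OF that Zsub] by (simp add: cycles_def)
  have aq: "a (int q) \<in> mod_hom R (C (int q)) (X q)" using a[of "int q"] Uq by simp
  have e0: "\<eta> 0 \<in> mod_hom R (X r) (X 0)" using eta[of 0] by simp
  have "p 0 (\<eta> 0 (j r y)) = \<zero>\<^bsub>K 0\<^esub>" if y: "y \<in> carrier (K (Suc r))" for y
  proof -
    obtain x where x: "x \<in> carrier (X (Suc r))" "y = p (Suc r) x" using s(13)[OF y] by blast
    have "\<eta> 1 x \<in> carrier (X 1)" using mod_hom_closed[OF eta[of 1]] x(1) by simp
    moreover have "\<eta> 0 (j r y) = D 0 (\<eta> 1 x)" using eta_D[of x 0] x by (simp add: D_def)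
    ultimately show ?thesis using p_D[of "\<eta> 1 x" 0] by simp
  qed
  from ses_factor[OF ses s(3) mod_hom_compose[OF e0 s(6)] this] obtain \<theta>
    where \<theta>: "\<theta> \<in> mod_hom R (K r) (K 0)" "\<forall>x\<in>carrier (X r). \<theta> (p r x) = p 0 (\<eta> 0 x)" by blast
  have "a (int q) ` carrier (cycles C c (int q)) \<subseteq> j q ` carrier (K (Suc q))"
  proof
    fix x assume "x \<in> a (int q) ` carrier (cycles C c (int q))"
    then obtain z where z: "z \<in> carrier (cycles C c (int q))" "x = a (int q) z" by blast
    have x: "x \<in> carrier (X (Suc q'))" using mod_hom_closed[OF aq Zc(1)[OF z(1)]] z(2) q' by simp
    have "D q' x = \<zero>\<^bsub>X q'\<^esub>" using cycle_a[OF Zc[OF z(1)]] Uq z(2) by simp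
    then have "p q x = \<zero>\<^bsub>K q\<^esub>" using D_zero_iff[OF x] q' by simp
    then show "x \<in> j q ` carrier (K (Suc q))" using s(11)[of x q] x q' by auto
  qed
  from mod_hom_corestrict[OF s(1) lmX s(4,5) subZ[OF aq] this Z]
  obtain \<zeta> where \<zeta>: "\<zeta> \<in> mod_hom R (cycles C c (int q)) (K r)"
    "\<forall>z\<in>carrier (cycles C c (int q)). j q (\<zeta> z) = a (int q) z" unfolding rq by blast
  have \<zeta>_eq: "\<zeta> z = y" if "z \<in> carrier (cycles C c (int q))" "y \<in> carrier (K r)" "a (int q) z = j q y" for z y
    using inj_onD[OF s(5)[of q], of "\<zeta> z" y] \<zeta>(2) mod_hom_closed[OF \<zeta>(1) that(1)] that rq by auto
  define \<epsilon> where "\<epsilon> = (if n = 0 then (\<lambda>_. \<zero>\<^bsub>K 0\<^esub>) else p 0)"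
  have \<epsilon>: "\<epsilon> \<in> mod_hom R (V (int q)) (K 0)"
  proof (cases "n = 0")
    case True
    then have "\<epsilon> = (\<lambda>_. \<zero>\<^bsub>K 0\<^esub>)" by (simp add: \<epsilon>_def)
    then show ?thesis by (simp only: zero_in_mod_hom[OF s(3)])
  next
    case False then show ?thesis using s(6)[of 0] Vq by (simp add: \<epsilon>_def)
  qed
  let ?F = "\<lambda>z. \<theta> (\<zeta> z) \<ominus>\<^bsub>K 0\<^esub> \<epsilon> (b (int q) z)"
  note \<theta>\<zeta> = mod_hom_compose[OF \<zeta>(1) \<theta>(1)] and \<epsilon>b = subZ[OF mod_hom_compose[OF b \<epsilon>]]
  have F: "?F \<in> mod_hom R (cycles C c (int q)) (K 0)" by (rule mod_hom_diff[OF s(3) \<theta>\<zeta> \<epsilon>b])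
  have \<theta>0: "\<theta> \<zero>\<^bsub>K r\<^esub> = \<zero>\<^bsub>K 0\<^esub>" by (rule mod_hom_zero[OF s(3) s(3) \<theta>(1)])
  have n0: "\<theta> y = y" "K r = K 0" if n: "n = 0" and y: "y \<in> carrier (K r)" for y
  proof -
    have per: "X r = X 0" "K r = K 0" "p r = p 0" "\<eta> 0 = (\<lambda>x. x)" using periodic[of 0] n by simp_all
    obtain x where "x \<in> carrier (X r)" "y = p r x" using s(13)[OF y] by blast
    then show "\<theta> y = y" "K r = K 0" using \<theta>(2) per by auto
  qed
  have Kr: "K r = K 0" if "n = 0" using periodic(2)[of 0] that by simp
  have cyc: "z \<in> carrier (cycles C c (int q))" if z: "z \<in> carrier (C (int q))" "D q' (a (int q) z) = \<zero>\<^bsub>X q'\<^esub>" for z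
  proof -
    have cz: "c (int q) z \<in> carrier (C (int q - 1))" by (rule CC(5)[OF z(1)])
    have "c (int q) z = \<zero>\<^bsub>C (int q - 1)\<^esub>"
      using a_c[OF z(1)] z(2) Uq a_zero[of "int q - 1"] b_zero[of "int q - 1"] bc[OF cz] Vq1
      by (rule_tac pair_eqI[OF cz left_module_basics(3)[OF CC(2)]]) simp_all
    then show ?thesis using z(1) by (simp add: a_kernel_def')
  qed
  show ?thesis
  proof (rule homology_isoI[OF cone s(3) F])
    show "?F ` carrier (cycles C c (int q)) = carrier (K 0)"
    proof (intro equalityI subsetI)
      fix m assume m: "m \<in> carrier (K 0)"
      show "m \<in> ?F ` carrier (cycles C c (int q))"
      proof (cases "n = 0")
        case True
        have m': "m \<in> carrier (K (Suc q))" using m Kr[OF True] rq by simp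
        obtain z where z: "z \<in> carrier (C (int q))" "a (int q) z = j q m"
          using pair[of "j q m" "int q" "{}"] Uq Vq0[OF True] s(10)[OF m'] by auto
        have "D q' (j q m) = \<zero>\<^bsub>X q'\<^esub>" using s(9)[OF m'] j_zero[of q'] q' by (simp add: D_def)
        then have zc: "z \<in> carrier (cycles C c (int q))" using z by (intro cyc) simp_all
        have "\<zeta> z = m" using zc m' z(2) rq by (intro \<zeta>_eq) simp_all
        then have "?F z = m" using n0[OF True, of m] m' rq left_module_minus(5)[OF s(3) m left_module_basics(3)[OF s(3)]] True
          by (simp add: \<epsilon>_def)
        then show ?thesis using zc by (rule_tac image_eqI[of _ _ z]) simp_all
      next
        case False
        obtain x where x: "x \<in> carrier (X 0)" "m = p 0 x" using s(13)[OF m] by blast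
        have x0: "\<zero>\<^bsub>X 0\<^esub> \<ominus>\<^bsub>X 0\<^esub> x \<in> carrier (X 0)" by (rule left_module_minus(1)[OF lmX Xc x(1)])
        obtain z where z: "z \<in> carrier (C (int q))" "a (int q) z = \<zero>\<^bsub>X q\<^esub>" "b (int q) z = \<zero>\<^bsub>X 0\<^esub> \<ominus>\<^bsub>X 0\<^esub> x"
          using pair[of "\<zero>\<^bsub>X q\<^esub>" "int q" "\<zero>\<^bsub>X 0\<^esub> \<ominus>\<^bsub>X 0\<^esub> x"] Uq Vq False x0 Xc by auto
        have "D q' \<zero>\<^bsub>X q\<^esub> = \<zero>\<^bsub>X q'\<^esub>" using mod_hom_zero[OF lmX lmX D_hom[of q']] q' by simp
        then have zc: "z \<in> carrier (cycles C c (int q))" using z by (intro cyc) simp_all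
        have "\<zeta> z = \<zero>\<^bsub>K r\<^esub>" using zc z(2) j_zero[of q] rq left_module_basics(3)[OF s(3)] by (intro \<zeta>_eq) simp_all
        then have "?F z = m"
          using \<theta>0 z(3) False mod_hom_minus[OF lmX s(3) s(6) Xc x(1)] mod_hom_zero[OF lmX s(3) s(6), of 0] x(2)
            left_module_minus_minus[OF s(3) left_module_basics(3)[OF s(3)] m] by (simp add: \<epsilon>_def)
        then show ?thesis using zc by (rule_tac image_eqI[of _ _ z]) simp_all
      qed
    qed (use mod_hom_closed[OF F] in blast)
    show "\<exists>w\<in>carrier (C (int q + 1)). c (int q + 1) w = z"
      if z: "z \<in> carrier (cycles C c (int q))" "?F z = \<zero>\<^bsub>K 0\<^esub>" for z
    proof -
      note zC = Zc(1)[OF z(1)]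
      have eq: "\<theta> (\<zeta> z) = \<epsilon> (b (int q) z)"
        using z(2) left_module_minus(3)[OF s(3) mod_hom_closed[OF \<theta>\<zeta> z(1)] mod_hom_closed[OF \<epsilon>b z(1)]] by simp
      note \<zeta>c = mod_hom_closed[OF \<zeta>(1) z(1)]
      show ?thesis
      proof (cases "n = 0")
        case True
        have "\<zeta> z = \<zero>\<^bsub>K r\<^esub>" using eq n0[OF True \<zeta>c] True by (simp add: \<epsilon>_def)
        then have "a (int q) z = \<zero>\<^bsub>X q\<^esub>" using bspec[OF \<zeta>(2) z(1)] j_zero[of q] rq by simp
        then have "z = \<zero>\<^bsub>C (int q)\<^esub>"
          using a_zero[of "int q"] b_zero[of "int q"] bc[OF zC] Vq0[OF True] Uq
          by (rule_tac pair_eqI[OF zC left_module_basics(3)[OF CC(2)]]) simp_all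
        then have "c (int q + 1) \<zero>\<^bsub>C (int q + 1)\<^esub> = z"
          using mod_hom_zero[OF CC(2) CC(2) CC(3), of "int q + 1"] by simp
        then show ?thesis using left_module_basics(3)[OF CC(2)] by blast
      next
        case False
        then have n: "0 < n" by simp
        obtain x where x: "x \<in> carrier (X r)" "\<zeta> z = p r x" using s(13)[OF \<zeta>c] by blast
        have bz: "b (int q) z \<in> carrier (X 0)" using bc[OF zC] Vq[OF n] by simp
        note ex = mod_hom_closed[OF e0 x(1)]
        have "p 0 (\<eta> 0 x) = p 0 (b (int q) z)" using eq x \<theta>(2) False by (simp add: \<epsilon>_def)
        then have "p 0 (\<eta> 0 x \<ominus>\<^bsub>X 0\<^esub> b (int q) z) = \<zero>\<^bsub>K 0\<^esub>"
          using mod_hom_minus[OF lmX s(3) s(6) ex bz] left_module_minus(3)[OF s(3) s(12)[OF bz] s(12)[OF bz]] by simp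
        from p_exact[OF left_module_minus(1)[OF lmX ex bz] this]
        obtain y where y: "y \<in> carrier (X (Suc 0))" "D 0 y = \<eta> 0 x \<ominus>\<^bsub>X 0\<^esub> b (int q) z" by blast
        have "a (int q) z = D q x" using bspec[OF \<zeta>(2) z(1)] x(2) rq by (simp add: D_def)
        then show ?thesis using x(1) rq by (intro cone_boundary[OF n _ zC _ _ y]) simp_all
      qed
    qed
    show "?F (c (int q + 1) w) = \<zero>\<^bsub>K 0\<^esub>" if w: "w \<in> carrier (C (int q + 1))" for w
    proof -
      have cw: "c (int q + 1) w \<in> carrier (C (int q))" using CC(5)[OF w] by simp
      have "c (int q) (c (int q + 1) w) = \<zero>\<^bsub>C (int q - 1)\<^esub>" using CC(4)[OF w] by simp
      then have cwZ: "c (int q + 1) w \<in> carrier (cycles C c (int q))" using cw by (simp add: a_kernel_def')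
      have acw: "a (int q) (c (int q + 1) w) = u (int q + 1) (a (int q + 1) w)" using a_c[OF w] by simp
      note K0 = left_module_basics(3)[OF s(3), of 0]
      show ?thesis
      proof (cases "n = 0")
        case True
        have "int N = int q" using True N(1) rq by simp
        then have "u (int q + 1) = (\<lambda>_. \<zero>\<^bsub>X q\<^esub>)" using Uq(1) by (simp add: u_def)
        then have "\<zeta> (c (int q + 1) w) = \<zero>\<^bsub>K r\<^esub>"
          using acw j_zero[of q] rq left_module_basics(3)[OF s(3)] by (intro \<zeta>_eq[OF cwZ]) simp_all
        then show ?thesis using \<theta>0 True left_module_minus(3)[OF s(3) K0 K0] by (simp add: \<epsilon>_def)
      next
        case False
        then have n: "0 < n" by simp
        have rN: "r \<le> N" using n N(1) by linarith
        have U1: "U (int q + 1) = X r" "u (int q + 1) = D q" "f (int q + 1) = \<eta> 0"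
          using U_nat[OF rN] u_nat[of q] rN f_nat[OF n] rq by (simp_all add: add.commute)
        have aw: "a (int q + 1) w \<in> carrier (X r)" using ac[OF w] U1 by simp
        have z: "\<zeta> (c (int q + 1) w) = p r (a (int q + 1) w)"
          using acw U1 s(12)[OF aw] rq by (intro \<zeta>_eq[OF cwZ]) (simp_all add: D_def)
        have vb: "v (int q + 1) (b (int q + 1) w) \<in> carrier (X 0)" "p 0 (v (int q + 1) (b (int q + 1) w)) = \<zero>\<^bsub>K 0\<^esub>"
        proof -
          show "v (int q + 1) (b (int q + 1) w) \<in> carrier (X 0)"
            using mod_hom_closed[OF v_hom bc[OF w]] Vq[OF n] by simp
          show "p 0 (v (int q + 1) (b (int q + 1) w)) = \<zero>\<^bsub>K 0\<^esub>"
          proof (cases "Suc 0 < n")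
            case True
            have "v (int q + 1) = D 0" using v_nat[OF True] rq by (simp add: add.commute)
            moreover have "V (int q + 1) = X (Suc 0)" using V_nat[OF True] rq by (simp add: add.commute)
            ultimately show ?thesis using p_D[of "b (int q + 1) w" 0] bc[OF w] by simp
          next
            case False
            then have "int N = int q + 1" using n N(1) rq by simp
            then have "v (int q + 1) = (\<lambda>_. \<zero>\<^bsub>X 0\<^esub>)" using Vq[OF n] by (simp add: v_def)
            then show ?thesis using mod_hom_zero[OF lmX s(3) s(6), of 0] by simp
          qed
        qed
        note ew = mod_hom_closed[OF e0 aw]
        have "p 0 (b (int q) (c (int q + 1) w)) = p 0 (\<eta> 0 (a (int q + 1) w))"
          using b_c[OF w] U1 Vq[OF n] mod_hom_minus[OF lmX s(3) s(6) ew vb(1)] vb(2)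
            left_module_minus(5)[OF s(3) s(12)[OF ew] K0] by simp
        then show ?thesis
          using z \<theta>(2) aw n left_module_minus(3)[OF s(3) s(12)[OF ew] s(12)[OF ew]] by (simp add: \<epsilon>_def)
      qed
    qed
  qed
qed

lemma cone_quasi_projective_resolution:
  assumes nz: "\<not> zero_mod (K 0)"
  shows "quasi_proj_resolution R (K 0) C c \<and> sup_cpx C < \<infinity> \<and> sup_cpx C - hsup_cpx C c \<le> ereal (real n)"
proof -
  obtain q where q: "r = Suc q" using r by (cases r) auto
  have q0: "0 < q" using q r by simp
  have Cout: "zero_mod (C i)" if "i < 0 \<or> int N < i" for i
    using that r N by (intro cone_zero_mod U_out V_out) auto
  define m where "m i = (if i = 0 \<or> i = int q then 1 else 0 :: nat)" for i
  have hom: "mod_iso R (homology C c i) (mod_power (K 0) (m i))" for i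
  proof -
    consider "i < 0 \<or> int N < i" | "i = 0" | "0 < i" "i < int q" | "i = int q" | "int q < i" "i \<le> int N" by linarith
    then show ?thesis
    proof cases
      case 1
      then have "m i = 0" using N q by (auto simp: m_def)
      then show ?thesis using mod_iso_power_zero[OF zero_mod_homology[OF cone Cout[OF 1]]] by simp
    next
      case 2 then show ?thesis using homology_bottom by (simp add: m_def)
    next
      case 3
      define k where "k = nat (i - 1)"
      have k: "i = int (Suc k)" using 3 by (simp add: k_def)
      have "Suc (Suc k) < r" using 3 k q by simp
      from mod_iso_power_zero[OF homology_low[OF this]] show ?thesis using 3 k by (simp add: m_def)
    next
      case 4 then show ?thesis using homology_upper[OF q] by (simp add: m_def)
    next
      case 5
      define k where "k = nat (i - int r)"
      have k: "i = int (k + r)" using 5 q by (simp add: k_def)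
      then have "k < n" using 5 N(1) by simp
      from mod_iso_power_zero[OF homology_middle[OF this]] show ?thesis using 5 k q0 by (simp add: m_def)
    qed
  qed
  have hq: "\<not> zero_mod (homology C c (int q))"
  proof
    assume z: "zero_mod (homology C c (int q))"
    have "mod_iso R (homology C c (int q)) (mod_power (K 0) (Suc 0))" using hom[of "int q"] by (simp add: m_def)
    from mod_power_retract[OF s(3) homology_left_module[OF cone] _ this]
    show False using zero_mod_retract[OF s(3) homology_left_module[OF cone] z] nz by blast
  qed
  then have Cq: "\<not> zero_mod (C (int q))" using zero_mod_homology[OF cone] by blast
  have sup: "sup_cpx C \<le> ereal (of_int (int N))"
    unfolding sup_cpx_def using Cout by (intro SUP_least) force
  have hsup: "ereal (of_int (int q)) \<le> hsup_cpx C c"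
    unfolding hsup_cpx_def using hq by (intro SUP_upper) simp
  have "0 \<le> inf_cpx C" unfolding inf_cpx_def using Cout by (intro INF_greatest) force
  then have inf: "inf_cpx C > - \<infinity>" by (metis less_ereal.simps(4) less_le_trans MInfty_neq_ereal(1) ereal_infty_less(2) zero_ereal_def)
  have inf_q: "inf_cpx C \<le> ereal (of_int (int q))" unfolding inf_cpx_def using Cq by (intro INF_lower) simp
  have "sup_cpx C - hsup_cpx C c \<le> ereal (of_int (int N)) - ereal (of_int (int q))"
    by (rule ereal_minus_mono[OF sup hsup])
  also have "\<dots> = ereal (real n)" using N(1) q by (simp add: N_def)
  finally have le: "sup_cpx C - hsup_cpx C c \<le> ereal (real n)" .
  have "\<exists>i. inf_cpx C \<le> ereal (of_int i) \<and> m i \<noteq> 0" using inf_q by (intro exI[of _ "int q"]) (simp add: m_def)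
  then have "quasi_proj_resolution R (K 0) C c"
    unfolding quasi_proj_resolution_def proj_obj_iff
    using cone C_proj[OF UV_proj] inf hom by blast
  then show ?thesis using le sup by (auto intro: le_less_trans)
qed

end

lemma (in periodic_resolution) qpd_le: "qpd R (K 0) \<le> ereal (real n)"
proof (cases "zero_mod (K 0)")
  case True then show ?thesis by (simp add: qpd_def)
next
  case False
  show ?thesis
  proof (rule mapping_cone[where R = R and U = U and u = u and V = V and v = v and f = f, OF U_complex V_complex f_hom f_comm])
    fix C :: "int \<Rightarrow> 'a fgm" and c a b
    assume C: "mod_complex R C c" "\<And>i. a i \<in> mod_hom R (C i) (U i)" "\<And>i. b i \<in> mod_hom R (C i) (V i)"
      "\<And>i x y. x \<in> carrier (U i) \<Longrightarrow> y \<in> carrier (V i) \<Longrightarrow> \<exists>z\<in>carrier (C i). a i z = x \<and> b i z = y"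
      "\<And>i z z'. z \<in> carrier (C i) \<Longrightarrow> z' \<in> carrier (C i) \<Longrightarrow> a i z = a i z' \<Longrightarrow> b i z = b i z' \<Longrightarrow> z = z'"
      "\<And>i z. z \<in> carrier (C i) \<Longrightarrow> a (i - 1) (c i z) = u i (a i z)"
      "\<And>i z. z \<in> carrier (C i) \<Longrightarrow> b (i - 1) (c i z) = f i (a i z) \<ominus>\<^bsub>V (i - 1)\<^esub> v i (b i z)"
      "\<And>i. dualizable R (U i) \<Longrightarrow> dualizable R (V i) \<Longrightarrow> dualizable R (C i)"
    interpret periodic_cone R K X j p \<eta> r n C c a b
      by (intro periodic_cone.intro periodic_cone_axioms.intro periodic_resolution_axioms) (fact C)+
    from cone_quasi_projective_resolution[OF False]
    have "Inf {sup_cpx X - hsup_cpx X d | X d. quasi_proj_resolution R (K 0) X d \<and> sup_cpx X < \<infinity>} \<le> ereal (real n)"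
      by (intro Inf_lower2[of "sup_cpx C - hsup_cpx C c"]) auto
    then show ?thesis using False by (simp add: qpd_def)
  qed
qed

section \<open>Existence of periodic resolutions\<close>

text \<open>The \<open>n\<close>-th syzygy \<open>G\<close> of \<open>M\<close> is Gorenstein projective, hence periodic, and a period of it is repeated
  forever. The identity of the periodic part is extended downwards to \<open>\<eta>\<close>: in each degree the
  obstruction lies in the \<open>Ext\<close> of degree one from a syzygy of order at least \<open>r\<close> to a projective module,
  and this vanishes because \<open>r \<ge> n\<close>.\<close>

lemma (in gorenstein_ring) periodic_resolution_exists:
  assumes per: "\<And>G. Gproj R G \<Longrightarrow> periodic_mod R G" and M: "fg_module R (M :: 'a fgm)"
  shows "\<exists>K X j p \<eta> r. periodic_resolution R K X j p \<eta> r n \<and> K 0 = M"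
proof -
  obtain Kp :: "nat \<Rightarrow> 'a fgm" and jp and Pp :: "nat \<Rightarrow> 'a fgm" and pp where res: "Kp 0 = M" "\<And>t. fg_module R (Kp t)"
    "\<And>t. dualizable R (Pp t)" "\<And>t. ses R (Kp (Suc t)) (jp t) (Pp t) (pp t) (Kp t)" "\<And>t. n \<le> t \<Longrightarrow> perp (Kp t)"
    by (rule resolution[OF M]) (rule that)
  define G where "G = Kp n"
  have G: "perp G" unfolding G_def by (rule res(5)) simp
  from per[OF perp_Gproj[OF G]] obtain l :: nat and C :: "int \<Rightarrow> 'a fgm" and c where l: "1 \<le> l"
    and C: "exact_complex R C c" "C (- 1) = G" "C (int l) = G"
    and C_proj: "\<forall>i. 0 \<le> i \<and> i < int l \<longrightarrow> proj_obj R (C i)"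
    and C_zero: "\<forall>i. i < - 1 \<or> int l < i \<longrightarrow> zero_mod (C i)"
    unfolding periodic_mod_def by (elim exE conjE) (rule that)
  note CC = mod_complexD[OF exact_complexD(1)[OF C(1)]]
  define kk where "kk s = (if s = 0 then G else cycles C c (int s - 1))" for s
  define jj where "jj s = (if Suc s = l then c (int l) else (\<lambda>x. x))" for s
  have kk: "kk s = cycles C c (int s - 1)" for s
  proof (cases "s = 0")
    case True
    have "carrier (C (- 2)) = {\<zero>\<^bsub>C (- 2)\<^esub>}" using C_zero by (simp add: zero_mod_def)
    then have "c (- 1) x = \<zero>\<^bsub>C (- 2)\<^esub>" if "x \<in> carrier (C (- 1))" for x using CC(5)[OF that] by simp
    then have "a_kernel (C (- 1)) (C (- 1 - 1)) (c (- 1)) = carrier (C (- 1))" by (auto simp: a_kernel_def')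
    then have "cycles C c (- 1) = C (- 1)" unfolding cycles_def by simp
    then show ?thesis using True C(2) by (simp add: kk_def)
  qed (simp add: kk_def)
  have ses_C: "ses R (kk (Suc s mod l)) (jj s) (C (int s)) (c (int s)) (kk s)" if s: "s < l" for s
  proof (cases "Suc s = l")
    case False
    then have "Suc s mod l = Suc s" using s by simp
    then show ?thesis using ses_cycles[OF C(1), of "int s"] False kk[of s] kk[of "Suc s"] by (simp add: jj_def)
  next
    case True
    note z = sesD[OF ses_cycles[OF C(1), of "int s"]]
    have il: "int l = int s + 1" using True by simp
    have cl: "c (int l) \<in> mod_hom R G (C (int s))" using CC(3)[of "int l"] C(3) il by simp
    have "inj_on (c (int l)) (carrier G)"
    proof (rule inj_mod_homI[OF fg_moduleD[OF perpD(1)[OF G]] CC(2) cl])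
      fix x assume "x \<in> carrier G" "c (int l) x = \<zero>\<^bsub>C (int s)\<^esub>"
      then obtain y where y: "y \<in> carrier (C (int l + 1))" "c (int l + 1) y = x"
        using exact_complexD(2)[OF C(1), of x "int l"] C(3) il by auto
      have "y = \<zero>\<^bsub>C (int l + 1)\<^esub>" using y(1) C_zero by (simp add: zero_mod_def)
      then show "x = \<zero>\<^bsub>G\<^esub>" using y(2) mod_hom_zero[OF CC(2) CC(2) CC(3), of "int l + 1"] C(3) by simp
    qed
    moreover have "c (int l) ` carrier G = a_kernel (C (int s)) (cycles C c (int s - 1)) (c (int s))"
    proof -
      have "c (int s + 1) ` carrier (C (int s + 1)) = a_kernel (C (int s)) (C (int s - 1)) (c (int s))"
        using C(1) by (simp add: exact_complex_def)
      then show ?thesis using C(3) il by (simp add: a_kernel_def')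
    qed
    ultimately have "ses R G (c (int l)) (C (int s)) (c (int s)) (cycles C c (int s - 1))"
      unfolding ses_def using z(2,3,6,7) cl fg_moduleD[OF perpD(1)[OF G]] by simp
    then show ?thesis using True kk[of s] by (simp add: jj_def kk_def[of 0])
  qed
  define \<rho> where "\<rho> t = (t - n) mod l" for t
  define K where "K t = (if t < n then Kp t else kk (\<rho> t))" for t
  define X where "X t = (if t < n then Pp t else C (int (\<rho> t)))" for t
  define j where "j t = (if t < n then jp t else jj (\<rho> t))" for t
  define p where "p t = (if t < n then pp t else c (int (\<rho> t)))" for t
  have s: "ses R (K (Suc t)) (j t) (X t) (p t) (K t)" for t
  proof (cases "t < n")
    case True
    have "K (Suc t) = Kp (Suc t)"
    proof (cases "Suc t < n")
      case False
      then have "Suc t = n" using True by simp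
      then show ?thesis by (simp add: K_def \<rho>_def kk_def G_def)
    qed (simp add: K_def)
    then show ?thesis using res(4)[of t] True by (simp add: K_def X_def j_def p_def)
  next
    case False
    have "\<rho> (Suc t) = Suc (\<rho> t) mod l" using False by (simp add: \<rho>_def Suc_diff_le mod_Suc_eq)
    moreover have "\<rho> t < l" using l by (simp add: \<rho>_def)
    ultimately show ?thesis using ses_C[of "\<rho> t"] False by (simp add: K_def X_def j_def p_def)
  qed
  have proj: "dualizable R (X t)" for t
  proof (cases "t < n")
    case False
    have "\<rho> t < l" using l by (simp add: \<rho>_def)
    then show ?thesis using C_proj False by (simp add: X_def proj_obj_iff)
  qed (simp add: X_def res(3))
  have fgK: "fg_module R (K t)" for t by (rule ses_fg(2)[OF noeth s dualizable_fg[OF proj]])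
  have perpK: "perp (K t)" if "n \<le> t" for t
    using that
  proof (induction t rule: dec_induct)
    case base show ?case using G by (simp add: K_def \<rho>_def kk_def)
  next
    case (step t) show ?case by (rule perp_syzygy[OF s proj fgK step.IH])
  qed
  \<comment> \<open>a multiple of the period \<open>l\<close> that is at least \<open>2\<close> and at least \<open>n\<close>\<close>
  define r where "r = l * (n + 2)"
  have r: "2 \<le> r" "n \<le> r"
  proof -
    have "1 * (n + 2) \<le> r" unfolding r_def using l by (rule mult_le_mono1)
    then show "2 \<le> r" "n \<le> r" by simp_all
  qed
  have \<rho>: "\<rho> (t + r) = \<rho> t" if "n \<le> t" for t
  proof -
    have "t + r - n = (t - n) + l * (n + 2)" using that by (simp add: r_def)
    then show ?thesis by (simp only: \<rho>_def mod_mult_self2)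
  qed
  have per: "X (t + r) = X t" "K (t + r) = K t" "p (t + r) = p t" "j (t + r) = j t" if "n \<le> t" for t
    using that \<rho>[OF that] by (simp_all add: X_def K_def p_def j_def)
  note s' = sesD[OF s] and lmX = dualizableD[OF proj]
  have DD: "(\<lambda>x. j t (p (Suc t) x)) \<in> mod_hom R (X (Suc t)) (X t)" for t by (rule mod_hom_compose[OF s'(6) s'(4)])
  have jp0: "j t (p (Suc t) (j (Suc t) y)) = \<zero>\<^bsub>X t\<^esub>" if "y \<in> carrier (K (Suc (Suc t)))" for t y
    using s'(9)[OF that] mod_hom_zero[OF s'(1,2,4), of t] by simp
  \<comment> \<open>extend the identity of the periodic part downwards, one degree at a time\<close>
  have "\<exists>\<eta>. (\<forall>t\<ge>n - m. \<eta> t \<in> mod_hom R (X (t + r)) (X t)) \<and> (\<forall>t\<ge>n. \<eta> t = (\<lambda>x. x)) \<and>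
    (\<forall>t\<ge>n - m. \<forall>x\<in>carrier (X (Suc t + r)). j t (p (Suc t) (\<eta> (Suc t) x)) = \<eta> t (j (t + r) (p (Suc t + r) x)))"
    if "m \<le> n" for m
    using that
  proof (induction m)
    case 0
    have "p (Suc t + r) = p (Suc t)" if "n \<le> t" for t using per(3)[of "Suc t"] that by simp
    then show ?case using per id_in_mod_hom by (intro exI[of _ "\<lambda>_ x. x"]) auto
  next
    case (Suc m)
    then obtain \<eta> where \<eta>: "\<forall>t\<ge>n - m. \<eta> t \<in> mod_hom R (X (t + r)) (X t)" "\<forall>t\<ge>n. \<eta> t = (\<lambda>x. x)"
      "\<forall>t\<ge>n - m. \<forall>x\<in>carrier (X (Suc t + r)). j t (p (Suc t) (\<eta> (Suc t) x)) = \<eta> t (j (t + r) (p (Suc t + r) x))"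
      by auto
    define b where "b = n - Suc m"
    have b: "n - m = Suc b" "b < n" using Suc.prems by (simp_all add: b_def)
    have e: "\<eta> (Suc b) \<in> mod_hom R (X (Suc (b + r))) (X (Suc b))"
      "\<eta> (Suc (Suc b)) \<in> mod_hom R (X (Suc (Suc (b + r)))) (X (Suc (Suc b)))"
      using \<eta>(1)[rule_format, of "Suc b"] \<eta>(1)[rule_format, of "Suc (Suc b)"] b(1) by simp_all
    let ?f = "\<lambda>x. j b (p (Suc b) (\<eta> (Suc b) x))"
    have f: "?f \<in> mod_hom R (X (Suc (b + r))) (X b)" by (rule mod_hom_compose[OF e(1) DD])
    have "?f (j (Suc (b + r)) y) = \<zero>\<^bsub>X b\<^esub>" if y: "y \<in> carrier (K (Suc (Suc (b + r))))" for y
    proof -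
      obtain z where z: "z \<in> carrier (X (Suc (Suc (b + r))))" "y = p (Suc (Suc (b + r))) z" using s'(13)[OF y] by blast
      have "\<eta> (Suc b) (j (Suc (b + r)) y) = j (Suc b) (p (Suc (Suc b)) (\<eta> (Suc (Suc b)) z))"
        using \<eta>(3)[rule_format, of "Suc b" z] z b(1) by simp
      then show ?thesis using jp0[OF s'(12)[OF mod_hom_closed[OF e(2) z(1)]]] by simp
    qed
    from ses_factor[OF s lmX f this] obtain g0
      where g0: "g0 \<in> mod_hom R (K (Suc (b + r))) (X b)" "\<forall>x\<in>carrier (X (Suc (b + r))). g0 (p (Suc (b + r)) x) = ?f x"
      by blast
    have "ext_zero 1 (K (b + r))" using r(2) by (intro perpD(2) perpK) simp_all
    from dualizable_extend[OF proj lmX ext_zero_extend[OF s fgK dualizable_fg[OF proj] this] g0(1)]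
    obtain g where g: "g \<in> mod_hom R (X (b + r)) (X b)" "\<forall>y\<in>carrier (K (Suc (b + r))). g (j (b + r) y) = g0 y" by blast
    have comm: "?f x = g (j (b + r) (p (Suc (b + r)) x))" if x: "x \<in> carrier (X (Suc (b + r)))" for x
      using g(2) g0(2) s'(12)[OF x] x by simp
    have nb: "n - Suc m = b" by (simp add: b_def)
    show ?case unfolding nb
    proof (intro exI[of _ "\<eta>(b := g)"] conjI allI impI ballI)
      show "(\<eta>(b := g)) t \<in> mod_hom R (X (t + r)) (X t)" if "b \<le> t" for t
        using that g(1) \<eta>(1) b(1) by (cases "t = b") simp_all
      show "(\<eta>(b := g)) t = (\<lambda>x. x)" if "n \<le> t" for t using that \<eta>(2) b(2) by simp
      show "j t (p (Suc t) ((\<eta>(b := g)) (Suc t) x)) = (\<eta>(b := g)) t (j (t + r) (p (Suc t + r) x))"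
        if "b \<le> t" "x \<in> carrier (X (Suc t + r))" for t x
        using that comm \<eta>(3) b(1) by (cases "t = b") simp_all
    qed
  qed
  from this[OF order_refl] obtain \<eta> where \<eta>: "\<forall>t. \<eta> t \<in> mod_hom R (X (t + r)) (X t)" "\<forall>t\<ge>n. \<eta> t = (\<lambda>x. x)"
    "\<forall>t. \<forall>x\<in>carrier (X (Suc t + r)). j t (p (Suc t) (\<eta> (Suc t) x)) = \<eta> t (j (t + r) (p (Suc t + r) x))"
    by auto
  have "periodic_resolution R K X j p \<eta> r n"
    using s proj r(1) \<eta> per(1-3) by (intro periodic_resolution.intro) simp_all
  moreover have "K 0 = M" using res(1) by (auto simp: K_def \<rho>_def kk_def G_def)
  ultimately show ?thesis by blast
qed


section \<open>The dimensions agree\<close>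

lemma inj_dim_reg_mod:
  assumes R: "ring R"
  shows "inj_dim R (reg_mod R) = Inf {ereal (real n) | n. \<exists>X d. injective_coresolution R X d n}"
  unfolding inj_dim_def injective_coresolution_def using R by (simp only: simp_thms imp_conjL)

lemma inj_dim_attained:
  assumes R: "ring R" and fin: "inj_dim R (reg_mod R) < \<infinity>"
  obtains n X d where "injective_coresolution R X d n" "inj_dim R (reg_mod R) = ereal (real n)"
    "\<And>m X' d'. injective_coresolution R X' d' m \<Longrightarrow> n \<le> m"
proof -
  let ?Q = "\<lambda>n. \<exists>X d. injective_coresolution R X d n"
  have "\<exists>n. ?Q n" using fin unfolding inj_dim_reg_mod[OF R] Inf_less_iff by blast
  then have Q: "?Q (LEAST n. ?Q n)" by (rule LeastI_ex)
  have le: "(LEAST n. ?Q n) \<le> m" if "?Q m" for m using that by (rule Least_le)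
  have "inj_dim R (reg_mod R) = ereal (real (LEAST n. ?Q n))"
    unfolding inj_dim_reg_mod[OF R]
  proof (rule antisym)
    show "Inf {ereal (real n) | n. ?Q n} \<le> ereal (real (LEAST n. ?Q n))" using Q by (intro Inf_lower) blast
    show "ereal (real (LEAST n. ?Q n)) \<le> Inf {ereal (real n) | n. ?Q n}"
    proof (rule Inf_greatest)
      fix x assume "x \<in> {ereal (real n) | n. ?Q n}"
      then obtain m where "x = ereal (real m)" "?Q m" by blast
      then show "ereal (real (LEAST n. ?Q n)) \<le> x" using le by simp
    qed
  qed
  with Q le show ?thesis using that by blast
qed

theorem mainTheorem2:
  fixes k :: "('k, 'r) ring_scheme" and A :: "('k, 'a, 'm) module_scheme"
  assumes "artin_algebra k A"
    and "gorenstein_algebra A"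
    and "\<And>G. Gproj A G \<Longrightarrow> periodic_mod A G"
  shows "qgldim A = (SUP M\<in>fg_mod A. Gpd A M) \<and>
    (SUP M\<in>fg_mod A. Gpd A M) = Ggldim A \<and>
    Ggldim A = inj_dim A (reg_mod A)"
proof -
  interpret alg: artin_algebra k A by (rule assms(1))
  have ring: "ring A" by unfold_locales
  note op = op_ring_ring[OF ring]
  have fin: "inj_dim A (reg_mod A) < \<infinity>" "inj_dim (op_ring A) (reg_mod (op_ring A)) < \<infinity>"
    using assms(2) by (simp_all add: gorenstein_algebra_def)
  obtain n X d where X: "injective_coresolution A X d n" "inj_dim A (reg_mod A) = ereal (real n)"
    "\<And>m X' d'. injective_coresolution A X' d' m \<Longrightarrow> n \<le> m"
    by (rule inj_dim_attained[OF ring fin(1)]) blast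
  obtain n' X' d' where X': "injective_coresolution (op_ring A) X' d' n'"
    by (rule inj_dim_attained[OF op fin(2)]) blast
  interpret gorenstein_ring A X d n X' d' n'
    by (intro gorenstein_ring.intro gorenstein_ring_axioms.intro X(1) X' alg.noetherian)
  have zero: "zero_obj \<in> fg_mod A" using dualizable_fg[OF dualizable_zero_obj[OF ring]] by (simp add: fg_mod_iff)
  have Xn: "X (- int n) \<in> fg_mod A" using cpx(1) by (simp add: fg_mod_iff)
  have no_split: "\<not> ext_zero n (X (- int n))" if "n = Suc m" for m
    using shorten[OF that _ noeth] X(3)[of _ _ m] that by auto
  have G: "Ggldim A = ereal (real n)"
    unfolding Ggldim_def
  proof (rule antisym)
    show "(SUP M\<in>fg_mod A. Gpd A M) \<le> ereal (real n)" using Gpd_le by (intro SUP_least) (simp add: fg_mod_iff)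
    show "ereal (real n) \<le> (SUP M\<in>fg_mod A. Gpd A M)"
    proof (cases n)
      case 0
      then show ?thesis using SUP_upper2[OF zero Gpd_nonneg] by (simp add: zero_ereal_def)
    next
      case (Suc m)
      have "ereal (real n) \<le> Gpd A (X (- int n))"
        using Gpd_ext_zero no_split[OF Suc] by (meson not_le)
      then show ?thesis by (rule SUP_upper2[OF Xn])
    qed
  qed
  have "qgldim A = ereal (real n)"
    unfolding qgldim_def
  proof (rule antisym)
    have "qpd A M \<le> ereal (real n)" if M: "M \<in> fg_mod A" for M
    proof -
      have "fg_module A M" using M by (simp add: fg_mod_iff)
      from periodic_resolution_exists[OF assms(3) this] obtain K T j p \<eta> r
        where *: "periodic_resolution A K T j p \<eta> r n" "K 0 = M" by blast
      show ?thesis using periodic_resolution.qpd_le[OF *(1)] *(2) by simp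
    qed
    then show "(SUP M\<in>fg_mod A. qpd A M) \<le> ereal (real n)" by (rule SUP_least)
    show "ereal (real n) \<le> (SUP M\<in>fg_mod A. qpd A M)"
    proof (cases n)
      case 0
      then show ?thesis using SUP_upper[OF zero, of "qpd A"] by (simp add: qpd_def zero_ereal_def)
    next
      case (Suc m)
      have "ereal (real n) \<le> qpd A (X (- int n))"
        using qpd_ext_zero[OF cpx(1) Suc] no_split[OF Suc] by (meson not_le)
      then show ?thesis by (rule SUP_upper2[OF Xn])
    qed
  qed
  with G X(2) show ?thesis by (simp add: Ggldim_def)
qed

end
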